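(* Let $P$ be a path-connected polyhedron with basepoint $\ast$ and let $(X,\star)$ be a pointed locally compact Polish space. There exists a definable right action of the definable group $[(S^1,\bullet),(P,\ast)]$ (where $\bullet$ is a basepoint of $S^1$) on the semidefinable set $[(X,\star),(P,\ast)]$ whose semidefinable set of orbits $[(X,\star),(P,\ast)]/[(S^1,\bullet),(P,\ast)]$ is definably isomorphic to the semidefinable set $[X,P]$.
   Context: A polyhedron is a space homeomorphic to the realization of a countable locally finite simplicial complex. Spaces of (basepoint-preserving) continuous maps carry the compact-open topology, and are Polish here. $[(X,\star),(P,\ast)]$ is the quotient of the Polish space of basepoint-preserving maps by basepoint-preserving homotopy; $[X,P]$ is the quotient of the space of all continuous maps by (free) homotopy. $[(S^1,\bullet),(P,\ast)]=\pi_1(P,\ast)$ with its usual group structure. A semidefinable set is a quotient $Y/E$ of a Polish space $Y$ by an analytic equivalence relation $E$. A function $Y/E\to Z/F$ is definable if it lifts to a Borel function $Y\to Z$. A definable isomorphism of semidefinable sets is a definable bijection whose inverse is also definable. A definable left action of a group $\Gamma$ on $Y/E$ is a group action $\Gamma\times Y/E\to Y/E$ such that for each $\gamma\in\Gamma$ the map $y\mapsto\gamma\cdot y$ is a definable function; a definable right action is a definable left action of the opposite group. The orbit space is the semidefinable set $Y/F$ where $x\,F\,y$ iff some $\gamma\in\Gamma$ carries the $E$-class of $x$ to the $E$-class of $y$. *)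

theory Defs
  imports "HOL-Analysis.Analysis" "HOL-Algebra.Group_Action"
begin

section \<open>Polyhedra\<close>

text \<open>Every countable simplicial complex is isomorphic to one whose vertices are natural
  numbers, so vertices are taken in \<^typ>\<open>nat\<close>. Simplices are nonempty.\<close>

definition simplicial_complex_on_nat :: "nat set set \<Rightarrow> bool" where
  "simplicial_complex_on_nat K \<longleftrightarrow>
     (\<forall>\<sigma>\<in>K. finite \<sigma> \<and> \<sigma> \<noteq> {}) \<and> (\<forall>\<sigma>\<in>K. \<forall>\<tau>. \<tau> \<subseteq> \<sigma> \<and> \<tau> \<noteq> {} \<longrightarrow> \<tau> \<in> K)"

definition locally_finite_complex :: "nat set set \<Rightarrow> bool" where
  "locally_finite_complex K \<longleftrightarrow> (\<forall>v\<in>\<Union>K. finite {\<sigma>\<in>K. v \<in> \<sigma>})"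

text \<open>Points of the realization are given by their barycentric coordinates.\<close>

definition realization_points :: "nat set set \<Rightarrow> (nat \<Rightarrow> real) set" where
  "realization_points K =
     {t. (\<forall>v. 0 \<le> t v) \<and> {v. t v \<noteq> 0} \<in> K \<and> (\<Sum>v | t v \<noteq> 0. t v) = 1}"

definition closed_simplex :: "nat set set \<Rightarrow> nat set \<Rightarrow> (nat \<Rightarrow> real) set" where
  "closed_simplex K \<sigma> = {t \<in> realization_points K. {v. t v \<noteq> 0} \<subseteq> \<sigma>}"

text \<open>The weak topology: a set is open iff its trace on each closed simplex is open for the
  Euclidean topology of that simplex (which is the one induced by pointwise convergence of
  barycentric coordinates).\<close>

definition realization :: "nat set set \<Rightarrow> (nat \<Rightarrow> real) topology" where
  "realization K = topology (\<lambda>U. U \<subseteq> realization_points K \<and>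
     (\<forall>\<sigma>\<in>K. openin (subtopology (powertop_real UNIV) (closed_simplex K \<sigma>))
                    (U \<inter> closed_simplex K \<sigma>)))"

lemma openin_realization:
  "openin (realization K) U \<longleftrightarrow> U \<subseteq> realization_points K \<and>
     (\<forall>\<sigma>\<in>K. openin (subtopology (powertop_real UNIV) (closed_simplex K \<sigma>))
                    (U \<inter> closed_simplex K \<sigma>))"
proof -
  let ?T = "\<lambda>\<sigma>. subtopology (powertop_real UNIV) (closed_simplex K \<sigma>)"
  let ?P = "\<lambda>U. U \<subseteq> realization_points K \<and> (\<forall>\<sigma>\<in>K. openin (?T \<sigma>) (U \<inter> closed_simplex K \<sigma>))"
  have "istopology ?P"
    unfolding istopology_def
  proof (intro conjI allI impI)
    fix S T assume S: "?P S" and T: "?P T"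
    then show "S \<inter> T \<subseteq> realization_points K" by blast
    show "\<forall>\<sigma>\<in>K. openin (?T \<sigma>) (S \<inter> T \<inter> closed_simplex K \<sigma>)"
    proof
      fix \<sigma> assume "\<sigma> \<in> K"
      with S T have "openin (?T \<sigma>) ((S \<inter> closed_simplex K \<sigma>) \<inter> (T \<inter> closed_simplex K \<sigma>))"
        using openin_Int by blast
      moreover have "(S \<inter> closed_simplex K \<sigma>) \<inter> (T \<inter> closed_simplex K \<sigma>)
          = S \<inter> T \<inter> closed_simplex K \<sigma>" by blast
      ultimately show "openin (?T \<sigma>) (S \<inter> T \<inter> closed_simplex K \<sigma>)" by simp
    qed
  next
    fix \<U> assume U: "\<forall>S\<in>\<U>. ?P S"
    then show "\<Union>\<U> \<subseteq> realization_points K" by blast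
    show "\<forall>\<sigma>\<in>K. openin (?T \<sigma>) (\<Union>\<U> \<inter> closed_simplex K \<sigma>)"
    proof
      fix \<sigma> assume "\<sigma> \<in> K"
      with U have "openin (?T \<sigma>) (\<Union>S\<in>\<U>. S \<inter> closed_simplex K \<sigma>)"
        by (intro openin_Union) auto
      moreover have "(\<Union>S\<in>\<U>. S \<inter> closed_simplex K \<sigma>) = \<Union>\<U> \<inter> closed_simplex K \<sigma>" by blast
      ultimately show "openin (?T \<sigma>) (\<Union>\<U> \<inter> closed_simplex K \<sigma>)" by simp
    qed
  qed
  then show ?thesis unfolding realization_def by (simp add: topology_inverse')
qed

definition polyhedron_space :: "'a topology \<Rightarrow> bool" where
  "polyhedron_space P \<longleftrightarrow>
     (\<exists>K. simplicial_complex_on_nat K \<and> locally_finite_complex K \<and>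
          P homeomorphic_space realization K)"

section \<open>Polish spaces, analytic sets, Borel functions\<close>

definition Polish_space :: "'a topology \<Rightarrow> bool" where
  "Polish_space X \<longleftrightarrow> completely_metrizable_space X \<and> separable_space X"

text \<open>A subset of a Polish space is analytic if it is a continuous image of a Polish space.
  A Polish space has at most continuum many points, so up to homeomorphism it lives on
  \<^typ>\<open>nat \<Rightarrow> nat\<close>. The Polish space \<open>W\<close> may be empty.\<close>

definition analytic_in :: "'a topology \<Rightarrow> 'a set \<Rightarrow> bool" where
  "analytic_in X A \<longleftrightarrow>
     (\<exists>(W :: (nat \<Rightarrow> nat) topology) f.
        Polish_space W \<and> continuous_map W X f \<and> f ` topspace W = A)"

definition Borel_algebra :: "'a topology \<Rightarrow> 'a measure" where
  "Borel_algebra X = sigma (topspace X) {U. openin X U}"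

definition Borel_function :: "'a topology \<Rightarrow> 'b topology \<Rightarrow> ('a \<Rightarrow> 'b) \<Rightarrow> bool" where
  "Borel_function X Y g \<longleftrightarrow> g \<in> measurable (Borel_algebra X) (Borel_algebra Y)"

section \<open>Semidefinable sets\<close>

record 'a presentation =
  ambient :: "'a topology"
  eqrel :: "('a \<times> 'a) set"

definition quotient_set :: "'a presentation \<Rightarrow> 'a set set" where
  "quotient_set A = topspace (ambient A) // eqrel A"

definition semidefinable :: "'a presentation \<Rightarrow> bool" where
  "semidefinable A \<longleftrightarrow> Polish_space (ambient A) \<and> equiv (topspace (ambient A)) (eqrel A) \<and>
     analytic_in (prod_topology (ambient A) (ambient A)) (eqrel A)"

text \<open>Only the values of \<open>f\<close> on \<^term>\<open>quotient_set A\<close> matter; since \<open>g\<close> is a Borel function, it maps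
  the ambient space of \<open>A\<close> into that of \<open>B\<close>, so \<open>f\<close> maps \<^term>\<open>quotient_set A\<close> to \<^term>\<open>quotient_set B\<close>.\<close>

definition definable_function ::
    "'a presentation \<Rightarrow> 'b presentation \<Rightarrow> ('a set \<Rightarrow> 'b set) \<Rightarrow> bool" where
  "definable_function A B f \<longleftrightarrow>
     (\<exists>g. Borel_function (ambient A) (ambient B) g \<and>
          (\<forall>y\<in>topspace (ambient A). f (eqrel A `` {y}) = eqrel B `` {g y}))"

definition definable_isomorphism ::
    "'a presentation \<Rightarrow> 'b presentation \<Rightarrow> ('a set \<Rightarrow> 'b set) \<Rightarrow> bool" where
  "definable_isomorphism A B f \<longleftrightarrow>
     semidefinable A \<and> semidefinable B \<and> bij_betw f (quotient_set A) (quotient_set B) \<and>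
     definable_function A B f \<and> definable_function B A (inv_into (quotient_set A) f)"

definition definably_isomorphic :: "'a presentation \<Rightarrow> 'b presentation \<Rightarrow> bool" where
  "definably_isomorphic A B \<longleftrightarrow> (\<exists>f. definable_isomorphism A B f)"

section \<open>Definable actions\<close>

definition definable_left_action ::
    "('g, 'm) monoid_scheme \<Rightarrow> 'a presentation \<Rightarrow> ('g \<Rightarrow> 'a set \<Rightarrow> 'a set) \<Rightarrow> bool" where
  "definable_left_action G A \<phi> \<longleftrightarrow>
     semidefinable A \<and> group_action G (quotient_set A) \<phi> \<and>
     (\<forall>\<gamma>\<in>carrier G. definable_function A A (\<phi> \<gamma>))"

definition opposite_group :: "'g monoid \<Rightarrow> 'g monoid" where
  "opposite_group G = \<lparr>carrier = carrier G, mult = (\<lambda>x y. y \<otimes>\<^bsub>G\<^esub> x), one = \<one>\<^bsub>G\<^esub>\<rparr>"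

definition definable_right_action ::
    "'g monoid \<Rightarrow> 'a presentation \<Rightarrow> ('g \<Rightarrow> 'a set \<Rightarrow> 'a set) \<Rightarrow> bool" where
  "definable_right_action G A \<phi> \<longleftrightarrow> definable_left_action (opposite_group G) A \<phi>"

definition orbit_space ::
    "('g, 'm) monoid_scheme \<Rightarrow> 'a presentation \<Rightarrow> ('g \<Rightarrow> 'a set \<Rightarrow> 'a set) \<Rightarrow> 'a presentation" where
  "orbit_space G A \<phi> =
     \<lparr>ambient = ambient A,
      eqrel = {(x, y). x \<in> topspace (ambient A) \<and> y \<in> topspace (ambient A) \<and>
                 (\<exists>\<gamma>\<in>carrier G. \<phi> \<gamma> (eqrel A `` {x}) = eqrel A `` {y})}\<rparr>"

section \<open>Mapping spaces and homotopy classes\<close>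

text \<open>A continuous map is represented by its unique extensional representative, so that
  equality of maps is equality on the domain.\<close>

definition maps :: "'a topology \<Rightarrow> 'b topology \<Rightarrow> ('a \<Rightarrow> 'b) set" where
  "maps X Y = {f \<in> extensional (topspace X). continuous_map X Y f}"

definition compact_open_topology :: "'a topology \<Rightarrow> 'b topology \<Rightarrow> ('a \<Rightarrow> 'b) topology" where
  "compact_open_topology X Y =
     topology_generated_by {{f \<in> maps X Y. f ` C \<subseteq> U} | C U. compactin X C \<and> openin Y U}"

lemma topspace_compact_open_topology [simp]:
  "topspace (compact_open_topology X Y) = maps X Y"
proof -
  have "maps X Y \<in> {{f \<in> maps X Y. f ` C \<subseteq> U} | C U. compactin X C \<and> openin Y U}"
    by (rule CollectI, rule exI[of _ "{}"], rule exI[of _ "{}"]) auto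
  then show ?thesis
    unfolding compact_open_topology_def topology_generated_by_topspace by blast
qed

definition homotopy_classes :: "'a topology \<Rightarrow> 'b topology \<Rightarrow> ('a \<Rightarrow> 'b) presentation" where
  "homotopy_classes X P =
     \<lparr>ambient = compact_open_topology X P,
      eqrel = {(f, g). f \<in> maps X P \<and> g \<in> maps X P \<and> homotopic_with (\<lambda>_. True) X P f g}\<rparr>"

definition pointed_maps :: "'a topology \<Rightarrow> 'a \<Rightarrow> 'b topology \<Rightarrow> 'b \<Rightarrow> ('a \<Rightarrow> 'b) set" where
  "pointed_maps X x P p = {f \<in> maps X P. f x = p}"

definition pointed_homotopy_classes ::
    "'a topology \<Rightarrow> 'a \<Rightarrow> 'b topology \<Rightarrow> 'b \<Rightarrow> ('a \<Rightarrow> 'b) presentation" where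
  "pointed_homotopy_classes X x P p =
     \<lparr>ambient = subtopology (compact_open_topology X P) (pointed_maps X x P p),
      eqrel = {(f, g). f \<in> pointed_maps X x P p \<and> g \<in> pointed_maps X x P p \<and>
                 homotopic_with (\<lambda>h. h x = p) X P f g}\<rparr>"

section \<open>The fundamental group\<close>

definition circle :: "complex topology" where
  "circle = top_of_set (sphere 0 1)"

text \<open>The circle with basepoint \<open>b\<close> is parametrized by \<open>s \<mapsto> b * cis (2 * pi * s)\<close> for
  \<open>0 \<le> s \<le> 1\<close>; under this parametrization the following is concatenation of loops, first \<open>f\<close>
  and then \<open>g\<close>, each at double speed.\<close>

definition circle_concat :: "complex \<Rightarrow> (complex \<Rightarrow> 'b) \<Rightarrow> (complex \<Rightarrow> 'b) \<Rightarrow> complex \<Rightarrow> 'b" where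
  "circle_concat b f g =
     (\<lambda>z\<in>sphere 0 1. let s = Arg2pi (z / b) / (2 * pi) in
        if s \<le> 1 / 2 then f (b * cis (2 * pi * (2 * s)))
        else g (b * cis (2 * pi * (2 * s - 1))))"

definition fundamental_group ::
    "complex \<Rightarrow> 'b topology \<Rightarrow> 'b \<Rightarrow> (complex \<Rightarrow> 'b) set monoid" where
  "fundamental_group b P p =
     (let A = pointed_homotopy_classes circle b P p in
      \<lparr>carrier = quotient_set A,
       mult = (\<lambda>\<alpha> \<beta>. \<Union>f\<in>\<alpha>. \<Union>g\<in>\<beta>. eqrel A `` {circle_concat b f g}),
       one = eqrel A `` {\<lambda>z\<in>sphere 0 1. p}\<rparr>)"

end

(* Points of a polyhedron P near y can be dragged along any path issuing from y by a homotopy of P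
   that starts at the identity and depends continuously on parameters. Composing f : X -> P with
   such a homotopy moves f(x) along the path, continuously in f and without any homotopy extension
   property of (X, x). A loop l at p acts on [f] by moving f(x) along l; a homotopy whose track at x
   is null-homotopic is deformed, by the same sliding with one more parameter, into a pointed one,
   so the action is well defined, and two pointed maps are in the same orbit iff they are freely
   homotopic. Countably many slides collapsing open sets of P to p give a Borel choice of a pointed
   map freely homotopic to a given map. The homotopy relations are analytic as continuous images of
   closed subspaces of C([0,1] x X, P), which is Polish because X is locally compact. *)

theory Submission
  imports Defs
begin

section \<open>The realization of a locally finite complex\<close>

text \<open>Slides are written down in barycentric coordinates. A point y near q cannot be pushed
  straight to q, because the supports of the two need not span a simplex; it passes through the
  normalized coordinatewise minimum of q and y, whose support lies in both. Closeness is measured by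
  \<open>overlap\<close>, and the thresholds 1/4, 1/2, 3/4 separate the points that rest, those that
  get all the way to q, and those that are carried along the whole path. A slide is a map of P
  alone, so a loop acts on mapping spaces by postcomposition, and this is why the action has
  continuous lifts. The extra parameter t lets the path vary: when the track of a homotopy is
  null-homotopic, the contraction of the track supplies for every time t a path from the current
  position of the basepoint to p. At both ends of the homotopy this path is constant at p, so the
  slides there keep the basepoint still and change the end maps only within their pointed classes.
  Tracks are compared up to path homotopy in a copy S of P inside
  \<open>nat \<Rightarrow> real\<close>, so only classes of loops matter.\<close>

lemma closed_simplex_eq:
  assumes "simplicial_complex_on_nat K" "\<sigma> \<in> K"
  shows "closed_simplex K \<sigma> =
    {t. (\<forall>v. 0 \<le> t v) \<and> (\<forall>v. v \<notin> \<sigma> \<longrightarrow> t v = 0) \<and> (\<Sum>v\<in>\<sigma>. t v) = 1}"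
proof -
  have fin: "finite \<sigma>" and faces: "\<And>\<tau>. \<tau> \<subseteq> \<sigma> \<Longrightarrow> \<tau> \<noteq> {} \<Longrightarrow> \<tau> \<in> K"
    using assms unfolding simplicial_complex_on_nat_def by blast+
  have sum: "(\<Sum>v | t v \<noteq> 0. t v) = (\<Sum>v\<in>\<sigma>. t v)" if "{v. t v \<noteq> 0} \<subseteq> \<sigma>" for t :: "nat \<Rightarrow> real"
    by (rule sum.mono_neutral_left) (use fin that in auto)
  show ?thesis
  proof (intro Set.set_eqI iffI)
    fix t assume "t \<in> closed_simplex K \<sigma>"
    then show "t \<in> {t. (\<forall>v. 0 \<le> t v) \<and> (\<forall>v. v \<notin> \<sigma> \<longrightarrow> t v = 0) \<and> (\<Sum>v\<in>\<sigma>. t v) = 1}"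
      using sum[of t] by (auto simp: closed_simplex_def realization_points_def)
  next
    fix t :: "nat \<Rightarrow> real" assume t: "t \<in> {t. (\<forall>v. 0 \<le> t v) \<and> (\<forall>v. v \<notin> \<sigma> \<longrightarrow> t v = 0) \<and> (\<Sum>v\<in>\<sigma>. t v) = 1}"
    then have sub: "{v. t v \<noteq> 0} \<subseteq> \<sigma>" by auto
    \<comment> \<open>Coordinates with sum 1 cannot all vanish, so the support is nonempty and hence
      a face of \<sigma>.\<close>
    moreover have "{v. t v \<noteq> 0} \<noteq> {}"
    proof
      assume "{v. t v \<noteq> 0} = {}"
      then have "(\<Sum>v\<in>\<sigma>. t v) = 0" by auto
      moreover have "(\<Sum>v\<in>\<sigma>. t v) = 1" using t by blast
      ultimately show False by linarith
    qed
    ultimately show "t \<in> closed_simplex K \<sigma>"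
      using t sum[OF sub] faces[OF sub] by (auto simp: closed_simplex_def realization_points_def)
  qed
qed

text \<open>The simplex lies in the cube of all sequences in [0,1], compact by Tychonoff. It is
  closed there because \<open>closed_simplex_eq\<close> sums over the fixed finite set \<sigma> and
  not over the varying support.\<close>

lemma compact_closed_simplex:
  assumes "simplicial_complex_on_nat K" "\<sigma> \<in> K"
  shows "compact (closed_simplex K \<sigma>)"
proof -
  have fin: "finite \<sigma>"
    using assms unfolding simplicial_complex_on_nat_def by blast
  let ?B = "PiE UNIV (\<lambda>_. {0..1}) :: (nat \<Rightarrow> real) set"
  have "compactin (powertop_real UNIV) ?B"
    by (subst compactin_PiE) auto
  then have "compact ?B"
    by (simp add: euclidean_product_topology)
  moreover have "closed (closed_simplex K \<sigma>)"
    unfolding closed_simplex_eq[OF assms]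
    by (intro closed_Collect_conj closed_Collect_all closed_Collect_imp closed_Collect_le
        closed_Collect_eq continuous_intros open_Collect_const continuous_on_product_coordinates)
  moreover have "closed_simplex K \<sigma> \<subseteq> ?B"
  proof
    fix t assume t: "t \<in> closed_simplex K \<sigma>"
    have "t v \<le> 1" for v
    proof (cases "v \<in> \<sigma>")
      case True
      then have "t v \<le> (\<Sum>v\<in>\<sigma>. t v)"
        using t fin by (intro member_le_sum) (auto simp: closed_simplex_eq[OF assms])
      then show ?thesis using t by (simp add: closed_simplex_eq[OF assms])
    qed (use t in \<open>auto simp: closed_simplex_eq[OF assms]\<close>)
    then show "t \<in> ?B" using t by (auto simp: closed_simplex_eq[OF assms])
  qed
  ultimately show ?thesis
    by (metis compact_Int_closed inf.absorb_iff2)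
qed

text \<open>Local finiteness enters the proof only here: the open star of a vertex v of the support
  of y, which is open for pointwise convergence, is covered by finitely many closed
  simplices.\<close>

lemma realization_points_star:
  assumes "simplicial_complex_on_nat K" "locally_finite_complex K" "y \<in> realization_points K"
  obtains v where "0 < y v" "finite {\<sigma>\<in>K. v \<in> \<sigma>}"
    "\<And>z. z \<in> realization_points K \<Longrightarrow> 0 < z v \<Longrightarrow> \<exists>\<sigma>\<in>K. v \<in> \<sigma> \<and> z \<in> closed_simplex K \<sigma>"
proof -
  have sup: "{v. y v \<noteq> 0} \<in> K" using assms by (simp add: realization_points_def)
  then have "{v. y v \<noteq> 0} \<noteq> {}"
    using assms(1) by (metis simplicial_complex_on_nat_def)
  then obtain v where v: "y v \<noteq> 0" by auto
  then have "0 < y v" using assms(3) by (metis (mono_tags, lifting) less_eq_real_def mem_Collect_eq realization_points_def)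
  moreover have "finite {\<sigma>\<in>K. v \<in> \<sigma>}"
    using assms(2) sup v unfolding locally_finite_complex_def by auto
  moreover have "\<exists>\<sigma>\<in>K. v \<in> \<sigma> \<and> z \<in> closed_simplex K \<sigma>" if "z \<in> realization_points K" "0 < z v" for z
    using that by (intro bexI[of _ "{v. z v \<noteq> 0}"]) (auto simp: closed_simplex_def realization_points_def)
  ultimately show ?thesis using that by blast
qed

text \<open>The weak topology is a priori the finer one. Inside an open star only finitely many
  traces matter, so a neighbourhood for each of them can be chosen and the finitely many choices
  intersected.\<close>

lemma realization_eq_subspace:
  assumes "simplicial_complex_on_nat K" "locally_finite_complex K"
  shows "realization K = top_of_set (realization_points K)"
proof (unfold topology_eq, intro allI iffI)
  fix U
  let ?S = "realization_points K"
  assume "openin (realization K) U"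
  then have US: "U \<subseteq> ?S"
    and tr: "\<And>\<sigma>. \<sigma> \<in> K \<Longrightarrow> openin (top_of_set (closed_simplex K \<sigma>)) (U \<inter> closed_simplex K \<sigma>)"
    by (auto simp: openin_realization euclidean_product_topology)
  show "openin (top_of_set ?S) U"
  proof (subst openin_subopen, intro ballI)
    fix y assume "y \<in> U"
    then have "y \<in> ?S" using US by blast
    obtain v where v: "0 < y v" "finite {\<sigma>\<in>K. v \<in> \<sigma>}"
      and star: "\<And>z. z \<in> ?S \<Longrightarrow> 0 < z v \<Longrightarrow> \<exists>\<sigma>\<in>K. v \<in> \<sigma> \<and> z \<in> closed_simplex K \<sigma>"
      by (rule realization_points_star[OF assms \<open>y \<in> ?S\<close>]) blast
    have "\<exists>V. open V \<and> y \<in> V \<and> V \<inter> closed_simplex K \<sigma> \<subseteq> U" if "\<sigma> \<in> K" for \<sigma>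
    proof (cases "y \<in> closed_simplex K \<sigma>")
      case True
      then show ?thesis
        using tr[OF that] \<open>y \<in> U\<close> by (auto simp: openin_open)
    next
      \<comment> \<open>If y is not in the simplex, removing the closed simplex leaves a
        neighbourhood with empty trace.\<close>
      case False
      have "closed (closed_simplex K \<sigma>)"
        using compact_closed_simplex[OF assms(1) that] by (rule compact_imp_closed)
      with False show ?thesis
        by (intro exI[of _ "- closed_simplex K \<sigma>"]) auto
    qed
    then obtain V where V: "\<And>\<sigma>. \<sigma> \<in> K \<Longrightarrow> open (V \<sigma>) \<and> y \<in> V \<sigma> \<and> V \<sigma> \<inter> closed_simplex K \<sigma> \<subseteq> U"
      by metis
    define T where "T = ?S \<inter> ({z. 0 < z v} \<inter> (\<Inter>\<sigma>\<in>{\<sigma>\<in>K. v \<in> \<sigma>}. V \<sigma>))"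
    have "open ({z::nat\<Rightarrow>real. 0 < z v} \<inter> (\<Inter>\<sigma>\<in>{\<sigma>\<in>K. v \<in> \<sigma>}. V \<sigma>))"
      using v V by (intro open_Int open_INT open_Collect_less continuous_intros
          continuous_on_product_coordinates) auto
    then have "openin (top_of_set ?S) T"
      unfolding T_def by (simp add: openin_open_Int)
    moreover have "y \<in> T" using v V \<open>y \<in> U\<close> US by (auto simp: T_def)
    moreover have "T \<subseteq> U"
    proof
      fix z assume "z \<in> T"
      then have "z \<in> ?S" "0 < z v" by (auto simp: T_def)
      then obtain \<sigma> where "\<sigma> \<in> K" "v \<in> \<sigma>" "z \<in> closed_simplex K \<sigma>" using star by blast
      moreover from this have "z \<in> V \<sigma>" using \<open>z \<in> T\<close> by (auto simp: T_def)
      ultimately show "z \<in> U" using V by blast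
    qed
    ultimately show "\<exists>T. openin (top_of_set ?S) T \<and> y \<in> T \<and> T \<subseteq> U" by blast
  qed
next
  fix U
  assume U: "openin (top_of_set (realization_points K)) U"
  then obtain V where V: "open V" "U = realization_points K \<inter> V" by (auto simp: openin_open)
  have "openin (top_of_set (closed_simplex K \<sigma>)) (U \<inter> closed_simplex K \<sigma>)" for \<sigma>
  proof -
    have "U \<inter> closed_simplex K \<sigma> = closed_simplex K \<sigma> \<inter> V"
      using V by (auto simp: closed_simplex_def)
    then show ?thesis using V by (simp add: openin_open_Int)
  qed
  then show "openin (realization K) U"
    using openin_subset[OF U] by (auto simp: openin_realization euclidean_product_topology)
qed

text \<open>Open stars lie in finite unions of compact simplices, so the space is locally compact;
  being also metrizable, it is completely metrizable. The countable base is inherited from the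
  product space.\<close>

lemma Polish_realization:
  assumes "simplicial_complex_on_nat K" "locally_finite_complex K"
  shows "Polish_space (realization K)"
proof -
  let ?S = "realization_points K"
  have "locally_compact_space (top_of_set ?S)"
    unfolding locally_compact_space_def
  proof (intro ballI)
    fix y assume "y \<in> topspace (top_of_set ?S)"
    then have yS: "y \<in> ?S" by simp
    obtain v where v: "0 < y v" "finite {\<sigma>\<in>K. v \<in> \<sigma>}"
      and star: "\<And>z. z \<in> ?S \<Longrightarrow> 0 < z v \<Longrightarrow> \<exists>\<sigma>\<in>K. v \<in> \<sigma> \<and> z \<in> closed_simplex K \<sigma>"
      by (rule realization_points_star[OF assms yS]) blast
    let ?U = "?S \<inter> {z. 0 < z v}" and ?C = "\<Union>\<sigma>\<in>{\<sigma>\<in>K. v \<in> \<sigma>}. closed_simplex K \<sigma>"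
    have "openin (top_of_set ?S) ?U"
      by (intro openin_open_Int open_Collect_less continuous_intros continuous_on_product_coordinates)
    moreover have "compact ?C"
      using v compact_closed_simplex[OF assms(1)] by (intro compact_UN) auto
    then have "compactin (top_of_set ?S) ?C"
      by (auto simp: compactin_subtopology closed_simplex_def)
    moreover have "?U \<subseteq> ?C" using star by auto
    ultimately show "\<exists>U C. openin (top_of_set ?S) U \<and> compactin (top_of_set ?S) C \<and> y \<in> U \<and> U \<subseteq> C"
      using v yS by blast
  qed
  then have "completely_metrizable_space (top_of_set ?S)"
    by (intro locally_compact_imp_completely_metrizable_space metrizable_space_subtopology
        metrizable_space_euclidean)
  moreover obtain \<B> :: "(nat \<Rightarrow> real) set set" where "countable \<B>" "topological_basis \<B>"
    using ex_countable_basis by blast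
  then have "second_countable (euclidean :: (nat \<Rightarrow> real) topology)"
    unfolding second_countable_def
    by (metis open_openin topological_basisE topological_basis_open)
  then have "second_countable (top_of_set ?S)"
    by (rule second_countable_subtopology)
  ultimately show ?thesis
    by (simp add: Polish_space_def realization_eq_subspace[OF assms] second_countable_imp_separable_space)
qed

section \<open>Sliding points of the realization along paths\<close>

text \<open>For two points of the realization this is 1 minus half their l^1 distance: it is
  positive iff the supports meet, and 1 iff the points agree.\<close>

definition overlap :: "(nat \<Rightarrow> real) \<Rightarrow> (nat \<Rightarrow> real) \<Rightarrow> real" where
  "overlap q y = (\<Sum>v | q v \<noteq> 0. min (q v) (y v))"

lemma realization_pointsD:
  assumes "simplicial_complex_on_nat K" "y \<in> realization_points K"
  shows "0 \<le> y v" "finite {v. y v \<noteq> 0}" "{v. y v \<noteq> 0} \<in> K" "(\<Sum>v | y v \<noteq> 0. y v) = 1"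
  using assms by (auto simp: realization_points_def simplicial_complex_on_nat_def)

lemma overlap_eq_sum:
  assumes "simplicial_complex_on_nat K" "q \<in> realization_points K" "y \<in> realization_points K"
    and "finite F" "\<And>v. q v \<noteq> 0 \<Longrightarrow> y v \<noteq> 0 \<Longrightarrow> v \<in> F"
  shows "overlap q y = (\<Sum>v\<in>F. min (q v) (y v))"
proof -
  note q = realization_pointsD[OF assms(1,2)] and y = realization_pointsD[OF assms(1,3)]
  have "overlap q y = (\<Sum>v\<in>F \<union> {v. q v \<noteq> 0}. min (q v) (y v))"
    unfolding overlap_def using q y assms by (intro sum.mono_neutral_left) (auto simp: min_def)
  also have "\<dots> = (\<Sum>v\<in>F. min (q v) (y v))"
  proof (rule sum.mono_neutral_right)
    show "\<forall>i\<in>F \<union> {v. q v \<noteq> 0} - F. min (q i) (y i) = 0"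
      using q(1) y(1) assms(5) by (auto simp: min_def) (metis order_antisym_conv)+
  qed (use q assms in auto)
  finally show ?thesis .
qed

lemma overlap_self:
  assumes "simplicial_complex_on_nat K" "q \<in> realization_points K"
  shows "overlap q q = 1"
  using realization_pointsD[OF assms] by (simp add: overlap_def)

text \<open>The support of q changes with q, so no fixed finite sum computes \<open>overlap\<close>
  in a neighbourhood. The terms outside F are bounded by the mass that q has outside F.\<close>

lemma overlap_near:
  assumes "simplicial_complex_on_nat K" "q \<in> realization_points K" "y \<in> realization_points K" "finite F"
  shows "\<bar>overlap q y - (\<Sum>v\<in>F. min (q v) (y v))\<bar> \<le> 1 - (\<Sum>v\<in>F. q v)"
proof -
  note q = realization_pointsD[OF assms(1,2)] and y = realization_pointsD[OF assms(1,3)]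
  let ?D = "{v. q v \<noteq> 0}"
  have "overlap q y = (\<Sum>v\<in>F \<union> (?D - F). min (q v) (y v))"
    using assms q by (intro overlap_eq_sum) auto
  then have 1: "overlap q y - (\<Sum>v\<in>F. min (q v) (y v)) = (\<Sum>v\<in>?D - F. min (q v) (y v))"
    using assms q by (subst (asm) sum.union_disjoint) auto
  have "1 = (\<Sum>v\<in>F \<union> (?D - F). q v)"
    unfolding q(4)[symmetric] using q assms by (intro sum.mono_neutral_left) auto
  also have "\<dots> = (\<Sum>v\<in>F. q v) + (\<Sum>v\<in>?D - F. q v)"
    using assms q by (subst sum.union_disjoint) auto
  finally have 2: "1 - (\<Sum>v\<in>F. q v) = (\<Sum>v\<in>?D - F. q v)" by simp
  have "0 \<le> (\<Sum>v\<in>?D - F. min (q v) (y v))" using q y by (intro sum_nonneg) auto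
  moreover have "(\<Sum>v\<in>?D - F. min (q v) (y v)) \<le> (\<Sum>v\<in>?D - F. q v)" by (intro sum_mono) auto
  ultimately show ?thesis unfolding 1 2 by simp
qed

lemma continuous_on_overlap:
  assumes K: "simplicial_complex_on_nat K"
  shows "continuous_on (realization_points K \<times> realization_points K) (\<lambda>z. overlap (fst z) (snd z))"
  unfolding continuous_on_def
proof (rule ballI)
  let ?S = "realization_points K"
  fix z assume z: "z \<in> ?S \<times> ?S"
  \<comment> \<open>At the limit point itself F carries the full mass 1, so the error bound of
    \<open>overlap_near\<close> tends to 0.\<close>
  define F where "F = {v. fst z v \<noteq> 0}"
  have "fst z \<in> ?S" using z by (simp add: mem_Times_iff)
  from realization_pointsD(2,4)[OF K this] have F: "finite F" "(\<Sum>v\<in>F. fst z v) = 1"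
    by (simp_all add: F_def)
  let ?net = "at z within ?S \<times> ?S"
  have fst: "((\<lambda>z. fst z v) \<longlongrightarrow> fst z v) ?net" and snd: "((\<lambda>z. snd z v) \<longlongrightarrow> snd z v) ?net" for v
  proof -
    note c = continuous_on_product_then_coordinatewise[OF continuous_on_fst[OF continuous_on_id]]
      continuous_on_product_then_coordinatewise[OF continuous_on_snd[OF continuous_on_id]]
    show "((\<lambda>z. fst z v) \<longlongrightarrow> fst z v) ?net" "((\<lambda>z. snd z v) \<longlongrightarrow> snd z v) ?net"
      by (rule c[unfolded continuous_on_def, rule_format, OF z])+
  qed
  have "((\<lambda>z. 1 - (\<Sum>v\<in>F. fst z v)) \<longlongrightarrow> 1 - (\<Sum>v\<in>F. fst z v)) ?net"
    by (intro tendsto_intros fst)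
  then have "((\<lambda>z. 1 - (\<Sum>v\<in>F. fst z v)) \<longlongrightarrow> 0) ?net" using F by simp
  then have "((\<lambda>z. overlap (fst z) (snd z) - (\<Sum>v\<in>F. min (fst z v) (snd z v))) \<longlongrightarrow> 0) ?net"
    by (rule Lim_null_comparison[rotated])
      (auto simp: eventually_at_filter intro!: always_eventually overlap_near[OF K _ _ F(1)])
  moreover have "((\<lambda>z. \<Sum>v\<in>F. min (fst z v) (snd z v)) \<longlongrightarrow> (\<Sum>v\<in>F. min (fst z v) (snd z v))) ?net"
    by (intro tendsto_intros fst snd)
  ultimately have "((\<lambda>z. overlap (fst z) (snd z) - (\<Sum>v\<in>F. min (fst z v) (snd z v))
      + (\<Sum>v\<in>F. min (fst z v) (snd z v))) \<longlongrightarrow> 0 + (\<Sum>v\<in>F. min (fst z v) (snd z v))) ?net"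
    by (rule tendsto_add)
  then show "((\<lambda>z. overlap (fst z) (snd z)) \<longlongrightarrow> overlap (fst z) (snd z)) ?net"
    by (simp add: overlap_def F_def)
qed

text \<open>Points whose overlap with \<open>q\<close> is at least \<open>1/2\<close> are moved to \<open>q\<close>, first within their own
  simplex to the normalized minimum with \<open>q\<close> and then within the simplex of \<open>q\<close>; points of overlap
  at most \<open>1/4\<close> stay fixed. The numbers \<open>2 * a\<close> and \<open>2 * a - 1\<close> are the times of the two motions.\<close>

definition gather :: "(nat \<Rightarrow> real) \<Rightarrow> (nat \<Rightarrow> real) \<Rightarrow> real \<Rightarrow> nat \<Rightarrow> real" where
  "gather q y s v =
     (let w = overlap q y; a = max 0 (min 1 (4 * w - 1)) * min 1 (2 * s)
      in max 0 (1 - 2 * a) * y v + (1 - \<bar>2 * a - 1\<bar>) * (min (q v) (y v) / max w (1 / 4))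
         + max 0 (2 * a - 1) * q v)"

lemma gather_0: "gather q y 0 = y"
  by (rule ext) (simp add: gather_def)

lemma gather_self:
  assumes "simplicial_complex_on_nat K" "q \<in> realization_points K" "0 \<le> s"
  shows "gather q q s = q"
proof
  fix v
  define a where "a = min 1 (2 * s)"
  \<comment> \<open>The three weights are the hat functions centred at 0, 1/2 and 1, a partition of
    unity on [0,1].\<close>
  have a: "max 0 (1 - 2 * a) + (1 - \<bar>2 * a - 1\<bar>) + max 0 (2 * a - 1) = 1"
    using assms(3) unfolding a_def by linarith
  have "gather q q s v = (max 0 (1 - 2 * a) + (1 - \<bar>2 * a - 1\<bar>) + max 0 (2 * a - 1)) * q v"
    by (simp add: gather_def Let_def overlap_self[OF assms(1,2)] a_def distrib_right)
  then show "gather q q s v = q v" by (simp add: a)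
qed

lemma gather_near:
  assumes "1 / 2 \<le> overlap q y" "1 / 2 \<le> s"
  shows "gather q y s = q"
  by (rule ext) (use assms in \<open>simp add: gather_def\<close>)

lemma closed_simplex_convex:
  assumes K: "simplicial_complex_on_nat K" "\<sigma> \<in> K"
    and t: "t \<in> closed_simplex K \<sigma>" "u \<in> closed_simplex K \<sigma>" and c: "0 \<le> c" "0 \<le> d" "c + d = 1"
  shows "(\<lambda>v. c * t v + d * u v) \<in> closed_simplex K \<sigma>"
  using t c by (auto simp: closed_simplex_eq[OF K] sum.distrib sum_distrib_left[symmetric])

text \<open>The normalized minimum m is supported in the common support, hence lies in the simplex
  of y and in that of q. The first half of the motion is a segment in the former, the second half a
  segment in the latter, and simplices are convex.\<close>

lemma gather_in:
  assumes K: "simplicial_complex_on_nat K" and q: "q \<in> realization_points K"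
    and y: "y \<in> realization_points K" and s: "0 \<le> s"
  shows "gather q y s \<in> realization_points K"
proof -
  note qD = realization_pointsD[OF K q] and yD = realization_pointsD[OF K y]
  let ?Q = "{v. q v \<noteq> 0}" and ?Y = "{v. y v \<noteq> 0}"
  define w where "w = overlap q y"
  define a where "a = max 0 (min 1 (4 * w - 1)) * min 1 (2 * s)"
  have g: "gather q y s = (\<lambda>v. max 0 (1 - 2 * a) * y v
      + (1 - \<bar>2 * a - 1\<bar>) * (min (q v) (y v) / max w (1 / 4)) + max 0 (2 * a - 1) * q v)"
    by (rule ext) (simp add: gather_def Let_def w_def a_def)
  have a: "0 \<le> a" "a \<le> 1" using s unfolding a_def by (auto intro!: mult_nonneg_nonneg mult_le_one)
  have in_q: "q \<in> closed_simplex K ?Q" and in_y: "y \<in> closed_simplex K ?Y"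
    using q y by (auto simp: closed_simplex_def)
  show ?thesis
  proof (cases "a = 0")
    case True
    then show ?thesis using y by (simp add: g)
  next
    case False
    \<comment> \<open>Any motion forces the overlap above 1/4, so the denominator
      \<open>max w (1 / 4)\<close>, which keeps the formula continuous everywhere, is the true
      overlap.\<close>
    have w: "1 / 4 < w"
    proof (rule ccontr)
      assume "\<not> 1 / 4 < w"
      then have "max 0 (min 1 (4 * w - 1)) = 0" by linarith
      with False show False by (simp add: a_def)
    qed
    define m where "m = (\<lambda>v. min (q v) (y v) / w)"
    have "(\<Sum>v\<in>\<sigma>. m v) = 1" if "\<sigma> = ?Q \<or> \<sigma> = ?Y" for \<sigma>
      using that overlap_eq_sum[OF K q y, of \<sigma>] qD yD w
      by (auto simp: m_def w_def sum_divide_distrib[symmetric])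
    moreover have "0 \<le> m v" for v using qD(1)[of v] yD(1)[of v] w by (simp add: m_def)
    moreover have "m v = 0" if "q v = 0 \<or> y v = 0" for v
      using that qD(1)[of v] yD(1)[of v] by (auto simp: m_def)
    ultimately have m: "m \<in> closed_simplex K ?Q" "m \<in> closed_simplex K ?Y"
      unfolding closed_simplex_eq[OF K qD(3)] closed_simplex_eq[OF K yD(3)] by blast+
    show ?thesis
    proof (cases "a \<le> 1 / 2")
      case True
      then have "max 0 (1 - 2 * a) = 1 - 2 * a" "1 - \<bar>2 * a - 1\<bar> = 2 * a" "max 0 (2 * a - 1) = 0"
        "max w (1 / 4) = w" using w by linarith+
      then have "gather q y s = (\<lambda>v. (1 - 2 * a) * y v + (2 * a) * m v)"
        by (simp add: g m_def)
      then show ?thesis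
        using closed_simplex_convex[OF K yD(3) in_y m(2), of "1 - 2 * a" "2 * a"] a True
        by (simp add: closed_simplex_def)
    next
      case False
      then have "max 0 (1 - 2 * a) = 0" "1 - \<bar>2 * a - 1\<bar> = 2 - 2 * a" "max 0 (2 * a - 1) = 2 * a - 1"
        "max w (1 / 4) = w" using w by linarith+
      then have "gather q y s = (\<lambda>v. (2 - 2 * a) * m v + (2 * a - 1) * q v)"
        by (simp add: g m_def)
      then show ?thesis
        using closed_simplex_convex[OF K qD(3) m(1) in_q, of "2 - 2 * a" "2 * a - 1"] a False
        by (simp add: closed_simplex_def)
    qed
  qed
qed

text \<open>After gathering at q = G (t, 0), the increment of the path over q is added
  coordinatewise, how far along the path being damped by the overlap. The increment vanishes unless
  y has already reached q, and then the sum is just a point of the path; so the values stay in the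
  realization, and one formula gives continuity.\<close>

lemma realization_slide:
  fixes G :: "real \<times> real \<Rightarrow> nat \<Rightarrow> real"
  assumes K: "simplicial_complex_on_nat K" and G: "continuous_on ({0..1} \<times> {0..1}) G"
    and GS: "\<And>t s. t \<in> {0..1} \<Longrightarrow> s \<in> {0..1} \<Longrightarrow> G (t, s) \<in> realization_points K"
  obtains \<Phi> :: "real \<times> (nat \<Rightarrow> real) \<times> real \<Rightarrow> nat \<Rightarrow> real" and N
  where "continuous_on ({0..1} \<times> realization_points K \<times> {0..1}) \<Phi>"
    "\<And>t y s. t \<in> {0..1} \<Longrightarrow> y \<in> realization_points K \<Longrightarrow> s \<in> {0..1} \<Longrightarrow> \<Phi> (t, y, s) \<in> realization_points K"
    "\<And>t y. t \<in> {0..1} \<Longrightarrow> y \<in> realization_points K \<Longrightarrow> \<Phi> (t, y, 0) = y"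
    "\<And>t s. t \<in> {0..1} \<Longrightarrow> s \<in> {0..1} \<Longrightarrow> \<Phi> (t, G (t, 0), s) = G (t, max 0 (2 * s - 1))"
    "openin (top_of_set (realization_points K)) N" "G (0, 0) \<in> N"
    "\<And>y. y \<in> N \<Longrightarrow> \<Phi> (0, y, 1) = G (0, 1)"
proof -
  let ?S = "realization_points K"
  let ?D = "{0..1::real} \<times> ?S \<times> {0..1::real}"
  \<comment> \<open>\<open>mu\<close> is 0 up to overlap 1/2, below which gathering may be
    incomplete, and 1 from 3/4 on, so the points of N travel the whole path.\<close>
  define mu :: "real \<Rightarrow> real" where "mu w = max 0 (min 1 (4 * w - 2))" for w
  define \<Phi> where "\<Phi> = (\<lambda>(t, y, s) v. gather (G (t, 0)) y s v
      + G (t, max 0 (2 * s - 1) * mu (overlap (G (t, 0)) y)) v - G (t, 0) v)"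
  define N where "N = ?S \<inter> {y. 3 / 4 < overlap (G (0, 0)) y}"
  have mu: "0 \<le> mu w" "mu w \<le> 1" for w by (auto simp: mu_def)
  have ps: "max 0 (2 * s - 1) \<in> {0..1}" if "s \<in> {0..1}" for s :: real using that by auto
  have pm: "max 0 (2 * s - 1) * mu w \<in> {0..1}" if "s \<in> {0..1}" for s w
    using ps[OF that] mu[of w] by (auto intro!: mult_le_one)
  have cG0: "continuous_on ?D (\<lambda>z. G (fst z, 0))"
    by (rule continuous_on_compose2[OF G]) (auto intro!: continuous_intros)
  have cs: "continuous_on ?D (\<lambda>z. fst (snd z))" by (intro continuous_intros)
  note cy = continuous_on_product_then_coordinatewise[OF cs]
  have cp: "continuous_on ?D (\<lambda>z. (G (fst z, 0), fst (snd z)))"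
    by (rule continuous_on_Pair[OF cG0 cs])
  have "(\<lambda>z. (G (fst z, 0), fst (snd z))) ` ?D \<subseteq> ?S \<times> ?S"
    using GS by auto
  from continuous_on_compose2[OF continuous_on_overlap[OF K] cp this]
  have cw: "continuous_on ?D (\<lambda>z. overlap (G (fst z, 0)) (fst (snd z)))"
    by simp
  have cB: "continuous_on ?D (\<lambda>z. G (fst z, max 0 (2 * snd (snd z) - 1) * mu (overlap (G (fst z, 0)) (fst (snd z)))))"
    by (rule continuous_on_compose2[OF G])
      (use pm in \<open>auto simp: mu_def intro!: continuous_intros cw\<close>)
  note cq = continuous_on_product_then_coordinatewise[OF cG0]
  have f1: "continuous_on ?D \<Phi>"
  proof (rule continuous_on_coordinatewise_then_product)
    fix v
    have "continuous_on ?D (\<lambda>z. gather (G (fst z, 0)) (fst (snd z)) (snd (snd z)) v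
      + G (fst z, max 0 (2 * snd (snd z) - 1) * mu (overlap (G (fst z, 0)) (fst (snd z)))) v - G (fst z, 0) v)"
      unfolding gather_def Let_def
      by (intro continuous_intros cy cq cw continuous_on_product_then_coordinatewise[OF cB]) auto
    then show "continuous_on ?D (\<lambda>z. \<Phi> z v)"
      by (simp add: \<Phi>_def split_beta)
  qed
  have f2: "\<Phi> (t, y, s) \<in> ?S" if t: "t \<in> {0..1}" "y \<in> ?S" "s \<in> {0..1}" for t y s
  proof (cases "max 0 (2 * s - 1) * mu (overlap (G (t, 0)) y) = 0")
    case True
    then have "\<Phi> (t, y, s) = gather (G (t, 0)) y s"
      unfolding \<Phi>_def by (auto simp only: prod.case)
    then show ?thesis using gather_in[OF K GS, of t 0 y s] t by auto
  next
    case False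
    then have "1 / 2 \<le> s" "1 / 2 \<le> overlap (G (t, 0)) y"
      by (auto simp: mu_def max_def split: if_splits)
    then have "\<Phi> (t, y, s) = G (t, max 0 (2 * s - 1) * mu (overlap (G (t, 0)) y))"
      by (auto simp: \<Phi>_def gather_near)
    then show ?thesis using GS pm t by auto
  qed
  have f3: "\<Phi> (t, y, 0) = y" if "t \<in> {0..1}" "y \<in> ?S" for t y
    by (simp add: \<Phi>_def gather_0)
  have f4: "\<Phi> (t, G (t, 0), s) = G (t, max 0 (2 * s - 1))" if "t \<in> {0..1}" "s \<in> {0..1}" for t s
    using that GS[of t 0] by (auto simp: \<Phi>_def gather_self[OF K] overlap_self[OF K] mu_def)
  have f5: "openin (top_of_set ?S) N"
  proof -
    have "continuous_on ?S (\<lambda>y. overlap (G (0, 0)) y)"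
    proof -
      have "(\<lambda>y. (G (0, 0), y)) ` ?S \<subseteq> ?S \<times> ?S" using GS[of 0 0] by auto
      from continuous_on_compose2[OF continuous_on_overlap[OF K]
          continuous_on_Pair[OF continuous_on_const continuous_on_id] this]
      show ?thesis by simp
    qed
    from continuous_openin_preimage_gen[OF this open_greaterThan[of "3 / 4"]]
    show ?thesis by (simp add: N_def vimage_def)
  qed
  have f6: "G (0, 0) \<in> N" using GS[of 0 0] by (simp add: N_def overlap_self[OF K])
  have f7: "\<Phi> (0, y, 1) = G (0, 1)" if "y \<in> N" for y
    using that by (auto simp: \<Phi>_def N_def mu_def gather_near)
  show ?thesis by (rule that[OF f1 f2 f3 f4 f5 f6 f7])
qed

section \<open>Polish spaces and analytic sets\<close>

lemma (in Metric_space) separable_imp_second_countable: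
  assumes "separable_space mtopology"
  shows "second_countable mtopology"
proof -
  obtain C where C: "countable C" "C \<subseteq> M" "mtopology closure_of C = M"
    using assms by (auto simp: separable_space_def)
  let ?\<B> = "(\<lambda>(c, n). mball c (inverse (Suc n))) ` (C \<times> (UNIV :: nat set))"
  show ?thesis
    unfolding second_countable_def
  proof (intro exI[of _ ?\<B>] conjI allI impI ballI)
    show "countable ?\<B>" using C by auto
    show "openin mtopology V" if "V \<in> ?\<B>" for V using that by auto
    fix U x assume U: "openin mtopology U \<and> x \<in> U"
    then have x: "x \<in> M" and "\<exists>r>0. mball x r \<subseteq> U"
      unfolding openin_mtopology by blast+
    then obtain r where r: "0 < r" "mball x r \<subseteq> U" by blast
    obtain n where n: "inverse (real (Suc n)) < r / 2"
      using reals_Archimedean[of "r / 2"] r by auto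
    have "x \<in> mtopology closure_of C" using C x by simp
    then have "\<forall>r>0. \<exists>c\<in>C. c \<in> mball x r" unfolding metric_closure_of by blast
    moreover have "0 < inverse (real (Suc n))" by simp
    ultimately obtain c where c: "c \<in> C" "c \<in> mball x (inverse (Suc n))" by blast
    have "mball c (inverse (Suc n)) \<subseteq> mball x r"
    proof
      fix z assume "z \<in> mball c (inverse (Suc n))"
      then show "z \<in> mball x r"
        using c n triangle[of x c z] by simp
    qed
    then show "\<exists>V\<in>?\<B>. x \<in> V \<and> V \<subseteq> U"
      using c r by (intro bexI[of _ "mball c (inverse (Suc n))"]) (simp add: commute | blast)+
  qed
qed

lemma Polish_space_iff_second_countable:
  "Polish_space X \<longleftrightarrow> completely_metrizable_space X \<and> second_countable X"
proof -
  have "second_countable X" if X: "completely_metrizable_space X" "separable_space X"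
  proof -
    obtain M d where "Metric_space M d" "X = Metric_space.mtopology M d"
      using X(1) by (auto simp: completely_metrizable_space_def)
    then show ?thesis using X(2) Metric_space.separable_imp_second_countable by blast
  qed
  then show ?thesis
    unfolding Polish_space_def using second_countable_imp_separable_space by blast
qed

lemma Polish_imp_Hausdorff: "Polish_space X \<Longrightarrow> Hausdorff_space X"
  by (simp add: Polish_space_def completely_metrizable_imp_metrizable_space metrizable_imp_Hausdorff_space)

lemma Polish_space_closedin:
  "Polish_space X \<Longrightarrow> closedin X C \<Longrightarrow> Polish_space (subtopology X C)"
  by (simp add: Polish_space_iff_second_countable completely_metrizable_space_closedin
      second_countable_subtopology)

lemma Polish_space_homeomorphic:
  "X homeomorphic_space Y \<Longrightarrow> Polish_space X \<Longrightarrow> Polish_space Y"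
  unfolding Polish_space_def
  using homeomorphic_completely_metrizable_space homeomorphic_separable_space by blast

lemma second_countable_prod_topology:
  assumes "second_countable X" "second_countable Y"
  shows "second_countable (prod_topology X Y)"
proof -
  obtain \<A> where \<A>: "countable \<A>" "\<And>V. V \<in> \<A> \<Longrightarrow> openin X V"
    "\<And>U x. openin X U \<Longrightarrow> x \<in> U \<Longrightarrow> \<exists>V\<in>\<A>. x \<in> V \<and> V \<subseteq> U"
    using assms(1) unfolding second_countable_def by metis
  obtain \<B> where \<B>: "countable \<B>" "\<And>V. V \<in> \<B> \<Longrightarrow> openin Y V"
    "\<And>U x. openin Y U \<Longrightarrow> x \<in> U \<Longrightarrow> \<exists>V\<in>\<B>. x \<in> V \<and> V \<subseteq> U"
    using assms(2) unfolding second_countable_def by metis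
  show ?thesis
    unfolding second_countable_def
  proof (intro exI[of _ "(\<lambda>(A, B). A \<times> B) ` (\<A> \<times> \<B>)"] conjI allI impI ballI)
    show "countable ((\<lambda>(A, B). A \<times> B) ` (\<A> \<times> \<B>))" using \<A> \<B> by auto
    show "openin (prod_topology X Y) V" if "V \<in> (\<lambda>(A, B). A \<times> B) ` (\<A> \<times> \<B>)" for V
      using that \<A> \<B> by (auto simp: openin_prod_Times_iff)
    fix U z assume U: "openin (prod_topology X Y) U \<and> z \<in> U"
    then obtain V W where VW: "openin X V" "openin Y W" "fst z \<in> V" "snd z \<in> W" "V \<times> W \<subseteq> U"
      unfolding openin_prod_topology_alt by (metis prod.collapse)
    obtain A B where "A \<in> \<A>" "fst z \<in> A" "A \<subseteq> V" "B \<in> \<B>" "snd z \<in> B" "B \<subseteq> W"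
      using \<A>(3)[OF VW(1,3)] \<B>(3)[OF VW(2,4)] by blast
    then show "\<exists>V\<in>(\<lambda>(A, B). A \<times> B) ` (\<A> \<times> \<B>). z \<in> V \<and> V \<subseteq> U"
      using VW(5) by (intro bexI[of _ "A \<times> B"]) (auto simp: mem_Times_iff)
  qed
qed

lemma Polish_space_prod_topology:
  "Polish_space X \<Longrightarrow> Polish_space Y \<Longrightarrow> Polish_space (prod_topology X Y)"
  by (simp add: Polish_space_iff_second_countable completely_metrizable_space_prod_topology
      second_countable_prod_topology)

lemma Polish_space_top_of_set_compact:
  fixes S :: "'a :: {complete_space, second_countable_topology} set"
  assumes "compact S"
  shows "Polish_space (top_of_set S)"
proof -
  obtain \<B> :: "'a set set" where \<B>: "countable \<B>" "topological_basis \<B>"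
    using ex_countable_basis by blast
  have "second_countable (euclidean :: 'a topology)"
    unfolding second_countable_def
  proof (intro exI[of _ \<B>] conjI allI impI ballI)
    show "countable \<B>" by fact
    show "openin euclidean V" if "V \<in> \<B>" for V
      using that \<B> topological_basis_open by auto
    show "\<exists>V\<in>\<B>. x \<in> V \<and> V \<subseteq> U" if "openin euclidean U \<and> x \<in> U" for U x
      using that \<B>(2) by (metis open_openin topological_basisE)
  qed
  moreover have "closedin euclidean S" using assms compact_imp_closed by auto
  ultimately show ?thesis
    by (simp add: Polish_space_iff_second_countable second_countable_subtopology
        completely_metrizable_space_closedin completely_metrizable_space_euclidean)
qed

text \<open>A point of a T0 space is determined by the members of a base that contain it; the code
  of a point is its membership sequence along an enumeration.\<close>

lemma second_countable_t0_inj: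
  assumes "second_countable X" "t0_space X"
  obtains e :: "'a \<Rightarrow> nat \<Rightarrow> nat" where "inj_on e (topspace X)"
proof -
  obtain \<B> where \<B>: "countable \<B>" "\<And>V. V \<in> \<B> \<Longrightarrow> openin X V"
    "\<And>U x. openin X U \<Longrightarrow> x \<in> U \<Longrightarrow> \<exists>V\<in>\<B>. x \<in> V \<and> V \<subseteq> U"
    using assms(1) unfolding second_countable_def by metis
  \<comment> \<open>Inserting the empty set keeps the enumerated family nonempty even if the base is
    empty.\<close>
  let ?B = "from_nat_into (insert {} \<B>)"
  define e :: "'a \<Rightarrow> nat \<Rightarrow> nat" where "e x n = (if x \<in> ?B n then 1 else 0)" for x n
  have "inj_on e (topspace X)"
  proof (rule inj_onI, rule ccontr)
    fix x y assume xy: "x \<in> topspace X" "y \<in> topspace X" "e x = e y" "x \<noteq> y"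
    then obtain U where U: "openin X U" "x \<notin> U \<longleftrightarrow> y \<in> U"
      using assms(2) unfolding t0_space_def by blast
    then obtain V where "V \<in> \<B>" "x \<notin> V \<longleftrightarrow> y \<in> V"
      using \<B>(3)[OF U(1)] by (cases "x \<in> U") blast+
    moreover from this obtain n where "?B n = V"
      using from_nat_into_surj[of "insert {} \<B>" V] \<B>(1) by auto
    ultimately show False using fun_cong[OF xy(3), of n] by (auto simp: e_def split: if_splits)
  qed
  then show ?thesis using that by blast
qed

text \<open>\<open>analytic_in\<close> asks for a source space with points in
  \<open>nat \<Rightarrow> nat\<close>; pulling the topology back along the inverse of an injective
  coding provides one.\<close>

lemma Polish_space_copy:
  assumes "Polish_space X"
  obtains W :: "(nat \<Rightarrow> nat) topology" where "X homeomorphic_space W"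
proof -
  have X: "second_countable X"
    using assms by (simp add: Polish_space_iff_second_countable)
  have X0: "t0_space X"
    by (intro t1_imp_t0_space Hausdorff_imp_t1_space Polish_imp_Hausdorff assms)
  obtain e :: "'a \<Rightarrow> nat \<Rightarrow> nat" where e: "inj_on e (topspace X)"
    by (rule second_countable_t0_inj[OF X X0])
  let ?g = "inv_into (topspace X) e" and ?A = "e ` topspace X"
  let ?W = "pullback_topology ?A ?g X"
  have W: "topspace ?W = ?A" by (auto simp: topspace_pullback_topology e)
  have "continuous_map ?W X (id \<circ> ?g)"
    by (rule continuous_map_pullback) simp
  moreover have "continuous_map X ?W e"
  proof (rule continuous_map_pullback')
    show "continuous_map X X (?g \<circ> e)"
      by (rule continuous_map_eq[of X X id]) (auto simp: e)
  qed auto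
  ultimately have "homeomorphic_maps X ?W e ?g"
    using e by (auto simp: homeomorphic_maps_def W)
  then show ?thesis using that homeomorphic_space_def by blast
qed

lemma analytic_inI:
  assumes "Polish_space W" "continuous_map W X f" "f ` topspace W = A"
  shows "analytic_in X A"
proof -
  obtain V :: "(nat \<Rightarrow> nat) topology" where V: "W homeomorphic_space V"
    using Polish_space_copy[OF assms(1)] by blast
  then obtain g h where gh: "homeomorphic_maps W V g h"
    by (auto simp: homeomorphic_space_def)
  have "h ` topspace V = topspace W"
    using gh by (meson homeomorphic_imp_surjective_map homeomorphic_maps_map)
  then have "(f \<circ> h) ` topspace V = A" using assms(3) by (metis image_comp)
  moreover have "continuous_map V X (f \<circ> h)"
    using gh assms(2) by (meson continuous_map_compose homeomorphic_maps_def)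
  moreover have "Polish_space V" using Polish_space_homeomorphic[OF V assms(1)] .
  ultimately show ?thesis unfolding analytic_in_def by blast
qed

section \<open>Borel functions\<close>

lemma space_Borel_algebra [simp]: "space (Borel_algebra X) = topspace X"
  by (auto simp: Borel_algebra_def space_measure_of_conv)

lemma sets_Borel_algebra:
  "sets (Borel_algebra X) = sigma_sets (topspace X) {U. openin X U}"
  unfolding Borel_algebra_def by (rule sets_measure_of) (auto dest: openin_subset)

lemma openin_in_Borel_algebra: "openin X U \<Longrightarrow> U \<in> sets (Borel_algebra X)"
  by (simp add: sets_Borel_algebra sigma_sets.Basic)

lemma measurable_Borel_algebraI:
  assumes "\<And>x. x \<in> space M \<Longrightarrow> f x \<in> topspace Y"
    and "\<And>U. openin Y U \<Longrightarrow> f -` U \<inter> space M \<in> sets M"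
  shows "f \<in> measurable M (Borel_algebra Y)"
  unfolding Borel_algebra_def
  by (rule measurable_measure_of) (use assms in \<open>auto dest: openin_subset\<close>)

lemma continuous_imp_Borel_function:
  assumes "continuous_map X Y f"
  shows "Borel_function X Y f"
  unfolding Borel_function_def
proof (rule measurable_Borel_algebraI)
  fix U assume "openin Y U"
  then have "openin X {x \<in> topspace X. f x \<in> U}"
    using assms by (simp add: continuous_map_def)
  moreover have "f -` U \<inter> space (Borel_algebra X) = {x \<in> topspace X. f x \<in> U}" by auto
  ultimately show "f -` U \<inter> space (Borel_algebra X) \<in> sets (Borel_algebra X)"
    by (simp add: openin_in_Borel_algebra)
qed (use assms continuous_map_funspace in fastforce)

text \<open>On the cell D n of points whose first index is n the function is f n. The cells are open
  sets minus finite unions of open sets, hence Borel, and there are countably many.\<close>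

lemma Borel_function_piecewise:
  fixes N :: "nat \<Rightarrow> 'a set"
  assumes open_N: "\<And>n. openin X (N n)" and cover: "topspace X \<subseteq> (\<Union>n. N n)"
    and f: "\<And>n. continuous_map X Y (f n)"
  shows "Borel_function X Y (\<lambda>x. f (LEAST n. x \<in> N n) x)"
proof -
  define k where "k x = (LEAST n. x \<in> N n)" for x
  define D where "D n = N n - (\<Union>m<n. N m)" for n
  have kD: "x \<in> D (k x)" if x: "x \<in> topspace X" for x
  proof -
    have "\<exists>n. x \<in> N n" using x cover by blast
    then have "x \<in> N (k x)" unfolding k_def by (rule LeastI_ex)
    moreover have "x \<notin> N m" if "m < k x" for m using that unfolding k_def by (rule not_less_Least)
    ultimately show ?thesis unfolding D_def by blast
  qed
  have Dk: "k x = n" if "x \<in> D n" for x n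
    unfolding k_def by (rule Least_equality) (use that in \<open>auto simp: D_def simp flip: not_less\<close>)
  have "(\<lambda>x. f (k x) x) \<in> measurable (Borel_algebra X) (Borel_algebra Y)"
  proof (rule measurable_Borel_algebraI)
    fix x assume "x \<in> space (Borel_algebra X)"
    then show "f (k x) x \<in> topspace Y" using f[of "k x"] continuous_map_funspace by fastforce
  next
    fix U assume U: "openin Y U"
    define E where "E n = {x \<in> topspace X. f n x \<in> U}" for n
    have "N n \<in> sets (Borel_algebra X)" for n using open_N by (rule openin_in_Borel_algebra)
    then have "D n \<in> sets (Borel_algebra X)" for n
      unfolding D_def by (intro sets.Diff sets.finite_UN) auto
    moreover have "E n \<in> sets (Borel_algebra X)" for n
      unfolding E_def using f U by (intro openin_in_Borel_algebra) (simp add: continuous_map_def)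
    ultimately have "(\<Union>n. D n \<inter> E n) \<in> sets (Borel_algebra X)"
      by (intro sets.countable_UN sets.Int image_subsetI)
    moreover have "(\<lambda>x. f (k x) x) -` U \<inter> space (Borel_algebra X) = (\<Union>n. D n \<inter> E n)"
    proof (intro Set.set_eqI iffI)
      fix x assume "x \<in> (\<lambda>x. f (k x) x) -` U \<inter> space (Borel_algebra X)"
      then have "x \<in> D (k x) \<inter> E (k x)" using kD by (simp add: E_def)
      then show "x \<in> (\<Union>n. D n \<inter> E n)" by blast
    next
      fix x assume "x \<in> (\<Union>n. D n \<inter> E n)"
      then obtain n where "x \<in> D n" "x \<in> E n" by blast
      with Dk show "x \<in> (\<lambda>x. f (k x) x) -` U \<inter> space (Borel_algebra X)"
        by (simp add: E_def)
    qed
    ultimately show "(\<lambda>x. f (k x) x) -` U \<inter> space (Borel_algebra X) \<in> sets (Borel_algebra X)"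
      by simp
  qed
  then show ?thesis by (simp add: Borel_function_def k_def)
qed

section \<open>The compact-open topology\<close>

lemma openin_compact_open:
  assumes "compactin X C" "openin Y U"
  shows "openin (compact_open_topology X Y) {f \<in> maps X Y. f ` C \<subseteq> U}"
  unfolding compact_open_topology_def using assms by (intro topology_generated_by_Basis) blast

lemma maps_continuous: "f \<in> maps X Y \<Longrightarrow> continuous_map X Y f"
  by (simp add: maps_def)

lemma maps_in: "f \<in> maps X Y \<Longrightarrow> x \<in> topspace X \<Longrightarrow> f x \<in> topspace Y"
  using continuous_map_funspace by (fastforce simp: maps_def)

lemma restrict_in_maps:
  "continuous_map X Y f \<Longrightarrow> restrict f (topspace X) \<in> maps X Y"
  by (auto simp: maps_def intro: continuous_map_eq)

lemma maps_eqI: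
  assumes "f \<in> maps X Y" "g \<in> maps X Y" "\<And>x. x \<in> topspace X \<Longrightarrow> f x = g x"
  shows "f = g"
  using assms by (auto simp: maps_def intro: extensionalityI)

lemma continuous_map_into_compact_open:
  assumes "\<And>z. z \<in> topspace Z \<Longrightarrow> F z \<in> maps X Y"
    and "\<And>C U. compactin X C \<Longrightarrow> openin Y U \<Longrightarrow> openin Z {z \<in> topspace Z. F z ` C \<subseteq> U}"
  shows "continuous_map Z (compact_open_topology X Y) F"
  unfolding compact_open_topology_def
proof (rule continuous_on_generated_topo)
  fix W assume "W \<in> {{f \<in> maps X Y. f ` C \<subseteq> U} | C U. compactin X C \<and> openin Y U}"
  then obtain C U where W: "W = {f \<in> maps X Y. f ` C \<subseteq> U}" "compactin X C" "openin Y U" by blast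
  have "F -` W \<inter> topspace Z = {z \<in> topspace Z. F z ` C \<subseteq> U}" using assms(1) W by auto
  then show "openin Z (F -` W \<inter> topspace Z)" using assms(2) W by simp
next
  have "topspace (compact_open_topology X Y) = maps X Y" by simp
  then show "F ` topspace Z \<subseteq> \<Union> {{f \<in> maps X Y. f ` C \<subseteq> U} | C U. compactin X C \<and> openin Y U}"
    using assms(1) unfolding compact_open_topology_def topology_generated_by_topspace by blast
qed

lemma continuous_map_precompose:
  assumes j: "continuous_map Z X j"
  shows "continuous_map (compact_open_topology X Y) (compact_open_topology Z Y)
           (\<lambda>f. restrict (f \<circ> j) (topspace Z))"
proof (rule continuous_map_into_compact_open)
  fix f assume "f \<in> topspace (compact_open_topology X Y)"
  then have "continuous_map X Y f" by (simp add: maps_continuous)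
  from continuous_map_compose[OF j this]
  show "restrict (f \<circ> j) (topspace Z) \<in> maps Z Y" by (rule restrict_in_maps)
next
  fix C U assume C: "compactin Z C" and U: "openin Y U"
  have "C \<subseteq> topspace Z" using C compactin_subset_topspace by blast
  then have "{f \<in> topspace (compact_open_topology X Y). restrict (f \<circ> j) (topspace Z) ` C \<subseteq> U}
      = {f \<in> maps X Y. f ` (j ` C) \<subseteq> U}" by auto
  then show "openin (compact_open_topology X Y)
      {f \<in> topspace (compact_open_topology X Y). restrict (f \<circ> j) (topspace Z) ` C \<subseteq> U}"
    using openin_compact_open[OF image_compactin[OF C j] U] by simp
qed

lemma continuous_map_postcompose:
  assumes k: "continuous_map Y Z k"
  shows "continuous_map (compact_open_topology X Y) (compact_open_topology X Z)
           (\<lambda>f. restrict (k \<circ> f) (topspace X))"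
proof (rule continuous_map_into_compact_open)
  fix f assume "f \<in> topspace (compact_open_topology X Y)"
  then have "continuous_map X Y f" by (simp add: maps_continuous)
  from continuous_map_compose[OF this k]
  show "restrict (k \<circ> f) (topspace X) \<in> maps X Z" by (rule restrict_in_maps)
next
  fix C U assume C: "compactin X C" and U: "openin Z U"
  let ?V = "{y \<in> topspace Y. k y \<in> U}"
  have "openin Y ?V" using k U by (simp add: continuous_map_def)
  moreover have "restrict (k \<circ> f) (topspace X) ` C \<subseteq> U \<longleftrightarrow> f ` C \<subseteq> ?V" if "f \<in> maps X Y" for f
    using maps_in[OF that] compactin_subset_topspace[OF C] by (auto simp: image_subset_iff)
  then have "{f \<in> topspace (compact_open_topology X Y). restrict (k \<circ> f) (topspace X) ` C \<subseteq> U}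
      = {f \<in> maps X Y. f ` C \<subseteq> ?V}" unfolding topspace_compact_open_topology by blast
  ultimately show "openin (compact_open_topology X Y)
      {f \<in> topspace (compact_open_topology X Y). restrict (k \<circ> f) (topspace X) ` C \<subseteq> U}"
    using openin_compact_open[OF C] by simp
qed

lemma continuous_map_evaluation:
  assumes "x \<in> topspace X"
  shows "continuous_map (compact_open_topology X Y) Y (\<lambda>f. f x)"
  unfolding continuous_map_def
proof (intro conjI allI impI)
  show "(\<lambda>f. f x) \<in> topspace (compact_open_topology X Y) \<rightarrow> topspace Y"
    using maps_in[OF _ assms] by auto
  fix U assume "openin Y U"
  then have "openin (compact_open_topology X Y) {f \<in> maps X Y. f ` {x} \<subseteq> U}"
    using assms by (intro openin_compact_open) auto
  then show "openin (compact_open_topology X Y) {f \<in> topspace (compact_open_topology X Y). f x \<in> U}"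
    by simp
qed

lemma compactin_finite_subcover:
  assumes C: "compactin X C" and V: "\<And>x. x \<in> C \<Longrightarrow> openin X (V x) \<and> x \<in> V x"
  obtains D where "finite D" "D \<subseteq> C" "C \<subseteq> \<Union> (V ` D)"
proof -
  have "\<exists>\<F>. finite \<F> \<and> \<F> \<subseteq> V ` C \<and> C \<subseteq> \<Union>\<F>"
    using V by (intro compactinD[OF C]) auto
  then obtain \<F> where F: "finite \<F>" "\<F> \<subseteq> V ` C" "C \<subseteq> \<Union>\<F>" by blast
  from finite_subset_image[OF F(1,2)] obtain D where "D \<subseteq> C" "finite D" "\<F> = V ` D" by blast
  with F(3) that show ?thesis by blast
qed

section \<open>Second countability and complete metrizability of mapping spaces\<close>

text \<open>The members of a countable base that have compact closure still form a base, by
  regularity and local compactness. Their closures are the countably many compact sets on which maps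
  will be tested.\<close>

lemma locally_compact_Polish_base:
  assumes "Polish_space X" "locally_compact_space X"
  obtains \<B> where "countable \<B>" "\<And>B. B \<in> \<B> \<Longrightarrow> openin X B"
    "\<And>B. B \<in> \<B> \<Longrightarrow> compactin X (X closure_of B)"
    "\<And>U x. openin X U \<Longrightarrow> x \<in> U \<Longrightarrow> \<exists>B\<in>\<B>. x \<in> B \<and> X closure_of B \<subseteq> U"
proof -
  obtain \<A> where \<A>: "countable \<A>" "\<And>V. V \<in> \<A> \<Longrightarrow> openin X V"
    "\<And>U x. openin X U \<Longrightarrow> x \<in> U \<Longrightarrow> \<exists>V\<in>\<A>. x \<in> V \<and> V \<subseteq> U"
    using assms(1) unfolding Polish_space_iff_second_countable second_countable_def by metis
  have "regular_space X"
    using assms(1) by (simp add: Polish_space_def completely_metrizable_imp_metrizable_space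
        metrizable_imp_regular_space)
  then have nb: "neighbourhood_base_of (\<lambda>C. compactin X C \<and> closedin X C) X"
    using assms(2) locally_compact_regular_space_neighbourhood_base by blast
  show ?thesis
  proof (rule that[of "{B \<in> \<A>. compactin X (X closure_of B)}"])
    fix U x assume "openin X U" "x \<in> U"
    then have "\<exists>V C. openin X V \<and> (compactin X C \<and> closedin X C) \<and> x \<in> V \<and> V \<subseteq> C \<and> C \<subseteq> U"
      using nb unfolding neighbourhood_base_of by simp
    then obtain V C where V: "openin X V" "compactin X C" "closedin X C" "x \<in> V" "V \<subseteq> C" "C \<subseteq> U"
      by blast
    obtain B where B: "B \<in> \<A>" "x \<in> B" "B \<subseteq> V" using \<A>(3)[OF V(1,4)] by blast
    then have BC: "X closure_of B \<subseteq> C"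
      using V by (intro closure_of_minimal) auto
    then have "compactin X (X closure_of B)"
      using V(2) by (intro closed_compactin[OF _ BC]) auto
    then show "\<exists>B\<in>{B \<in> \<A>. compactin X (X closure_of B)}. x \<in> B \<and> X closure_of B \<subseteq> U"
      using B BC V by blast
  qed (use \<A> in auto)
qed

text \<open>A condition f(C) \<subseteq> U follows from finitely many conditions f(closure of B)
  \<subseteq> V with B and V from countable bases: cover the compact set C by such B, with V inside
  U.\<close>

lemma second_countable_compact_open:
  assumes X: "Polish_space X" "locally_compact_space X" and Y: "second_countable Y"
  shows "second_countable (compact_open_topology X Y)"
proof -
  obtain \<B> where \<B>: "countable \<B>" "\<And>B. B \<in> \<B> \<Longrightarrow> openin X B"
    "\<And>B. B \<in> \<B> \<Longrightarrow> compactin X (X closure_of B)"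
    "\<And>U x. openin X U \<Longrightarrow> x \<in> U \<Longrightarrow> \<exists>B\<in>\<B>. x \<in> B \<and> X closure_of B \<subseteq> U"
    by (rule locally_compact_Polish_base[OF X]) blast
  obtain \<V> where \<V>: "countable \<V>" "\<And>V. V \<in> \<V> \<Longrightarrow> openin Y V"
    "\<And>U x. openin Y U \<Longrightarrow> x \<in> U \<Longrightarrow> \<exists>V\<in>\<V>. x \<in> V \<and> V \<subseteq> U"
    using Y unfolding second_countable_def by metis
  define W where "W = (\<lambda>(B, V). {f \<in> maps X Y. f ` (X closure_of B) \<subseteq> V})"
  \<comment> \<open>Intersecting with \<open>maps X Y\<close> makes the empty F stand for the whole
    space.\<close>
  define base where "base F = maps X Y \<inter> \<Inter> (W ` F)" for F
  have W: "openin (compact_open_topology X Y) (W z)" if "z \<in> \<B> \<times> \<V>" for z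
    using that \<B>(3) \<V>(2) by (auto simp: W_def intro!: openin_compact_open)
  have base: "\<exists>F. finite F \<and> F \<subseteq> \<B> \<times> \<V> \<and> f \<in> base F \<and> base F \<subseteq> U"
    if "generate_topology_on {{f \<in> maps X Y. f ` C \<subseteq> U} | C U. compactin X C \<and> openin Y U} U" "f \<in> U"
    for U f
    using that
  proof (induction arbitrary: f)
    case (Int U1 U2)
    then obtain F1 F2 where "finite F1" "F1 \<subseteq> \<B> \<times> \<V>" "f \<in> base F1" "base F1 \<subseteq> U1"
      "finite F2" "F2 \<subseteq> \<B> \<times> \<V>" "f \<in> base F2" "base F2 \<subseteq> U2"
      using Int.IH(1)[of f] Int.IH(2)[of f] Int.prems by (elim IntE) blast
    moreover have "base (F1 \<union> F2) = base F1 \<inter> base F2" by (auto simp: base_def)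
    ultimately show ?case by (intro exI[of _ "F1 \<union> F2"]) auto
  next
    case (UN \<U>)
    then obtain V where V: "V \<in> \<U>" "f \<in> V" by blast
    then show ?case using UN.IH[OF V] by blast
  next
    case (Basis U0)
    then obtain C U where CU: "U0 = {f \<in> maps X Y. f ` C \<subseteq> U}" "compactin X C" "openin Y U" by blast
    then have f: "f \<in> maps X Y" "f ` C \<subseteq> U" using Basis by auto
    have "\<exists>B V. B \<in> \<B> \<and> V \<in> \<V> \<and> x \<in> B \<and> f ` (X closure_of B) \<subseteq> V \<and> V \<subseteq> U" if "x \<in> C" for x
    proof -
      have x: "x \<in> topspace X" using that CU(2) compactin_subset_topspace by blast
      have fx: "f x \<in> U" using f(2) that by blast
      obtain V where V: "V \<in> \<V>" "f x \<in> V" "V \<subseteq> U"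
        using \<V>(3)[OF CU(3) fx] by blast
      have "openin X {x \<in> topspace X. f x \<in> V}"
        using maps_continuous[OF f(1)] \<V>(2)[OF V(1)] by (simp add: continuous_map_def)
      moreover have "x \<in> {x \<in> topspace X. f x \<in> V}" using x V by simp
      ultimately obtain B where "B \<in> \<B>" "x \<in> B" "X closure_of B \<subseteq> {x \<in> topspace X. f x \<in> V}"
        by (rule \<B>(4)[THEN bexE]) blast
      then show ?thesis using V by (intro exI[of _ B] exI[of _ V]) auto
    qed
    then obtain b v where bv: "\<And>x. x \<in> C \<Longrightarrow> b x \<in> \<B> \<and> v x \<in> \<V> \<and> x \<in> b x \<and>
        f ` (X closure_of b x) \<subseteq> v x \<and> v x \<subseteq> U" by metis
    have "openin X (b x) \<and> x \<in> b x" if "x \<in> C" for x using bv[OF that] \<B>(2) by blast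
    then obtain D where D: "finite D" "D \<subseteq> C" "C \<subseteq> \<Union> (b ` D)"
      by (rule compactin_finite_subcover[OF CU(2)])
    let ?F = "(\<lambda>x. (b x, v x)) ` D"
    have "f \<in> W (b x, v x)" if "x \<in> D" for x using f bv[of x] D that by (auto simp: W_def)
    then have "f \<in> base ?F" using f by (auto simp: base_def)
    moreover have "base ?F \<subseteq> U0"
    proof
      fix g assume g: "g \<in> base ?F"
      have "g x \<in> U" if xC: "x \<in> C" for x
      proof -
        obtain y where y: "y \<in> D" "x \<in> b y" using D(3) xC by blast
        then have "x \<in> X closure_of b y"
          using bv[of y] D(2) closure_of_subset[OF openin_subset[OF \<B>(2)], of "b y"] by auto
        moreover have "g ` (X closure_of b y) \<subseteq> v y" using g y by (auto simp: base_def W_def)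
        ultimately show ?thesis using bv[of y] y D by blast
      qed
      then show "g \<in> U0" using g by (auto simp: CU base_def)
    qed
    ultimately show ?case using D bv by (intro exI[of _ ?F]) auto
  qed auto
  show ?thesis
    unfolding second_countable_def
  proof (intro exI[of _ "base ` {F. finite F \<and> F \<subseteq> \<B> \<times> \<V>}"] conjI allI impI ballI)
    have "countable (\<B> \<times> \<V>)" using \<B>(1) \<V>(1) by auto
    then show "countable (base ` {F. finite F \<and> F \<subseteq> \<B> \<times> \<V>})"
      by (intro countable_image countable_Collect_finite_subset)
    show "openin (compact_open_topology X Y) U" if U: "U \<in> base ` {F. finite F \<and> F \<subseteq> \<B> \<times> \<V>}" for U
    proof -
      obtain F where F: "finite F" "F \<subseteq> \<B> \<times> \<V>" "U = base F" using U by blast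
      have "openin (compact_open_topology X Y) (maps X Y)"
        by (metis openin_topspace topspace_compact_open_topology)
      then have "openin (compact_open_topology X Y) (\<Inter> (insert (maps X Y) (W ` F)))"
        using F W by (intro openin_Inter) auto
      then show ?thesis by (simp add: F base_def)
    qed
    fix U f assume "openin (compact_open_topology X Y) U \<and> f \<in> U"
    then show "\<exists>V\<in>base ` {F. finite F \<and> F \<subseteq> \<B> \<times> \<V>}. f \<in> V \<and> V \<subseteq> U"
      using base[of U f] unfolding compact_open_topology_def openin_topology_generated_by_iff by blast
  qed
qed

text \<open>Completeness of C(Y, M) is known for the uniform metric. The two topologies agree
  because a finite cover of the compact image, or of Y itself, turns ball conditions into subbasic
  conditions and back.\<close>

lemma (in Metric_space) compact_open_eq_cfunspace:
  assumes Y: "compact_space Y"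
  shows "compact_open_topology Y mtopology = mtopology_of (cfunspace Y Self)"
proof -
  let ?F = "cfunspace Y Self"
  interpret F: Metric_space "mspace ?F" "mdist ?F" by (rule Metric_space_mspace_mdist)
  have cpt: "compactin Y (topspace Y)" using Y by (simp add: compact_space_def)
  have sp: "mspace ?F = maps Y mtopology"
    unfolding compactin_mspace_cfunspace[OF cpt]
    using maps_in[of _ Y mtopology] by (auto simp: maps_def mtopology_of_def)
  note mspace_cfunspace [simp del]
  have mt: "mtopology_of ?F = F.mtopology" by (simp add: mtopology_of_def)
  have pt: "d (f y) (g y) \<le> mdist ?F f g" if "f \<in> maps Y mtopology" "g \<in> maps Y mtopology" "y \<in> topspace Y" for f g y
    using mdist_cfunspace_imp_mdist_le[of f Y Self g "mdist ?F f g" y] that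
    unfolding sp by simp
  have sub: "openin F.mtopology {f \<in> maps Y mtopology. f ` C \<subseteq> U}"
    if C: "compactin Y C" and U: "openin mtopology U" for C U
    unfolding F.openin_mtopology
  proof (intro conjI allI impI)
    show "{f \<in> maps Y mtopology. f ` C \<subseteq> U} \<subseteq> mspace ?F" by (auto simp: sp)
    fix f assume "f \<in> {f \<in> maps Y mtopology. f ` C \<subseteq> U}"
    then have f: "f \<in> maps Y mtopology" "f ` C \<subseteq> U" by auto
    have CY: "C \<subseteq> topspace Y" using C by (rule compactin_subset_topspace)
    have "\<forall>y\<in>U. \<exists>r>0. mball y r \<subseteq> U" using U openin_mtopology by blast
    then obtain r where r: "\<And>y. y \<in> U \<Longrightarrow> 0 < r y \<and> mball y (r y) \<subseteq> U" by metis
    have "compactin mtopology (f ` C)"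
      using image_compactin[OF C maps_continuous[OF f(1)]] .
    moreover have "openin mtopology (mball y (r y / 2)) \<and> y \<in> mball y (r y / 2)" if "y \<in> f ` C" for y
    proof -
      have "y \<in> M" "0 < r y" using maps_in[OF f(1)] CY f(2) r that by auto
      then show ?thesis by simp
    qed
    ultimately obtain D where D: "finite D" "D \<subseteq> f ` C" "f ` C \<subseteq> \<Union> ((\<lambda>y. mball y (r y / 2)) ` D)"
      by (rule compactin_finite_subcover)
    \<comment> \<open>Half of each radius is spent on the cover of f(C), the other half is left for
      the distance of g from f. The 1 keeps the minimum defined when D is empty.\<close>
    define e where "e = Min (insert 1 ((\<lambda>y. r y / 2) ` D))"
    have e: "0 < e" using D(1,2) r f by (auto simp: e_def)
    have er: "e \<le> r y / 2" if "y \<in> D" for y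
      unfolding e_def by (rule Min_le) (use D(1) that in auto)
    have "F.mball f e \<subseteq> {f \<in> maps Y mtopology. f ` C \<subseteq> U}"
    proof
      fix g assume "g \<in> F.mball f e"
      then have g: "g \<in> maps Y mtopology" "mdist ?F f g < e"
        unfolding F.in_mball by (simp_all add: sp)
      have "g x \<in> U" if xC: "x \<in> C" for x
      proof -
        have x: "x \<in> topspace Y" using that CY by blast
        obtain y where y: "y \<in> D" "f x \<in> mball y (r y / 2)" using D(3) xC by blast
        have gx: "g x \<in> M" using maps_in[OF g(1) x] by simp
        have "d (f x) (g x) < r y / 2" using pt[OF f(1) g(1) x] g(2) er[OF y(1)] by linarith
        then have "g x \<in> mball y (r y)" using y(2) gx triangle[of y "f x" "g x"] by auto
        moreover have "y \<in> U" using y(1) D(2) f(2) by blast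
        ultimately show ?thesis using r[of y] by blast
      qed
      then show "g \<in> {f \<in> maps Y mtopology. f ` C \<subseteq> U}" using g by auto
    qed
    then show "\<exists>r>0. F.mball f r \<subseteq> {f \<in> maps Y mtopology. f ` C \<subseteq> U}" using e by blast
  qed
  have ball: "\<exists>N. openin (compact_open_topology Y mtopology) N \<and> f \<in> N \<and> N \<subseteq> F.mball f r"
    if f: "f \<in> maps Y mtopology" and r: "0 < r" for f r
  proof -
    \<comment> \<open>The open preimages \<open>A x\<close> yield a finite cover; the closed
      preimages \<open>K x\<close> contain them and are compact, hence admissible in the
      compact-open topology.\<close>
    define A where "A x = {y \<in> topspace Y. f y \<in> mball (f x) (r / 4)}" for x
    define K where "K x = {y \<in> topspace Y. f y \<in> mcball (f x) (r / 4)}" for x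
    have A: "openin Y (A x)" for x
      unfolding A_def by (rule openin_continuous_map_preimage[OF maps_continuous[OF f]]) auto
    have "closedin Y (K x)" for x
      unfolding K_def by (rule closedin_continuous_map_preimage[OF maps_continuous[OF f]]) auto
    then have K: "compactin Y (K x)" for x
      using Y closedin_compact_space by blast
    have fM: "f x \<in> M" if "x \<in> topspace Y" for x using maps_in[OF f that] by simp
    have "openin Y (A x) \<and> x \<in> A x" if "x \<in> topspace Y" for x
    proof
      show "openin Y (A x)" by (rule A)
      show "x \<in> A x" using fM[OF that] r that by (simp add: A_def)
    qed
    then obtain D where D: "finite D" "D \<subseteq> topspace Y" "topspace Y \<subseteq> \<Union> (A ` D)"
      by (rule compactin_finite_subcover[OF cpt])
    define N where "N = \<Inter> (insert (maps Y mtopology)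
        ((\<lambda>x. {g \<in> maps Y mtopology. g ` K x \<subseteq> mball (f x) (r / 2)}) ` D))"
    have "openin (compact_open_topology Y mtopology) (maps Y mtopology)"
      by (metis openin_topspace topspace_compact_open_topology)
    then have "openin (compact_open_topology Y mtopology) N"
      unfolding N_def using D(1) K by (intro openin_Inter) (auto intro!: openin_compact_open)
    moreover have "f \<in> N" using f r by (auto simp: N_def K_def)
    moreover have "N \<subseteq> F.mball f r"
    proof
      fix g assume "g \<in> N"
      then have g: "g \<in> maps Y mtopology"
        and gK: "\<And>x. x \<in> D \<Longrightarrow> g ` K x \<subseteq> mball (f x) (r / 2)" by (auto simp: N_def)
      \<comment> \<open>r/4 from f y to f x plus r/2 from f x to g y. The slack below r is needed
        because the supremum distance inherits only a weak inequality.\<close>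
      have "d (f y) (g y) \<le> 3 / 4 * r" if y: "y \<in> topspace Y" for y
      proof -
        obtain x where x: "x \<in> D" "y \<in> A x" using D(3) y by blast
        then have "y \<in> K x" by (auto simp: A_def K_def)
        then have "g y \<in> mball (f x) (r / 2)" using gK[OF x(1)] by blast
        then show ?thesis
          using x(2) triangle[of "f y" "f x" "g y"] by (auto simp: A_def commute)
      qed
      then have "mdist ?F f g \<le> 3 / 4 * r"
        using r f g by (intro mdist_cfunspace_le) auto
      also have "\<dots> < r" using r by simp
      finally show "g \<in> F.mball f r" unfolding F.in_mball using f g by (simp add: sp)
    qed
    ultimately show ?thesis by blast
  qed
  have "openin (compact_open_topology Y mtopology) U \<longleftrightarrow> openin F.mtopology U" for U
  proof
    assume "openin F.mtopology U"
    then have U: "U \<subseteq> mspace ?F" "\<And>f. f \<in> U \<Longrightarrow> \<exists>r>0. F.mball f r \<subseteq> U"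
      unfolding F.openin_mtopology by blast+
    show "openin (compact_open_topology Y mtopology) U"
    proof (subst openin_subopen, intro ballI)
      fix f assume "f \<in> U"
      then obtain r where "0 < r" "F.mball f r \<subseteq> U" using U by blast
      moreover have "f \<in> maps Y mtopology" using U(1) \<open>f \<in> U\<close> sp by blast
      ultimately show "\<exists>T. openin (compact_open_topology Y mtopology) T \<and> f \<in> T \<and> T \<subseteq> U"
        using ball[of f r] by blast
    qed
  next
    assume "openin (compact_open_topology Y mtopology) U"
    then show "openin F.mtopology U"
      unfolding compact_open_topology_def openin_topology_generated_by_iff
    proof induction
      case (Basis s)
      then show ?case using sub by blast
    qed (auto intro: openin_Union)
  qed
  then show ?thesis by (simp add: topology_eq mt)
qed

lemma completely_metrizable_compact_open_compact:
  assumes "compact_space X" "completely_metrizable_space Y"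
  shows "completely_metrizable_space (compact_open_topology X Y)"
proof -
  obtain M d where M: "Metric_space M d" "Metric_space.mcomplete M d" "Y = Metric_space.mtopology M d"
    using assms(2) by (auto simp: completely_metrizable_space_def)
  interpret Metric_space M d by fact
  have "mcomplete_of (cfunspace X Self)" using mcomplete_cfunspace[OF M(2)] .
  then have "completely_metrizable_space (mtopology_of (cfunspace X Self))"
    unfolding mtopology_of_def mcomplete_of_def
    by (rule Metric_space.completely_metrizable_space_mtopology[OF Metric_space_mspace_mdist])
  then show ?thesis using compact_open_eq_cfunspace[OF assms(1)] by (simp add: M)
qed

text \<open>Restriction to the compact closures of countably many base sets identifies C(X, Y) with
  the compatible families in a countable product of spaces C(K, Y), K compact. That product is
  completely metrizable, and compatibility is a closed condition.\<close>

lemma Polish_space_compact_open: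
  fixes X :: "'a topology" and Y :: "'b topology"
  assumes X: "Polish_space X" "locally_compact_space X" and Y: "Polish_space Y"
  shows "Polish_space (compact_open_topology X Y)"
proof -
  obtain \<B> where \<B>: "countable \<B>" "\<And>B. B \<in> \<B> \<Longrightarrow> openin X B"
    "\<And>B. B \<in> \<B> \<Longrightarrow> compactin X (X closure_of B)"
    "\<And>U x. openin X U \<Longrightarrow> x \<in> U \<Longrightarrow> \<exists>B\<in>\<B>. x \<in> B \<and> X closure_of B \<subseteq> U"
    using locally_compact_Polish_base[OF X] by metis
  have HY: "Hausdorff_space Y" using Y by (rule Polish_imp_Hausdorff)
  have cl: "X closure_of B \<subseteq> topspace X" "B \<in> \<B> \<Longrightarrow> B \<subseteq> X closure_of B" for B
    using closure_of_subset_topspace closure_of_subset openin_subset \<B>(2) by metis+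
  define S where "S B = subtopology X (X closure_of B)" for B
  have tS: "topspace (S B) = X closure_of B" for B using cl by (auto simp: S_def)
  define T where "T = product_topology (\<lambda>B. compact_open_topology (S B) Y) \<B>"
  \<comment> \<open>Compatible families: an intersection of equalizers of evaluation maps into the
    Hausdorff space Y, hence closed.\<close>
  define E where "E = {F \<in> topspace T. \<forall>B\<in>\<B>. \<forall>B'\<in>\<B>. \<forall>x\<in>X closure_of B \<inter> X closure_of B'. F B x = F B' x}"
  define r where "r f = (\<lambda>B\<in>\<B>. restrict f (X closure_of B))" for f :: "'a \<Rightarrow> 'b"
  \<comment> \<open>An arbitrary base set around x. On compatible families the value of
    \<open>glue\<close> does not depend on the choice.\<close>
  define \<beta> where "\<beta> x = (SOME B. B \<in> \<B> \<and> x \<in> B)" for x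
  define glue where "glue F = (\<lambda>x\<in>topspace X. F (\<beta> x) x)" for F :: "'a set \<Rightarrow> 'a \<Rightarrow> 'b"
  have \<beta>: "\<beta> x \<in> \<B>" "x \<in> \<beta> x" if "x \<in> topspace X" for x
  proof -
    have "\<exists>B. B \<in> \<B> \<and> x \<in> B" using \<B>(4)[OF openin_topspace that] by blast
    then have "\<beta> x \<in> \<B> \<and> x \<in> \<beta> x" unfolding \<beta>_def by (rule someI_ex)
    then show "\<beta> x \<in> \<B>" "x \<in> \<beta> x" by auto
  qed
  have T: "F \<in> extensional \<B>" "B \<in> \<B> \<Longrightarrow> F B \<in> maps (S B) Y" if "F \<in> topspace T" for F B
    using that by (auto simp: T_def PiE_def)
  have proj: "continuous_map T (compact_open_topology (S B) Y) (\<lambda>F. F B)" if "B \<in> \<B>" for B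
    unfolding T_def by (rule continuous_map_product_projection[OF that])
  have "completely_metrizable_space (compact_open_topology (S B) Y)" if "B \<in> \<B>" for B
    using Y \<B>(3)[OF that] unfolding S_def
    by (intro completely_metrizable_compact_open_compact)
      (auto simp: Polish_space_def compact_space_subtopology)
  then have "completely_metrizable_space T"
    using \<B>(1) unfolding T_def completely_metrizable_space_product_topology
    by (intro disjI2 conjI) (auto elim: countable_subset[rotated])
  moreover have "closedin T E"
  proof -
    define Cs where "Cs = {{F \<in> topspace T. F B x = F B' x} | B B' x.
        B \<in> \<B> \<and> B' \<in> \<B> \<and> x \<in> X closure_of B \<inter> X closure_of B'}"
    have "closedin T {F \<in> topspace T. F B x = F B' x}"
      if B: "B \<in> \<B>" "B' \<in> \<B>" and x: "x \<in> X closure_of B \<inter> X closure_of B'" for B B' x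
    proof (rule closedin_continuous_maps_eq[OF HY])
      have ev: "continuous_map T Y (\<lambda>F. F A x)" if "A \<in> \<B>" "x \<in> topspace (S A)" for A
        using continuous_map_compose[OF proj[OF that(1)] continuous_map_evaluation[OF that(2)]]
        by (simp add: o_def)
      show "continuous_map T Y (\<lambda>F. F B x)" "continuous_map T Y (\<lambda>F. F B' x)"
        using ev B x by (simp_all add: tS)
    qed
    then have "closedin T C" if "C \<in> insert (topspace T) Cs" for C
      using that unfolding Cs_def by blast
    then have "closedin T (\<Inter> (insert (topspace T) Cs))"
      by (intro closedin_Inter) simp_all
    moreover have "E = \<Inter> (insert (topspace T) Cs)"
      unfolding E_def Cs_def by blast
    ultimately show ?thesis by simp
  qed
  ultimately have "completely_metrizable_space (subtopology T E)"
    by (rule completely_metrizable_space_closedin)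
  moreover have "homeomorphic_maps (compact_open_topology X Y) (subtopology T E) r glue"
  proof -
    have glue_eq: "glue F x = F B x" if F: "F \<in> E" and B: "B \<in> \<B>" "x \<in> X closure_of B" for F B x
    proof -
      have x: "x \<in> topspace X" using cl B by blast
      then have "x \<in> X closure_of (\<beta> x)" using \<beta> cl by blast
      then have "F (\<beta> x) x = F B x" using F B \<beta>(1)[OF x] unfolding E_def by blast
      then show ?thesis using x by (simp add: glue_def)
    qed
    have glue_maps: "glue F \<in> maps X Y" if F: "F \<in> E" for F
    proof -
      have FT: "F \<in> topspace T" using F by (simp add: E_def)
      have "continuous_map X Y (glue F)"
        unfolding continuous_map_def
      proof (intro conjI allI impI)
        show "glue F \<in> topspace X \<rightarrow> topspace Y"
        proof
          fix x assume x: "x \<in> topspace X"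
          then have "x \<in> X closure_of (\<beta> x)" using \<beta> cl by blast
          then show "glue F x \<in> topspace Y"
            using maps_in[OF T(2)[OF FT \<beta>(1)[OF x]], of x] x by (simp add: glue_def tS)
        qed
        fix U assume U: "openin Y U"
        show "openin X {x \<in> topspace X. glue F x \<in> U}"
        proof (subst openin_subopen, intro ballI)
          fix x assume x: "x \<in> {x \<in> topspace X. glue F x \<in> U}"
          let ?B = "\<beta> x"
          have B: "?B \<in> \<B>" "x \<in> ?B" using \<beta> x by auto
          have "openin (S ?B) {z \<in> topspace (S ?B). F ?B z \<in> U}"
            using maps_continuous[OF T(2)[OF FT B(1)]] U by (simp add: continuous_map_def)
          then obtain V where V: "openin X V" "{z \<in> topspace (S ?B). F ?B z \<in> U} = V \<inter> X closure_of ?B"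
            by (auto simp: S_def openin_subtopology)
          show "\<exists>T. openin X T \<and> x \<in> T \<and> T \<subseteq> {x \<in> topspace X. glue F x \<in> U}"
          proof (intro exI conjI)
            \<comment> \<open>Intersecting with the base set and not with its closure gives a set
              open in X on which \<open>glue F\<close> is \<open>F ?B\<close>.\<close>
            show "openin X (V \<inter> ?B)" using V(1) \<B>(2)[OF B(1)] by (rule openin_Int)
            have xB: "x \<in> X closure_of ?B" using B cl by blast
            then have "F ?B x \<in> U" using x glue_eq[OF F B(1)] by simp
            then show "x \<in> V \<inter> ?B" using V(2) xB B tS by blast
            show "V \<inter> ?B \<subseteq> {x \<in> topspace X. glue F x \<in> U}"
            proof
              fix z assume z: "z \<in> V \<inter> ?B"
              then have zB: "z \<in> X closure_of ?B" using cl(2)[OF B(1)] by blast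
              then have "F ?B z \<in> U" using V(2) z by blast
              then show "z \<in> {x \<in> topspace X. glue F x \<in> U}"
                using glue_eq[OF F B(1) zB] zB cl(1) by auto
            qed
          qed
        qed
      qed
      then show ?thesis by (simp add: maps_def glue_def)
    qed
    have rT: "r f \<in> E" if f: "f \<in> maps X Y" for f
    proof -
      have "restrict f (X closure_of B) \<in> maps (S B) Y" for B
      proof -
        have "continuous_map (S B) Y f"
          by (simp add: S_def continuous_map_from_subtopology maps_continuous f)
        from restrict_in_maps[OF this] show ?thesis by (simp only: tS)
      qed
      then show ?thesis by (auto simp: E_def T_def r_def)
    qed
    have "continuous_map (compact_open_topology X Y) (subtopology T E) r"
    proof (rule continuous_map_into_subtopology)
      show "continuous_map (compact_open_topology X Y) T r"
        unfolding T_def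
      proof (rule continuous_map_componentwise[THEN iffD2], intro conjI ballI)
        show "r ` topspace (compact_open_topology X Y) \<subseteq> extensional \<B>" by (auto simp: r_def)
        fix B assume B: "B \<in> \<B>"
        have "continuous_map (S B) X id"
          unfolding S_def by (rule continuous_map_from_subtopology[OF continuous_map_id])
        from continuous_map_precompose[OF this, of Y]
        show "continuous_map (compact_open_topology X Y) (compact_open_topology (S B) Y) (\<lambda>f. r f B)"
          by (rule continuous_map_eq) (simp add: r_def B tS)
      qed
    qed (use rT in auto)
    moreover have "continuous_map (subtopology T E) (compact_open_topology X Y) glue"
    proof (rule continuous_map_into_compact_open)
      show "glue F \<in> maps X Y" if "F \<in> topspace (subtopology T E)" for F
        using that by (intro glue_maps) simp
      fix C U assume C: "compactin X C" and U: "openin Y U"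
      have CX: "C \<subseteq> topspace X" using C by (rule compactin_subset_topspace)
      \<comment> \<open>Finitely many base sets cover C, so the condition on C splits into
        conditions on the compact pieces of C in their closures, each visible in one factor of the
        product.\<close>
      have "C \<subseteq> \<Union>\<B>" using \<beta> CX by blast
      from compactinD[OF C \<B>(2) this] obtain \<F> where \<F>: "finite \<F>" "\<F> \<subseteq> \<B>" "C \<subseteq> \<Union>\<F>" by blast
      have "openin T {F \<in> topspace T. F B ` (X closure_of B \<inter> C) \<subseteq> U}" if B: "B \<in> \<F>" for B
      proof -
        have "closedin X (X closure_of B)" by simp
        then have "compactin X (X closure_of B \<inter> C)"
          using C by (rule closed_Int_compactin)
        then have "compactin (S B) (X closure_of B \<inter> C)"
          by (simp add: S_def compactin_subtopology)
        then have "openin (compact_open_topology (S B) Y)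
            {f \<in> maps (S B) Y. f ` (X closure_of B \<inter> C) \<subseteq> U}"
          using U by (rule openin_compact_open)
        from openin_continuous_map_preimage[OF proj this] B \<F>(2)
        have "openin T {F \<in> topspace T. F B \<in> {f \<in> maps (S B) Y. f ` (X closure_of B \<inter> C) \<subseteq> U}}"
          by blast
        moreover have "{F \<in> topspace T. F B \<in> {f \<in> maps (S B) Y. f ` (X closure_of B \<inter> C) \<subseteq> U}}
            = {F \<in> topspace T. F B ` (X closure_of B \<inter> C) \<subseteq> U}"
          using T(2)[of _ B] B \<F>(2) by blast
        ultimately show ?thesis by (simp only:)
      qed
      then have "openin T (\<Inter> (insert (topspace T) ((\<lambda>B. {F \<in> topspace T. F B ` (X closure_of B \<inter> C) \<subseteq> U}) ` \<F>)))"
        (is "openin T ?V")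
        using \<F>(1) by (intro openin_Inter) auto
      then have "openin (subtopology T E) (E \<inter> ?V)"
        by (rule openin_subtopology_Int2)
      moreover have "{F \<in> topspace (subtopology T E). glue F ` C \<subseteq> U} = E \<inter> ?V"
      proof (intro Set.set_eqI iffI)
        fix F assume "F \<in> {F \<in> topspace (subtopology T E). glue F ` C \<subseteq> U}"
        then have F: "F \<in> E" "F \<in> topspace T" "glue F ` C \<subseteq> U" by auto
        have "F B x \<in> U" if B: "B \<in> \<F>" "x \<in> X closure_of B \<inter> C" for B x
        proof -
          have "B \<in> \<B>" "x \<in> X closure_of B" "glue F x \<in> U" using B \<F>(2) F(3) by blast+
          then show ?thesis using glue_eq[OF F(1), of B x] by simp
        qed
        then show "F \<in> E \<inter> ?V" using F by auto
      next
        fix F assume F: "F \<in> E \<inter> ?V"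
        have "glue F x \<in> U" if x: "x \<in> C" for x
        proof -
          obtain B where B: "B \<in> \<F>" "x \<in> B" using \<F>(3) x by blast
          then have xB: "x \<in> X closure_of B" using cl(2) \<F>(2) by blast
          then have "F B x \<in> U" using F B x by auto
          moreover have "B \<in> \<B>" "F \<in> E" using B \<F>(2) F by blast+
          ultimately show ?thesis using glue_eq[of F B x] xB by simp
        qed
        then show "F \<in> {F \<in> topspace (subtopology T E). glue F ` C \<subseteq> U}" using F by auto
      qed
      ultimately show "openin (subtopology T E) {F \<in> topspace (subtopology T E). glue F ` C \<subseteq> U}"
        by simp
    qed
    moreover have "glue (r f) = f" if f: "f \<in> maps X Y" for f
    proof (rule maps_eqI[OF glue_maps[OF rT[OF f]] f])
      fix x assume x: "x \<in> topspace X"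
      then have "x \<in> X closure_of (\<beta> x)" using \<beta> cl by blast
      then show "glue (r f) x = f x" using x \<beta> by (simp add: glue_def r_def)
    qed
    moreover have "r (glue F) = F" if F: "F \<in> E" for F
    proof (rule extensionalityI[of _ \<B>])
      show "r (glue F) \<in> extensional \<B>" by (simp add: r_def)
      show "F \<in> extensional \<B>" using F T by (simp add: E_def)
      fix B assume B: "B \<in> \<B>"
      have "F \<in> topspace T" using F by (simp add: E_def)
      from T(2)[OF this B] have "F B \<in> extensional (X closure_of B)" by (simp add: maps_def tS)
      then have "restrict (glue F) (X closure_of B) = F B"
        by (intro extensionalityI[of _ "X closure_of B"]) (simp_all add: glue_eq[OF F B])
      then show "r (glue F) B = F B" by (simp add: r_def B)
    qed
    ultimately show ?thesis
      by (simp add: homeomorphic_maps_def)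
  qed
  ultimately have "completely_metrizable_space (compact_open_topology X Y)"
    using homeomorphic_completely_metrizable_space homeomorphic_space_def by blast
  moreover have "second_countable (compact_open_topology X Y)"
    using X Y by (intro second_countable_compact_open) (auto simp: Polish_space_iff_second_countable)
  ultimately show ?thesis by (simp add: Polish_space_iff_second_countable)
qed

section \<open>Homotopies moving the basepoint along a path\<close>

abbreviation unit_space :: "real topology" where
  "unit_space \<equiv> top_of_set {0..1}"

text \<open>The definition of \<open>homotopic_with\<close> prescribes the ends at all arguments.
  Prescribing them on the space suffices, as the property k x = p sees only the value at a point of
  X.\<close>

lemma homotopic_with_basepointI:
  assumes "x \<in> topspace X" "continuous_map (prod_topology unit_space X) P H"
    "\<And>z. z \<in> topspace X \<Longrightarrow> H (0, z) = f z" "\<And>z. z \<in> topspace X \<Longrightarrow> H (1, z) = g z"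
    "\<And>t. t \<in> {0..1} \<Longrightarrow> H (t, x) = p"
  shows "homotopic_with (\<lambda>k. k x = p) X P f g"
proof (subst homotopic_with)
  show "\<exists>H. continuous_map (prod_topology unit_space X) P H \<and> (\<forall>z\<in>topspace X. H (0, z) = f z) \<and>
      (\<forall>z\<in>topspace X. H (1, z) = g z) \<and> (\<forall>t\<in>{0..1}. H (t, x) = p)"
    using assms by blast
qed (use assms(1) in simp)

lemma homotopic_withI:
  assumes "continuous_map (prod_topology unit_space X) P H"
    "\<And>z. z \<in> topspace X \<Longrightarrow> H (0, z) = f z" "\<And>z. z \<in> topspace X \<Longrightarrow> H (1, z) = g z"
  shows "homotopic_with (\<lambda>_. True) X P f g"
  by (subst homotopic_with) (use assms in blast)+

text \<open>The map \<open>\<Phi> (t, _, s)\<close> drags the points near \<open>G (t, 0)\<close> along the path \<open>G (t, _)\<close>, after first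
  (for \<open>s \<le> 1/2\<close>) gathering them at \<open>G (t, 0)\<close>. It replaces the homotopy extension property of
  \<open>(X, x)\<close>, which may fail for a general locally compact Polish \<open>X\<close>.\<close>

locale sliding =
  fixes P :: "'b topology" and h :: "'b \<Rightarrow> nat \<Rightarrow> real" and S :: "(nat \<Rightarrow> real) set"
  assumes Polish: "Polish_space P"
    and homeo: "homeomorphic_map P (top_of_set S) h"
    and slide: "\<And>G. continuous_map (prod_topology unit_space unit_space) P G \<Longrightarrow>
      \<exists>\<Phi> N. continuous_map (prod_topology unit_space (prod_topology P unit_space)) P \<Phi> \<and>
        (\<forall>t\<in>{0..1}. \<forall>y\<in>topspace P. \<Phi> (t, y, 0) = y) \<and>
        (\<forall>t\<in>{0..1}. \<forall>s\<in>{0..1}. \<Phi> (t, G (t, 0), s) = G (t, max 0 (2 * s - 1))) \<and>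
        openin P N \<and> G (0, 0) \<in> N \<and> (\<forall>y\<in>N. \<Phi> (0, y, 1) = G (0, 1))"

text \<open>\<open>realization_slide\<close> is conjugated by a homeomorphism h onto the
  realization. The locale keeps h and S so that tracks in the abstract topology P become paths in a
  set of a topological type, where \<open>homotopic_paths\<close> applies.\<close>

lemma polyhedron_sliding:
  assumes "polyhedron_space P"
  obtains h S where "sliding P h S"
proof -
  obtain K where K: "simplicial_complex_on_nat K" "locally_finite_complex K"
    and hs: "P homeomorphic_space realization K"
    using assms unfolding polyhedron_space_def by blast
  let ?S = "realization_points K"
  let ?I = "{0..1::real}"
  have eq: "realization K = top_of_set ?S" using K by (rule realization_eq_subspace)
  obtain h g where hg: "homeomorphic_maps P (top_of_set ?S) h g"
    using hs eq unfolding homeomorphic_space_def by auto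
  then have h: "continuous_map P (top_of_set ?S) h" and g: "continuous_map (top_of_set ?S) P g"
    and gh: "\<And>y. y \<in> topspace P \<Longrightarrow> g (h y) = y" and hg': "\<And>y. y \<in> ?S \<Longrightarrow> h (g y) = y"
    by (auto simp: homeomorphic_maps_def)
  have gP: "g y \<in> topspace P" if "y \<in> ?S" for y
    using continuous_map_funspace[OF g] that by auto
  have hS: "h y \<in> ?S" if "y \<in> topspace P" for y
    using continuous_map_funspace[OF h] that by auto
  have "sliding P h ?S"
  proof
    show "Polish_space P"
      using Polish_space_homeomorphic[OF _ Polish_realization[OF K]] hs homeomorphic_space_sym by blast
    show "homeomorphic_map P (top_of_set ?S) h"
      using hg homeomorphic_maps_map by blast
    fix G assume G: "continuous_map (prod_topology unit_space unit_space) P G"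
    have GP: "G (t, s) \<in> topspace P" if "t \<in> ?I" "s \<in> ?I" for t s
      using continuous_map_funspace[OF G] that by auto
    have "continuous_map (prod_topology unit_space unit_space) (top_of_set ?S) (h \<circ> G)"
      using G h by (rule continuous_map_compose)
    then have 1: "continuous_on (?I \<times> ?I) (h \<circ> G)"
      by simp
    have 2: "(h \<circ> G) (t, s) \<in> ?S" if "t \<in> ?I" "s \<in> ?I" for t s
      using hS[OF GP[OF that]] by simp
    obtain \<Psi> N where \<Psi>: "continuous_on (?I \<times> ?S \<times> ?I) \<Psi>"
      "\<And>t y s. t \<in> ?I \<Longrightarrow> y \<in> ?S \<Longrightarrow> s \<in> ?I \<Longrightarrow> \<Psi> (t, y, s) \<in> ?S"
      "\<And>t y. t \<in> ?I \<Longrightarrow> y \<in> ?S \<Longrightarrow> \<Psi> (t, y, 0) = y"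
      "\<And>t s. t \<in> ?I \<Longrightarrow> s \<in> ?I \<Longrightarrow> \<Psi> (t, (h \<circ> G) (t, 0), s) = (h \<circ> G) (t, max 0 (2 * s - 1))"
      "openin (top_of_set ?S) N" "(h \<circ> G) (0, 0) \<in> N"
      "\<And>y. y \<in> N \<Longrightarrow> \<Psi> (0, y, 1) = (h \<circ> G) (0, 1)"
      by (rule realization_slide[OF K(1) 1 2]) blast+
    define \<Phi> where "\<Phi> = (\<lambda>z. g (\<Psi> (fst z, h (fst (snd z)), snd (snd z))))"
    let ?Q = "prod_topology unit_space (prod_topology P unit_space)"
    let ?R = "top_of_set (?I \<times> ?S \<times> ?I)"
    have R: "?R = prod_topology unit_space (prod_topology (top_of_set ?S) unit_space)"
      by simp
    have c1: "continuous_map ?Q ?R (\<lambda>z. (fst z, h (fst (snd z)), snd (snd z)))"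
      unfolding R
      by (intro continuous_map_pairedI continuous_map_fst continuous_map_of_fst
          continuous_map_compose[OF _ h, unfolded o_def] continuous_map_fst_of
          continuous_map_snd_of continuous_map_compose[OF continuous_map_snd, unfolded o_def]
          continuous_map_fst continuous_map_snd)
    have c2: "continuous_map ?R (top_of_set ?S) \<Psi>"
      using \<Psi>(1,2) by auto
    from continuous_map_compose[OF continuous_map_compose[OF c1 c2] g]
    have "continuous_map ?Q P \<Phi>" by (simp only: \<Phi>_def o_def)
    moreover have "\<forall>t\<in>?I. \<forall>y\<in>topspace P. \<Phi> (t, y, 0) = y"
      using \<Psi>(3) hS gh by (simp add: \<Phi>_def)
    moreover have "\<forall>t\<in>?I. \<forall>s\<in>?I. \<Phi> (t, G (t, 0), s) = G (t, max 0 (2 * s - 1))"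
    proof (intro ballI)
      fix t s :: real assume ts: "t \<in> ?I" "s \<in> ?I"
      then have "max 0 (2 * s - 1) \<in> ?I" by auto
      then show "\<Phi> (t, G (t, 0), s) = G (t, max 0 (2 * s - 1))"
        using \<Psi>(4)[OF ts] gh[OF GP[OF ts(1)]] by (simp add: \<Phi>_def)
    qed
    moreover have "openin P {y \<in> topspace P. h y \<in> N}"
      by (rule openin_continuous_map_preimage[OF h \<Psi>(5)])
    moreover have "G (0, 0) \<in> {y \<in> topspace P. h y \<in> N}"
      using \<Psi>(6) GP[of 0 0] by simp
    moreover have "\<forall>y\<in>{y \<in> topspace P. h y \<in> N}. \<Phi> (0, y, 1) = G (0, 1)"
      using \<Psi>(7) gh GP[of 0 1] by (simp add: \<Phi>_def)
    ultimately show "\<exists>\<Phi> N. continuous_map ?Q P \<Phi> \<and>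
        (\<forall>t\<in>?I. \<forall>y\<in>topspace P. \<Phi> (t, y, 0) = y) \<and>
        (\<forall>t\<in>?I. \<forall>s\<in>?I. \<Phi> (t, G (t, 0), s) = G (t, max 0 (2 * s - 1))) \<and>
        openin P N \<and> G (0, 0) \<in> N \<and> (\<forall>y\<in>N. \<Phi> (0, y, 1) = G (0, 1))"
      by blast
  qed
  then show ?thesis using that by blast
qed

context sliding
begin

text \<open>Here \<open>\<gamma>\<close> is a path in the model \<open>S\<close> of \<open>P\<close>.\<close>

definition homotopic_along ::
    "'a topology \<Rightarrow> 'a \<Rightarrow> (real \<Rightarrow> nat \<Rightarrow> real) \<Rightarrow> ('a \<Rightarrow> 'b) \<Rightarrow> ('a \<Rightarrow> 'b) \<Rightarrow> bool" where
  "homotopic_along X x \<gamma> f g \<longleftrightarrow>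
     (\<exists>H. continuous_map (prod_topology unit_space X) P H \<and>
        (\<forall>z\<in>topspace X. H (0, z) = f z \<and> H (1, z) = g z) \<and>
        homotopic_paths S \<gamma> (\<lambda>t. h (H (t, x))))"

lemma h_continuous: "continuous_map P (top_of_set S) h"
  using homeo homeomorphic_imp_continuous_map by blast

lemma h_in: "y \<in> topspace P \<Longrightarrow> h y \<in> S"
  using continuous_map_funspace[OF h_continuous] by auto

lemma h_inj: "y \<in> topspace P \<Longrightarrow> z \<in> topspace P \<Longrightarrow> h y = h z \<longleftrightarrow> y = z"
  using homeomorphic_imp_injective_map[OF homeo] by (auto dest: inj_onD)

lemma h_inverse:
  obtains g where "continuous_map (top_of_set S) P g" "\<And>y. y \<in> topspace P \<Longrightarrow> g (h y) = y"
    "\<And>y. y \<in> S \<Longrightarrow> h (g y) = y" "\<And>y. y \<in> S \<Longrightarrow> g y \<in> topspace P"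
proof -
  obtain g where g: "homeomorphic_maps P (top_of_set S) h g"
    using homeo homeomorphic_map_maps by blast
  then have "continuous_map (top_of_set S) P g" by (simp add: homeomorphic_maps_def)
  moreover from continuous_map_funspace[OF this] have "\<And>y. y \<in> S \<Longrightarrow> g y \<in> topspace P" by auto
  ultimately show ?thesis using g that by (auto simp: homeomorphic_maps_def)
qed

lemma homotopic_along_paths:
  assumes "homotopic_along X x \<gamma> f g" "x \<in> topspace X"
  shows "path \<gamma>" "path_image \<gamma> \<subseteq> S" "pathstart \<gamma> = h (f x)" "pathfinish \<gamma> = h (g x)"
proof -
  obtain H where H: "\<forall>z\<in>topspace X. H (0, z) = f z \<and> H (1, z) = g z"
    and hp: "homotopic_paths S \<gamma> (\<lambda>t. h (H (t, x)))"
    using assms(1) unfolding homotopic_along_def by blast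
  show "path \<gamma>" "path_image \<gamma> \<subseteq> S"
    using hp homotopic_paths_imp_path homotopic_paths_imp_subset by blast+
  show "pathstart \<gamma> = h (f x)" "pathfinish \<gamma> = h (g x)"
    using homotopic_paths_imp_pathstart[OF hp] homotopic_paths_imp_pathfinish[OF hp] H assms(2)
    by (simp_all add: pathstart_def pathfinish_def)
qed

text \<open>The track need only be homotopic to \<gamma> with fixed ends, not equal to it, so the
  relation sees just the class of \<gamma>.\<close>

lemma homotopic_along_homotopic_paths:
  "homotopic_along X x \<gamma> f g \<Longrightarrow> homotopic_paths S \<gamma> \<delta> \<Longrightarrow> homotopic_along X x \<delta> f g"
  unfolding homotopic_along_def using homotopic_paths_sym homotopic_paths_trans by meson

lemma homotopic_along_cong:
  assumes "homotopic_along X x \<gamma> f g" "\<And>z. z \<in> topspace X \<Longrightarrow> f z = f' z" "\<And>z. z \<in> topspace X \<Longrightarrow> g z = g' z"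
  shows "homotopic_along X x \<gamma> f' g'"
  using assms unfolding homotopic_along_def by (elim exE) (rule exI, auto)

lemma path_of_homotopy:
  assumes H: "continuous_map (prod_topology unit_space X) P H" and x: "x \<in> topspace X"
  shows "path (\<lambda>t. h (H (t, x)))" "path_image (\<lambda>t. h (H (t, x))) \<subseteq> S"
proof -
  have "continuous_map unit_space (prod_topology unit_space X) (\<lambda>t. (t, x))"
    using x by (intro continuous_map_pairedI) auto
  from continuous_map_compose[OF continuous_map_compose[OF this H] h_continuous]
  have "continuous_map unit_space (top_of_set S) (\<lambda>t. h (H (t, x)))" by (simp add: o_def)
  then show "path (\<lambda>t. h (H (t, x)))" "path_image (\<lambda>t. h (H (t, x))) \<subseteq> S"
    by (auto simp: path_def path_image_def)
qed

lemma homotopic_imp_homotopic_along_const: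
  assumes "homotopic_with (\<lambda>k. k x = p) X P f g" and x: "x \<in> topspace X"
  shows "homotopic_along X x (\<lambda>_. h p) f g"
proof -
  obtain H where H: "continuous_map (prod_topology unit_space X) P H"
    "\<And>z. H (0, z) = f z" "\<And>z. H (1, z) = g z" "\<And>t. t \<in> {0..1} \<Longrightarrow> H (t, x) = p"
    using assms(1) unfolding homotopic_with_def by blast
  have "homotopic_paths S (\<lambda>t. h (H (t, x))) (\<lambda>_. h p)"
    using H(4) by (intro homotopic_paths_eq path_of_homotopy[OF H(1) x]) simp
  then have "homotopic_paths S (\<lambda>_. h p) (\<lambda>t. h (H (t, x)))"
    by (rule homotopic_paths_sym)
  then show ?thesis unfolding homotopic_along_def using H by blast
qed

lemma homotopic_imp_homotopic_along:
  assumes "homotopic_with (\<lambda>_. True) X P f g" and x: "x \<in> topspace X"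
  obtains \<gamma> where "homotopic_along X x \<gamma> f g"
proof -
  obtain H where H: "continuous_map (prod_topology unit_space X) P H"
    "\<And>z. H (0, z) = f z" "\<And>z. H (1, z) = g z"
    using assms(1) unfolding homotopic_with_def by blast
  have "homotopic_along X x (\<lambda>t. h (H (t, x))) f g"
    unfolding homotopic_along_def using H path_of_homotopy[OF H(1) x]
    by (intro exI[of _ H]) simp
  then show ?thesis by (rule that)
qed

lemma homotopic_along_imp_homotopic:
  "homotopic_along X x \<gamma> f g \<Longrightarrow> homotopic_with (\<lambda>_. True) X P f g"
  unfolding homotopic_along_def by (subst homotopic_with) blast+

lemma homotopic_along_reverse:
  assumes "homotopic_along X x \<gamma> f g"
  shows "homotopic_along X x (reversepath \<gamma>) g f"
proof -
  obtain H where H: "continuous_map (prod_topology unit_space X) P H"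
    "\<forall>z\<in>topspace X. H (0, z) = f z \<and> H (1, z) = g z"
    "homotopic_paths S \<gamma> (\<lambda>t. h (H (t, x)))"
    using assms unfolding homotopic_along_def by blast
  have "continuous_map unit_space unit_space (\<lambda>t. 1 - t)"
    by (auto intro!: continuous_intros)
  then have "continuous_map (prod_topology unit_space X) (prod_topology unit_space X)
      (\<lambda>z. (1 - fst z, snd z))"
    by (intro continuous_map_pairedI continuous_map_snd continuous_map_compose[OF continuous_map_fst, unfolded o_def])
  from continuous_map_compose[OF this H(1)]
  have "continuous_map (prod_topology unit_space X) P (\<lambda>z. H (1 - fst z, snd z))"
    by (simp add: o_def)
  moreover have "homotopic_paths S (reversepath \<gamma>) (\<lambda>t. h (H (1 - t, x)))"
    using homotopic_paths_reversepath_D[OF H(3)] by (simp add: reversepath_def)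
  ultimately show ?thesis
    unfolding homotopic_along_def using H(2)
    by (intro exI[of _ "\<lambda>z. H (1 - fst z, snd z)"]) simp
qed

lemma homotopic_along_join:
  assumes fg: "homotopic_along X x \<gamma> f g" and gk: "homotopic_along X x \<delta> g k"
    and x: "x \<in> topspace X"
  shows "homotopic_along X x (\<gamma> +++ \<delta>) f k"
proof -
  let ?X01 = "prod_topology unit_space X"
  obtain H1 where H1: "continuous_map ?X01 P H1"
    "\<forall>z\<in>topspace X. H1 (0, z) = f z \<and> H1 (1, z) = g z"
    "homotopic_paths S \<gamma> (\<lambda>t. h (H1 (t, x)))"
    using fg unfolding homotopic_along_def by blast
  obtain H2 where H2: "continuous_map ?X01 P H2"
    "\<forall>z\<in>topspace X. H2 (0, z) = g z \<and> H2 (1, z) = k z"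
    "homotopic_paths S \<delta> (\<lambda>t. h (H2 (t, x)))"
    using gk unfolding homotopic_along_def by blast
  define H where "H = (\<lambda>y. if fst y \<le> 1/2 then (H1 \<circ> (\<lambda>x. (2 *\<^sub>R fst x, snd x))) y
      else (H2 \<circ> (\<lambda>x. (2 *\<^sub>R fst x - 1, snd x))) y)"
  have "continuous_map ?X01 P H"
    unfolding H_def
  proof (rule continuous_map_cases_le)
    show fst: "continuous_map ?X01 euclideanreal fst"
      using continuous_map_fst continuous_map_in_subtopology by blast
    show "continuous_map ?X01 euclideanreal (\<lambda>x. 1/2)" by simp
    show "continuous_map (subtopology ?X01 {y \<in> topspace ?X01. fst y \<le> 1/2}) P
        (H1 \<circ> (\<lambda>x. (2 *\<^sub>R fst x, snd x)))"
      apply (intro fst continuous_map_compose [OF _ H1(1)] continuous_intros continuous_map_into_subtopology continuous_map_from_subtopology | simp)+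
      by (force simp: prod_topology_subtopology)
    show "continuous_map (subtopology ?X01 {y \<in> topspace ?X01. 1/2 \<le> fst y}) P
        (H2 \<circ> (\<lambda>x. (2 *\<^sub>R fst x - 1, snd x)))"
      apply (intro fst continuous_map_compose [OF _ H2(1)] continuous_intros continuous_map_into_subtopology continuous_map_from_subtopology | simp)+
      by (force simp: prod_topology_subtopology)
    show "(H1 \<circ> (\<lambda>x. (2 *\<^sub>R fst x, snd x))) y = (H2 \<circ> (\<lambda>x. (2 *\<^sub>R fst x - 1, snd x))) y"
      if y: "y \<in> topspace ?X01" "fst y = 1/2" for y
    proof -
      obtain v where "y = (1 / 2, v)" "v \<in> topspace X" using y by (cases y) auto
      then show ?thesis using H1(2) H2(2) by simp
    qed
  qed
  moreover have "homotopic_paths S (\<gamma> +++ \<delta>) (\<lambda>t. h (H (t, x)))"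
  proof -
    have "pathfinish \<gamma> = pathstart \<delta>"
      using homotopic_along_paths[OF fg x] homotopic_along_paths[OF gk x] by simp
    from homotopic_paths_join[OF H1(3) H2(3) this]
    have "homotopic_paths S (\<gamma> +++ \<delta>) ((\<lambda>t. h (H1 (t, x))) +++ (\<lambda>t. h (H2 (t, x))))" .
    moreover have "(\<lambda>t. h (H1 (t, x))) +++ (\<lambda>t. h (H2 (t, x))) = (\<lambda>t. h (H (t, x)))"
      by (auto simp: joinpaths_def H_def fun_eq_iff)
    ultimately show ?thesis by simp
  qed
  moreover have "\<forall>z\<in>topspace X. H (0, z) = f z \<and> H (1, z) = k z"
    using H1(2) H2(2) by (simp add: H_def)
  ultimately show ?thesis unfolding homotopic_along_def by blast
qed

text \<open>\<phi> is the final map of a slide along \<gamma>. It depends on P and \<gamma> only, so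
  the same \<phi> serves every space X and every f by postcomposition.\<close>

lemma slide_along:
  assumes \<gamma>: "path \<gamma>" "path_image \<gamma> \<subseteq> S" and p: "p \<in> topspace P" "pathstart \<gamma> = h p"
    and q: "q \<in> topspace P" "pathfinish \<gamma> = h q"
  obtains \<phi> N where "continuous_map P P \<phi>" "openin P N" "p \<in> N" "\<And>y. y \<in> N \<Longrightarrow> \<phi> y = q"
    "\<And>(X :: 'a topology) x f. continuous_map X P f \<Longrightarrow> x \<in> topspace X \<Longrightarrow> f x = p \<Longrightarrow> homotopic_along X x \<gamma> f (\<phi> \<circ> f)"
    "\<And>(X :: 'a topology) f. continuous_map X P f \<Longrightarrow> homotopic_with (\<lambda>_. True) X P f (\<phi> \<circ> f)"
proof -
  obtain g where g: "continuous_map (top_of_set S) P g" "\<And>y. y \<in> topspace P \<Longrightarrow> g (h y) = y"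
    "\<And>y. y \<in> S \<Longrightarrow> h (g y) = y" by (rule h_inverse) blast
  \<comment> \<open>The path does not vary here, so G ignores the parameter t and only the slide at
    t = 0 is used.\<close>
  define G where "G = (\<lambda>z::real \<times> real. g (\<gamma> (snd z)))"
  have \<gamma>S: "\<gamma> s \<in> S" if "s \<in> {0..1}" for s
    using \<gamma>(2) that by (auto simp: path_image_def)
  have "continuous_map unit_space (top_of_set S) \<gamma>"
    using \<gamma> by (auto simp: path_def path_image_def)
  from continuous_map_compose[OF continuous_map_compose[OF continuous_map_snd this] g(1)]
  have "continuous_map (prod_topology unit_space unit_space) P G"
    by (simp only: G_def o_def)
  from slide[OF this] obtain \<Phi> N where
    \<Phi>: "continuous_map (prod_topology unit_space (prod_topology P unit_space)) P \<Phi>"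
      "\<forall>t\<in>{0..1}. \<forall>y\<in>topspace P. \<Phi> (t, y, 0) = y"
      "\<forall>t\<in>{0..1}. \<forall>s\<in>{0..1}. \<Phi> (t, G (t, 0), s) = G (t, max 0 (2 * s - 1))"
    and N: "openin P N" "G (0, 0) \<in> N" "\<forall>y\<in>N. \<Phi> (0, y, 1) = G (0, 1)" by blast
  have G0: "G (t, 0) = p" and G1: "G (t, 1) = q" for t
    using p q g(2) by (simp_all add: G_def pathstart_def pathfinish_def)
  define \<phi> where "\<phi> = (\<lambda>y. \<Phi> (0, y, 1))"
  have c0: "continuous_map P P \<phi>"
  proof -
    have "continuous_map P (prod_topology unit_space (prod_topology P unit_space)) (\<lambda>y. (0, y, 1))"
      by (intro continuous_map_pairedI) auto
    from continuous_map_compose[OF this \<Phi>(1)] show ?thesis by (simp add: \<phi>_def o_def)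
  qed
  have H: "continuous_map (prod_topology unit_space X) P (\<lambda>z. \<Phi> (0, f (snd z), fst z))"
    if f: "continuous_map X P f" for X :: "'a topology" and f
  proof -
    have "continuous_map (prod_topology unit_space X) (prod_topology unit_space (prod_topology P unit_space))
        (\<lambda>z. (0, f (snd z), fst z))"
      by (intro continuous_map_pairedI continuous_map_fst
          continuous_map_compose[OF continuous_map_snd f, unfolded o_def]) auto
    from continuous_map_compose[OF this \<Phi>(1)] show ?thesis by (simp add: o_def)
  qed
  have ends: "\<Phi> (0, f (snd (0, z)), fst (0, z)) = f z" if "continuous_map X P f" "z \<in> topspace X"
    for X :: "'a topology" and f z
  proof -
    have "f z \<in> topspace P" using continuous_map_funspace[OF that(1)] that(2) by blast
    then show ?thesis using \<Phi>(2) by simp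
  qed
  have along: "homotopic_along X x \<gamma> f (\<phi> \<circ> f)"
    if f: "continuous_map X P f" and x: "x \<in> topspace X" "f x = p" for X :: "'a topology" and x f
  proof -
    have "homotopic_paths S \<gamma> (\<lambda>t. h (\<Phi> (0, f x, t)))"
    \<comment> \<open>The track rests at p during the gathering phase s \<le> 1/2 and then runs
      through \<gamma> at double speed.\<close>
    proof (rule homotopic_paths_reparametrize[OF \<gamma>, where f = "\<lambda>s. max 0 (2 * s - 1)"])
      fix t :: real assume t: "t \<in> {0..1}"
      then have "max 0 (2 * t - 1) \<in> {0..1}" by auto
      moreover have "\<Phi> (0, f x, t) = G (0, max 0 (2 * t - 1))"
        using \<Phi>(3) t G0[of 0] x(2) by auto
      ultimately show "h (\<Phi> (0, f x, t)) = \<gamma> (max 0 (2 * t - 1))"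
        using g(3)[OF \<gamma>S] by (simp add: G_def)
    qed (auto intro!: continuous_intros)
    then show ?thesis
      unfolding homotopic_along_def
      using H[OF f] ends[OF f] by (intro exI[of _ "\<lambda>z. \<Phi> (0, f (snd z), fst z)"]) (simp add: \<phi>_def)
  qed
  have homotopic: "homotopic_with (\<lambda>_. True) X P f (\<phi> \<circ> f)" if f: "continuous_map X P f"
    for X :: "'a topology" and f
    by (rule homotopic_withI[OF H[OF f]]) (use ends[OF f] in \<open>simp_all add: \<phi>_def\<close>)
  show ?thesis
    by (rule that[OF c0 N(1) _ _ along homotopic]) (use N G0 G1 in \<open>simp_all add: \<phi>_def\<close>)
qed

text \<open>The key step. Let a contract the track of H to the constant path. At time t, slide H (t,
  _) along the path that the point H (t, x) describes under a; this carries the basepoint to p at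
  every t. It remains to compare the slid end maps with f and k.\<close>

lemma homotopic_along_null:
  assumes R: "homotopic_along X x \<gamma> f k" and x: "x \<in> topspace X" "f x = p" "p \<in> topspace P"
    and f: "continuous_map X P f" and k: "continuous_map X P k"
    and null: "homotopic_paths S \<gamma> (\<lambda>_. h p)"
  shows "homotopic_with (\<lambda>k. k x = p) X P f k"
proof -
  obtain H where H: "continuous_map (prod_topology unit_space X) P H"
    "\<And>z. z \<in> topspace X \<Longrightarrow> H (0, z) = f z" "\<And>z. z \<in> topspace X \<Longrightarrow> H (1, z) = k z"
    "homotopic_paths S \<gamma> (\<lambda>t. h (H (t, x)))"
    using R unfolding homotopic_along_def by blast
  have HP: "H (t, z) \<in> topspace P" if "t \<in> {0..1}" "z \<in> topspace X" for t z
    using continuous_map_funspace[OF H(1)] that by auto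
  have "homotopic_paths S (\<lambda>t. h (H (t, x))) (\<lambda>_. h p)"
    using H(4) null homotopic_paths_sym homotopic_paths_trans by blast
  then obtain a where a: "continuous_on ({0..1} \<times> {0..1}) a" "a \<in> ({0..1} \<times> {0..1}) \<rightarrow> S"
    "\<forall>t\<in>{0..1}. a (0, t) = h (H (t, x))" "\<forall>t\<in>{0..1}. a (1, t) = h p"
    "\<forall>u\<in>{0..1::real}. a (u, 0) = h (H (0, x)) \<and> a (u, 1) = h (H (1, x))"
    unfolding homotopic_paths pathstart_def pathfinish_def o_def by blast
  have kx: "k x = p"
    using homotopic_along_paths[OF R x(1)] homotopic_paths_imp_pathfinish[OF null] h_inj x
      continuous_map_funspace[OF k] by (auto simp: pathfinish_def)
  obtain g where g: "continuous_map (top_of_set S) P g" "\<And>y. y \<in> topspace P \<Longrightarrow> g (h y) = y"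
    "\<And>y. y \<in> S \<Longrightarrow> h (g y) = y" by (rule h_inverse) blast
  \<comment> \<open>The arguments are swapped: the slide parameter is the time of H, and the path
    runs in the direction of the contraction.\<close>
  define G where "G = (\<lambda>z::real \<times> real. g (a (snd z, fst z)))"
  have "continuous_on ({0..1} \<times> {0..1}) (\<lambda>z. a (snd z, fst z))"
    by (rule continuous_on_compose2[OF a(1)]) (auto intro!: continuous_intros)
  then have "continuous_map (prod_topology unit_space unit_space) (top_of_set S) (\<lambda>z. a (snd z, fst z))"
    using a(2) by auto
  from continuous_map_compose[OF this g(1)]
  have "continuous_map (prod_topology unit_space unit_space) P G"
    by (simp only: G_def o_def)
  from slide[OF this] obtain \<Phi> where
    \<Phi>: "continuous_map (prod_topology unit_space (prod_topology P unit_space)) P \<Phi>"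
      "\<And>t y. t \<in> {0..1} \<Longrightarrow> y \<in> topspace P \<Longrightarrow> \<Phi> (t, y, 0) = y"
      "\<And>t s. t \<in> {0..1} \<Longrightarrow> s \<in> {0..1} \<Longrightarrow> \<Phi> (t, G (t, 0), s) = G (t, max 0 (2 * s - 1))" by blast
  have G0: "G (t, 0) = H (t, x)" and G1: "G (t, 1) = p" if "t \<in> {0..1}" for t
    using a(3,4) that g(2) HP[OF that x(1)] x(3) by (simp_all add: G_def)
  have Ge: "G (0, s) = p" "G (1, s) = p" if "s \<in> {0..1}" for s
    using a(5) that g(2) H(2,3) x kx by (simp_all add: G_def)
  \<comment> \<open>The contraction fixes the ends of the track, so at t = 0 and t = 1 the sliding
    path is constant at p and the whole slide is a pointed homotopy.\<close>
  have still: "homotopic_with (\<lambda>k. k x = p) X P w (\<lambda>z. \<Phi> (t, w z, 1))"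
    if w: "continuous_map X P w" "w x = p" and t: "t = 0 \<or> t = 1" for w and t :: real
  proof -
    have t01: "t \<in> {0..1}" using t by auto
    have wP: "w z \<in> topspace P" if "z \<in> topspace X" for z
      using continuous_map_funspace[OF w(1)] that by auto
    have "continuous_map (prod_topology unit_space X) (prod_topology unit_space (prod_topology P unit_space))
        (\<lambda>z. (t, w (snd z), fst z))"
      using t01 by (intro continuous_map_pairedI continuous_map_fst
          continuous_map_compose[OF continuous_map_snd w(1), unfolded o_def]) auto
    from continuous_map_compose[OF this \<Phi>(1)]
    have c: "continuous_map (prod_topology unit_space X) P (\<lambda>z. \<Phi> (t, w (snd z), fst z))"
      by (simp add: o_def)
    have "\<Phi> (t, w x, s) = p" if s: "s \<in> {0..1}" for s
    proof -
      have "G (t, 0) = w x" using t Ge[of 0] w(2) by auto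
      moreover have "max 0 (2 * s - 1) \<in> {0..1}" using s by auto
      ultimately show ?thesis using \<Phi>(3)[OF t01 s] Ge[of "max 0 (2 * s - 1)"] t by auto
    qed
    then show ?thesis
      by (intro homotopic_with_basepointI[OF x(1) c]) (use \<Phi>(2)[OF t01 wP] in simp_all)
  qed
  \<comment> \<open>Each H (t, _) is taken at the end of its own slide, where the basepoint sits at
    p.\<close>
  have moved: "homotopic_with (\<lambda>k. k x = p) X P (\<lambda>z. \<Phi> (0, f z, 1)) (\<lambda>z. \<Phi> (1, k z, 1))"
  proof -
    have *: "\<Phi> (t, H (t, x), 1) = p" if "t \<in> {0..1}" for t
      using \<Phi>(3)[OF that, of 1] G0[OF that] G1[OF that] by simp
    have "continuous_map (prod_topology unit_space X) (prod_topology unit_space (prod_topology P unit_space))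
        (\<lambda>z. (fst z, H z, 1))"
      by (intro continuous_map_pairedI continuous_map_fst H(1)) auto
    from continuous_map_compose[OF this \<Phi>(1)]
    have "continuous_map (prod_topology unit_space X) P (\<lambda>z. \<Phi> (fst z, H z, 1))"
      by (simp add: o_def)
    from homotopic_with_basepointI[OF x(1) this] show ?thesis using H(2,3) * by simp
  qed
  show ?thesis
    by (rule homotopic_with_trans[OF homotopic_with_trans[OF still[OF f x(2)] moved]
          homotopic_with_symD[OF still[OF k kx]]]) simp_all
qed

end

section \<open>Loops and the fundamental group\<close>

text \<open>Running at double speed and then resting is a reparametrization of \<gamma>. Stated for
  topological spaces, as the model S lives in the product space
  \<open>nat \<Rightarrow> real\<close>.\<close>

lemma homotopic_paths_rconst:
  fixes \<gamma> :: "real \<Rightarrow> 'a::topological_space"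
  assumes "path \<gamma>" "path_image \<gamma> \<subseteq> S"
  shows "homotopic_paths S (\<gamma> +++ (\<lambda>_. pathfinish \<gamma>)) \<gamma>"
proof (rule homotopic_paths_sym, rule homotopic_paths_reparametrize[OF assms, where f = "\<lambda>t. min 1 (2 * t)"])
  fix t :: real
  have "min 1 (2 * t) = (if t \<le> 1 / 2 then 2 * t else 1)" by auto
  then show "(\<gamma> +++ (\<lambda>_. pathfinish \<gamma>)) t = \<gamma> (min 1 (2 * t))"
    by (simp add: joinpaths_def pathfinish_def)
qed (auto intro!: continuous_intros)

lemma homotopic_paths_lconst:
  fixes \<gamma> :: "real \<Rightarrow> 'a::topological_space"
  assumes "path \<gamma>" "path_image \<gamma> \<subseteq> S"
  shows "homotopic_paths S ((\<lambda>_. pathstart \<gamma>) +++ \<gamma>) \<gamma>"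
proof (rule homotopic_paths_sym, rule homotopic_paths_reparametrize[OF assms, where f = "\<lambda>t. max 0 (2 * t - 1)"])
  fix t :: real
  have "max 0 (2 * t - 1) = (if t \<le> 1 / 2 then 0 else 2 * t - 1)" by auto
  then show "((\<lambda>_. pathstart \<gamma>) +++ \<gamma>) t = \<gamma> (max 0 (2 * t - 1))"
    by (simp add: joinpaths_def pathstart_def)
qed (auto intro!: continuous_intros)

lemma homotopic_paths_reverse_right:
  fixes \<gamma> :: "real \<Rightarrow> 'a::topological_space"
  assumes "path \<gamma>" "path_image \<gamma> \<subseteq> S"
  shows "homotopic_paths S (\<lambda>_. pathstart \<gamma>) (\<gamma> +++ reversepath \<gamma>)"
  unfolding homotopic_paths
\<comment> \<open>The tent 1 - |2s - 1| goes out and back; the factor t limits how far out along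
  \<gamma> the path goes before it turns.\<close>
proof (intro exI[of _ "\<lambda>z. \<gamma> (fst z * (1 - \<bar>2 * snd z - 1\<bar>))"] conjI ballI)
  have in01: "t * (1 - \<bar>2 * s - 1\<bar>) \<in> {0..1}" if "t \<in> {0..1}" "s \<in> {0..1}" for t s :: real
    using that mult_le_one[of t "1 - \<bar>2 * s - 1\<bar>"] mult_nonneg_nonneg[of t "1 - \<bar>2 * s - 1\<bar>"]
    by (auto simp: abs_if)
  show "continuous_on ({0..1} \<times> {0..1}) (\<lambda>z. \<gamma> (fst z * (1 - \<bar>2 * snd z - 1\<bar>)))"
    using assms(1) unfolding path_def
    by (rule continuous_on_compose2) (use in01 in \<open>auto intro!: continuous_intros\<close>)
  show "(\<lambda>z. \<gamma> (fst z * (1 - \<bar>2 * snd z - 1\<bar>))) \<in> {0..1} \<times> {0..1} \<rightarrow> S"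
    using assms(2) in01 unfolding path_image_def by (auto simp: image_subset_iff)
  fix s :: real
  have "1 - \<bar>2 * s - 1\<bar> = (if s \<le> 1 / 2 then 2 * s else 1 - (2 * s - 1))" by auto
  then show "\<gamma> (fst (1, s) * (1 - \<bar>2 * snd (1, s) - 1\<bar>)) = (\<gamma> +++ reversepath \<gamma>) s"
    by (simp add: joinpaths_def reversepath_def)
qed (auto simp: pathstart_def pathfinish_def joinpaths_def reversepath_def)

lemma homotopic_paths_reverse_left:
  fixes \<gamma> :: "real \<Rightarrow> 'a::topological_space"
  assumes "path \<gamma>" "path_image \<gamma> \<subseteq> S"
  shows "homotopic_paths S (\<lambda>_. pathfinish \<gamma>) (reversepath \<gamma> +++ \<gamma>)"
  using homotopic_paths_reverse_right[of "reversepath \<gamma>" S] assms by simp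

definition circle_param :: "complex \<Rightarrow> real \<Rightarrow> complex" where
  "circle_param b s = b * cis (2 * pi * s)"

text \<open>A section of \<open>circle_param\<close> with values in [0,1). It jumps at b, so
  continuity of maps built from it has to be checked on the interval.\<close>

definition circle_angle :: "complex \<Rightarrow> complex \<Rightarrow> real" where
  "circle_angle b z = Arg2pi (z / b) / (2 * pi)"

lemma circle_angle_in: "circle_angle b z \<in> {0..<1}"
  using Arg2pi[of "z / b"] by (simp add: circle_angle_def field_simps)

lemma circle_param_in: "b \<in> sphere 0 1 \<Longrightarrow> circle_param b s \<in> sphere 0 1"
  by (simp add: circle_param_def norm_mult)

lemma circle_param_0 [simp]: "circle_param b 0 = b" and circle_param_1 [simp]: "circle_param b 1 = b"
  by (simp_all add: circle_param_def)

lemma circle_param_angle: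
  assumes "b \<in> sphere 0 1" "z \<in> sphere 0 1"
  shows "circle_param b (circle_angle b z) = z"
proof -
  have b: "b \<noteq> 0" using assms by auto
  have "norm (z / b) = 1" using assms by (simp add: norm_divide)
  then have "cis (Arg2pi (z / b)) = z / b"
    using complex_norm_eq_1_exp[of "z / b"] by (simp add: cis_conv_exp)
  then show ?thesis using b by (simp add: circle_param_def circle_angle_def)
qed

lemma circle_angle_param:
  assumes "b \<in> sphere 0 1" "s \<in> {0..<1}"
  shows "circle_angle b (circle_param b s) = s"
proof -
  have b: "b \<noteq> 0" using assms by auto
  have "Arg2pi (cis (2 * pi * s)) = 2 * pi * s"
    by (rule Arg2pi_unique[of 1]) (use assms in \<open>auto simp: cis_conv_exp\<close>)
  then show ?thesis using b by (simp add: circle_param_def circle_angle_def)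
qed

lemma topspace_circle [simp]: "topspace circle = sphere 0 1"
  by (simp add: circle_def)

text \<open>A continuous surjection from a compact to a Hausdorff space is a quotient map, and it
  remains one after multiplication with the locally compact interval. The first part lets paths
  descend to loops, the second lets path homotopies descend to homotopies of loops.\<close>

lemma quotient_map_circle_param:
  assumes b: "b \<in> sphere 0 1"
  shows "quotient_map unit_space circle (circle_param b)"
    and "quotient_map (prod_topology unit_space unit_space) (prod_topology unit_space circle)
           (\<lambda>(t, s). (t, circle_param b s))"
proof -
  have "continuous_map unit_space circle (circle_param b)"
    using circle_param_in[OF b] unfolding circle_def circle_param_def
    by (auto intro!: continuous_intros)
  moreover have "circle_param b ` topspace unit_space = topspace circle"
  proof
    show "circle_param b ` topspace unit_space \<subseteq> topspace circle" using circle_param_in[OF b] by auto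
    show "topspace circle \<subseteq> circle_param b ` topspace unit_space"
    proof
      fix z assume "z \<in> topspace circle"
      then have "z = circle_param b (circle_angle b z)" using circle_param_angle[OF b] by simp
      moreover have "circle_angle b z \<in> topspace unit_space" using circle_angle_in[of b z] by simp
      ultimately show "z \<in> circle_param b ` topspace unit_space" by blast
    qed
  qed
  moreover have "compact_space unit_space" by (simp add: compact_space_subtopology)
  moreover have "Hausdorff_space circle" by (simp add: circle_def Hausdorff_space_subtopology)
  ultimately show q: "quotient_map unit_space circle (circle_param b)"
    by (intro continuous_imp_quotient_map)
  show "quotient_map (prod_topology unit_space unit_space) (prod_topology unit_space circle)
      (\<lambda>(t, s). (t, circle_param b s))"
    by (rule quotient_map_prod_right[OF _ _ q])
      (simp_all add: Hausdorff_space_subtopology compact_imp_locally_compact_space compact_space_subtopology)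
qed

section \<open>Pointed homotopy classes\<close>

lemma equiv_pointed_homotopy_classes:
  "equiv (pointed_maps X x P p) (eqrel (pointed_homotopy_classes X x P p))"
proof (rule equivI)
  let ?R = "eqrel (pointed_homotopy_classes X x P p)"
  show "?R \<subseteq> pointed_maps X x P p \<times> pointed_maps X x P p"
    by (auto simp: pointed_homotopy_classes_def)
  show "refl_on (pointed_maps X x P p) ?R"
    by (rule refl_onI) (auto simp: pointed_homotopy_classes_def pointed_maps_def maps_def)
  show "sym ?R"
    by (rule symI) (auto simp: pointed_homotopy_classes_def intro: homotopic_with_symD)
  show "trans ?R"
    by (rule transI) (auto simp: pointed_homotopy_classes_def intro: homotopic_with_trans)
qed

lemma topspace_pointed_homotopy_classes [simp]:
  "topspace (ambient (pointed_homotopy_classes X x P p)) = pointed_maps X x P p"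
  by (auto simp: pointed_homotopy_classes_def pointed_maps_def)

definition pointed_class :: "'a topology \<Rightarrow> 'a \<Rightarrow> 'b topology \<Rightarrow> 'b \<Rightarrow> ('a \<Rightarrow> 'b) \<Rightarrow> ('a \<Rightarrow> 'b) set" where
  "pointed_class X x P p f = eqrel (pointed_homotopy_classes X x P p) `` {f}"

lemma pointed_class_eq_iff:
  assumes "f \<in> pointed_maps X x P p" "g \<in> pointed_maps X x P p"
  shows "pointed_class X x P p f = pointed_class X x P p g \<longleftrightarrow> homotopic_with (\<lambda>k. k x = p) X P f g"
  using eq_equiv_class_iff[OF equiv_pointed_homotopy_classes assms] assms
  by (simp add: pointed_class_def pointed_homotopy_classes_def)

lemma mem_pointed_class:
  assumes "f \<in> pointed_maps X x P p"
  shows "g \<in> pointed_class X x P p f \<longleftrightarrow>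
    g \<in> pointed_maps X x P p \<and> homotopic_with (\<lambda>k. k x = p) X P f g"
  using assms by (auto simp: pointed_class_def pointed_homotopy_classes_def)

lemma pointed_class_self: "f \<in> pointed_maps X x P p \<Longrightarrow> f \<in> pointed_class X x P p f"
  unfolding pointed_class_def by (rule equiv_class_self[OF equiv_pointed_homotopy_classes])

lemma pointed_class_in: "f \<in> pointed_maps X x P p \<Longrightarrow>
    pointed_class X x P p f \<in> quotient_set (pointed_homotopy_classes X x P p)"
  by (simp add: quotient_set_def pointed_class_def quotientI)

lemma quotient_setE:
  assumes "C \<in> quotient_set (pointed_homotopy_classes X x P p)"
  obtains f where "f \<in> pointed_maps X x P p" "C = pointed_class X x P p f"
  using assms unfolding quotient_set_def topspace_pointed_homotopy_classes pointed_class_def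
  by (rule quotientE)

section \<open>Loops on the circle as closed paths in the model\<close>

context sliding
begin

definition loop_path :: "complex \<Rightarrow> (complex \<Rightarrow> 'b) \<Rightarrow> real \<Rightarrow> nat \<Rightarrow> real" where
  "loop_path b l s = h (l (circle_param b s))"

context
  fixes b :: complex and p :: 'b
  assumes b: "b \<in> sphere 0 1" and p: "p \<in> topspace P"
begin

lemma loop_path:
  assumes "l \<in> pointed_maps circle b P p"
  shows "path (loop_path b l)" "path_image (loop_path b l) \<subseteq> S"
    "pathstart (loop_path b l) = h p" "pathfinish (loop_path b l) = h p"
proof -
  have l: "continuous_map circle P l" "l b = p" using assms by (auto simp: pointed_maps_def maps_def)
  from continuous_map_compose[OF continuous_map_compose[OF
      quotient_imp_continuous_map[OF quotient_map_circle_param(1)[OF b]] l(1)] h_continuous]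
  have "continuous_map unit_space (top_of_set S) (loop_path b l)"
    by (simp add: o_def loop_path_def[abs_def])
  then show "path (loop_path b l)" "path_image (loop_path b l) \<subseteq> S"
    by (auto simp: path_def path_image_def)
  show "pathstart (loop_path b l) = h p" "pathfinish (loop_path b l) = h p"
    by (simp_all add: pathstart_def pathfinish_def loop_path_def l)
qed

text \<open>Continuity is checked after composing with the quotient map
  \<open>circle_param b\<close>. There the only delicate value is s = 1, where
  \<open>circle_angle\<close> returns 0; it matches because \<gamma> is closed.\<close>

lemma loop_of_path:
  assumes \<gamma>: "path \<gamma>" "path_image \<gamma> \<subseteq> S" "pathstart \<gamma> = h p" "pathfinish \<gamma> = h p"
  obtains l where "l \<in> pointed_maps circle b P p" "\<And>s. s \<in> {0..1} \<Longrightarrow> loop_path b l s = \<gamma> s"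
proof -
  obtain g where g: "continuous_map (top_of_set S) P g" "\<And>y. y \<in> topspace P \<Longrightarrow> g (h y) = y"
    "\<And>y. y \<in> S \<Longrightarrow> h (g y) = y" by (rule h_inverse) blast
  define m where "m z = g (\<gamma> (circle_angle b z))" for z
  have m: "m (circle_param b s) = g (\<gamma> s)" if "s \<in> {0..1}" for s
  proof (cases "s = 1")
    case True
    have "circle_angle b b = 0" using circle_angle_param[OF b, of 0] by simp
    then show ?thesis using True \<gamma>(3,4) by (simp add: m_def pathstart_def pathfinish_def)
  next
    case False
    then show ?thesis using that circle_angle_param[OF b, of s] by (simp add: m_def)
  qed
  have c: "continuous_map unit_space (top_of_set S) \<gamma>"
    using \<gamma> by (auto simp: path_def path_image_def)
  have "continuous_map unit_space P (m \<circ> circle_param b)"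
    by (rule continuous_map_eq[OF continuous_map_compose[OF c g(1)]]) (simp add: m)
  then have "continuous_map circle P m"
    by (rule continuous_compose_quotient_map[OF quotient_map_circle_param(1)[OF b]])
  then have "restrict m (topspace circle) \<in> maps circle P" by (rule restrict_in_maps)
  moreover have "m b = p" using m[of 0] \<gamma>(3) g(2) p by (simp add: pathstart_def)
  ultimately have "restrict m (topspace circle) \<in> pointed_maps circle b P p"
    using b by (simp add: pointed_maps_def)
  moreover have "loop_path b (restrict m (topspace circle)) s = \<gamma> s" if "s \<in> {0..1}" for s
  proof -
    have "\<gamma> s \<in> S" using \<gamma>(2) that by (auto simp: path_image_def)
    then show ?thesis using m[OF that] g(3) circle_param_in[OF b, of s] by (simp add: loop_path_def)
  qed
  ultimately show ?thesis by (rule that)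
qed

text \<open>Lets the group laws and the action be computed with path homotopies. A path homotopy
  with fixed ends takes equal values at s = 0 and s = 1, hence descends to a pointed homotopy on the
  circle.\<close>

lemma homotopic_loop_paths_iff:
  assumes l: "l \<in> pointed_maps circle b P p" and m: "m \<in> pointed_maps circle b P p"
  shows "homotopic_with (\<lambda>k. k b = p) circle P l m \<longleftrightarrow> homotopic_paths S (loop_path b l) (loop_path b m)"
proof
  assume "homotopic_with (\<lambda>k. k b = p) circle P l m"
  then obtain H where H: "continuous_map (prod_topology unit_space circle) P H"
    "\<And>z. H (0, z) = l z" "\<And>z. H (1, z) = m z" "\<And>t. t \<in> {0..1} \<Longrightarrow> H (t, b) = p"
    unfolding homotopic_with_def by blast
  from continuous_map_compose[OF continuous_map_compose[OF
      quotient_imp_continuous_map[OF quotient_map_circle_param(2)[OF b]] H(1)] h_continuous]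
  have "continuous_map (prod_topology unit_space unit_space) (top_of_set S)
      (\<lambda>z. h (H (fst z, circle_param b (snd z))))"
    by (simp only: o_def split_beta)
  then have c: "continuous_on ({0..1} \<times> {0..1}) (\<lambda>z. h (H (fst z, circle_param b (snd z))))"
    "(\<lambda>z. h (H (fst z, circle_param b (snd z)))) \<in> {0..1} \<times> {0..1} \<rightarrow> S"
    by auto
  show "homotopic_paths S (loop_path b l) (loop_path b m)"
    unfolding homotopic_paths
    by (intro exI[of _ "\<lambda>z. h (H (fst z, circle_param b (snd z)))"] conjI c)
      (use H loop_path[OF l] in \<open>auto simp: loop_path_def pathstart_def pathfinish_def\<close>)
next
  assume "homotopic_paths S (loop_path b l) (loop_path b m)"
  then obtain a where a: "continuous_on ({0..1} \<times> {0..1}) a" "a \<in> ({0..1} \<times> {0..1}) \<rightarrow> S"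
    "\<forall>t\<in>{0..1}. a (0, t) = loop_path b l t" "\<forall>t\<in>{0..1}. a (1, t) = loop_path b m t"
    "\<forall>u\<in>{0..1::real}. a (u, 0) = loop_path b l 0 \<and> a (u, 1) = loop_path b l 1"
    unfolding homotopic_paths pathstart_def pathfinish_def o_def by blast
  have lm: "continuous_map circle P l" "l b = p" "continuous_map circle P m" "m b = p"
    using l m by (auto simp: pointed_maps_def maps_def)
  obtain g where g: "continuous_map (top_of_set S) P g" "\<And>y. y \<in> topspace P \<Longrightarrow> g (h y) = y"
    "\<And>y. y \<in> S \<Longrightarrow> h (g y) = y" by (rule h_inverse) blast
  define H where "H z = g (a (fst z, circle_angle b (snd z)))" for z
  have H: "H (t, circle_param b s) = g (a (t, s))" if ts: "t \<in> {0..1}" "s \<in> {0..1}" for t s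
  proof (cases "s = 1")
    case True
    have "circle_angle b b = 0" using circle_angle_param[OF b, of 0] by simp
    moreover have "a (t, 0) = a (t, 1)" using a(5) ts(1) by (simp add: loop_path_def)
    ultimately show ?thesis using True by (simp add: H_def)
  next
    case False
    then show ?thesis using ts circle_angle_param[OF b, of s] by (simp add: H_def)
  qed
  have "continuous_map (prod_topology unit_space unit_space) (top_of_set S) a"
    using a(1,2) by auto
  from continuous_map_compose[OF this g(1)]
  have "continuous_map (prod_topology unit_space unit_space) P (H \<circ> (\<lambda>(t, s). (t, circle_param b s)))"
    by (rule continuous_map_eq) (use H in auto)
  then have cH: "continuous_map (prod_topology unit_space circle) P H"
    by (rule continuous_compose_quotient_map[OF quotient_map_circle_param(2)[OF b]])
  have ang: "circle_angle b z \<in> {0..1}" for z using circle_angle_in[of b z] by simp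
  show "homotopic_with (\<lambda>k. k b = p) circle P l m"
  proof (rule homotopic_with_basepointI[OF _ cH])
    show "b \<in> topspace circle" using b by simp
    fix z assume z: "z \<in> topspace circle"
    then have zb: "circle_param b (circle_angle b z) = z" using circle_param_angle[OF b] by simp
    have "l z \<in> topspace P" "m z \<in> topspace P"
      using continuous_map_funspace[OF lm(1)] continuous_map_funspace[OF lm(3)] z by blast+
    then show "H (0, z) = l z" "H (1, z) = m z"
      using a(3,4) ang[of z] g(2) zb by (simp_all add: H_def loop_path_def)
  next
    fix t :: real assume "t \<in> {0..1}"
    then show "H (t, b) = p" using H[of t 0] a(5) g(2) p lm by (simp add: loop_path_def)
  qed
qed

text \<open>The concatenation is recognized as the loop k obtained from the joined path: the two
  agree after applying the injective h. This spares pasting at b and at its antipode.\<close>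

lemma circle_concat_pointed:
  assumes l: "l \<in> pointed_maps circle b P p" and m: "m \<in> pointed_maps circle b P p"
  shows "circle_concat b l m \<in> pointed_maps circle b P p"
    and "homotopic_paths S (loop_path b l +++ loop_path b m) (loop_path b (circle_concat b l m))"
proof -
  let ?c = "circle_concat b l m" and ?j = "loop_path b l +++ loop_path b m"
  note lp = loop_path[OF l] and mp = loop_path[OF m]
  have j: "path ?j" "path_image ?j \<subseteq> S" "pathstart ?j = h p" "pathfinish ?j = h p"
    using lp mp by (auto simp: subset_path_image_join)
  have lmP: "l z \<in> topspace P" "m z \<in> topspace P" if "z \<in> sphere 0 1" for z
    using l m that maps_in[of _ circle P z] by (simp_all add: pointed_maps_def)
  have c: "?c z = (if circle_angle b z \<le> 1 / 2 then l (circle_param b (2 * circle_angle b z))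
      else m (circle_param b (2 * circle_angle b z - 1)))" if "z \<in> sphere 0 1" for z
    using that by (simp add: circle_concat_def Let_def circle_angle_def circle_param_def)
  then have hc: "h (?c z) = ?j (circle_angle b z)" if "z \<in> sphere 0 1" for z
    using that by (simp add: joinpaths_def loop_path_def)
  obtain k where k: "k \<in> pointed_maps circle b P p" "\<And>s. s \<in> {0..1} \<Longrightarrow> loop_path b k s = ?j s"
    using loop_of_path[OF j] by blast
  have "?c = k"
  proof (rule extensionalityI[of _ "sphere 0 1"])
    show "?c \<in> extensional (sphere 0 1)" by (simp add: circle_concat_def)
    show "k \<in> extensional (sphere 0 1)" using k(1) by (simp add: pointed_maps_def maps_def)
    fix z :: complex assume z: "z \<in> sphere 0 1"
    have "circle_angle b z \<in> {0..1}" using circle_angle_in[of b z] by simp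
    then have "h (k z) = ?j (circle_angle b z)"
      using k(2)[of "circle_angle b z"] circle_param_angle[OF b z] by (simp add: loop_path_def)
    then have "h (?c z) = h (k z)" using hc[OF z] by simp
    moreover have "?c z \<in> topspace P"
      unfolding c[OF z] using lmP circle_param_in[OF b] by auto
    moreover have "k z \<in> topspace P" using k(1) z maps_in[of k circle P z] by (simp add: pointed_maps_def)
    ultimately show "?c z = k z" using h_inj by blast
  qed
  then show "?c \<in> pointed_maps circle b P p" using k(1) by simp
  show "homotopic_paths S ?j (loop_path b ?c)"
    using k(2) \<open>?c = k\<close> by (intro homotopic_paths_eq j) simp
qed

lemma constant_loop_pointed:
  "(\<lambda>z\<in>sphere 0 1. p) \<in> pointed_maps circle b P p"
  "homotopic_paths S (\<lambda>_. h p) (loop_path b (\<lambda>z\<in>sphere 0 1. p))"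
proof -
  have "restrict (\<lambda>z. p) (topspace circle) \<in> maps circle P" using p by (intro restrict_in_maps) simp
  then show "(\<lambda>z\<in>sphere 0 1. p) \<in> pointed_maps circle b P p" using b by (simp add: pointed_maps_def)
  show "homotopic_paths S (\<lambda>_. h p) (loop_path b (\<lambda>z\<in>sphere 0 1. p))"
    using circle_param_in[OF b] h_in[OF p]
    by (intro homotopic_paths_eq) (auto simp: path_def path_image_def loop_path_def)
qed

section \<open>The group structure on classes of loops\<close>

abbreviation loop_class :: "(complex \<Rightarrow> 'b) \<Rightarrow> (complex \<Rightarrow> 'b) set" where
  "loop_class \<equiv> pointed_class circle b P p"

lemma loop_class_eq_iff:
  "l \<in> pointed_maps circle b P p \<Longrightarrow> m \<in> pointed_maps circle b P p \<Longrightarrow>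
   loop_class l = loop_class m \<longleftrightarrow> homotopic_paths S (loop_path b l) (loop_path b m)"
  by (simp add: pointed_class_eq_iff homotopic_loop_paths_iff)

lemma fundamental_group_carrier:
  "carrier (fundamental_group b P p) = quotient_set (pointed_homotopy_classes circle b P p)"
  by (simp add: fundamental_group_def Let_def)

lemma fundamental_group_one:
  "\<one>\<^bsub>fundamental_group b P p\<^esub> = loop_class (\<lambda>z\<in>sphere 0 1. p)"
  by (simp add: fundamental_group_def Let_def pointed_class_def)

text \<open>The product is defined as a union over all representatives. Concatenation respects path
  homotopy, so all members of the union are one and the same class.\<close>

lemma fundamental_group_mult:
  assumes l: "l \<in> pointed_maps circle b P p" and m: "m \<in> pointed_maps circle b P p"
  shows "loop_class l \<otimes>\<^bsub>fundamental_group b P p\<^esub> loop_class m = loop_class (circle_concat b l m)"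
proof -
  have "loop_class (circle_concat b f g) = loop_class (circle_concat b l m)"
    if f: "f \<in> loop_class l" and g: "g \<in> loop_class m" for f g
  proof -
    have fp: "f \<in> pointed_maps circle b P p" "homotopic_paths S (loop_path b l) (loop_path b f)"
      using f by (simp_all add: mem_pointed_class[OF l] flip: homotopic_loop_paths_iff[OF l])
    have gp: "g \<in> pointed_maps circle b P p" "homotopic_paths S (loop_path b m) (loop_path b g)"
      using g by (simp_all add: mem_pointed_class[OF m] flip: homotopic_loop_paths_iff[OF m])
    have "homotopic_paths S (loop_path b l +++ loop_path b m) (loop_path b f +++ loop_path b g)"
      using fp gp loop_path[OF l] loop_path[OF m] by (intro homotopic_paths_join) auto
    then have "homotopic_paths S (loop_path b (circle_concat b f g)) (loop_path b (circle_concat b l m))"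
      using circle_concat_pointed(2)[OF l m] circle_concat_pointed(2)[OF fp(1) gp(1)]
        homotopic_paths_trans homotopic_paths_sym by meson
    then show ?thesis
      by (simp add: loop_class_eq_iff circle_concat_pointed(1) l m fp(1) gp(1))
  qed
  moreover have "l \<in> loop_class l" "m \<in> loop_class m" using l m by (simp_all add: pointed_class_self)
  ultimately have "(\<Union>f\<in>loop_class l. \<Union>g\<in>loop_class m. loop_class (circle_concat b f g))
      = loop_class (circle_concat b l m)" by blast
  then show ?thesis by (simp add: fundamental_group_def Let_def pointed_class_def)
qed

text \<open>Each law is a homotopy between joined paths, carried over by
  \<open>loop_class_eq_iff\<close>; \<open>groupI\<close> asks only for a left unit and left
  inverses.\<close>

lemma group_fundamental_group: "group (fundamental_group b P p)" (is "group ?G")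
proof (rule groupI)
  note [simp] = fundamental_group_carrier
  fix \<alpha> assume "\<alpha> \<in> carrier ?G"
  then obtain l where l: "l \<in> pointed_maps circle b P p" "\<alpha> = loop_class l"
    by (auto elim: quotient_setE)
  note lp = loop_path[OF l(1)]
  show "\<one>\<^bsub>?G\<^esub> \<otimes>\<^bsub>?G\<^esub> \<alpha> = \<alpha>"
  proof -
    have "homotopic_paths S ((\<lambda>_. h p) +++ loop_path b l) (loop_path b l)"
      using homotopic_paths_lconst[OF lp(1,2)] lp(3) by simp
    moreover have "homotopic_paths S ((\<lambda>_. h p) +++ loop_path b l)
        (loop_path b (\<lambda>z\<in>sphere 0 1. p) +++ loop_path b l)"
      using constant_loop_pointed(2) lp by (intro homotopic_paths_join) (auto simp: pathfinish_def)
    ultimately have "homotopic_paths S (loop_path b (circle_concat b (\<lambda>z\<in>sphere 0 1. p) l)) (loop_path b l)"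
      using circle_concat_pointed(2)[OF constant_loop_pointed(1) l(1)]
        homotopic_paths_trans homotopic_paths_sym by meson
    then show ?thesis
      by (simp add: fundamental_group_one l(2) fundamental_group_mult constant_loop_pointed(1)
          l(1) loop_class_eq_iff circle_concat_pointed(1))
  qed
  show "\<exists>\<beta>\<in>carrier ?G. \<beta> \<otimes>\<^bsub>?G\<^esub> \<alpha> = \<one>\<^bsub>?G\<^esub>"
  proof -
    have "path (reversepath (loop_path b l))" "path_image (reversepath (loop_path b l)) \<subseteq> S"
      "pathstart (reversepath (loop_path b l)) = h p" "pathfinish (reversepath (loop_path b l)) = h p"
      using lp by simp_all
    then obtain m where m: "m \<in> pointed_maps circle b P p"
      "\<And>s. s \<in> {0..1} \<Longrightarrow> loop_path b m s = reversepath (loop_path b l) s"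
      using loop_of_path by blast
    note mp = loop_path[OF m(1)]
    have "homotopic_paths S (loop_path b m) (reversepath (loop_path b l))"
      using m(2) by (intro homotopic_paths_eq mp)
    then have "homotopic_paths S (loop_path b m +++ loop_path b l) (reversepath (loop_path b l) +++ loop_path b l)"
      using lp mp by (intro homotopic_paths_join) auto
    moreover have "homotopic_paths S (\<lambda>_. h p) (reversepath (loop_path b l) +++ loop_path b l)"
      using homotopic_paths_reverse_left[OF lp(1,2)] lp(4) by simp
    ultimately have "homotopic_paths S (loop_path b (circle_concat b m l)) (loop_path b (\<lambda>z\<in>sphere 0 1. p))"
      using circle_concat_pointed(2)[OF m(1) l(1)] constant_loop_pointed(2)
        homotopic_paths_trans homotopic_paths_sym by meson
    then have "loop_class m \<otimes>\<^bsub>?G\<^esub> \<alpha> = \<one>\<^bsub>?G\<^esub>"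
      by (simp add: fundamental_group_one l(2) fundamental_group_mult constant_loop_pointed(1)
          m(1) l(1) loop_class_eq_iff circle_concat_pointed(1))
    then show ?thesis using m(1) by (auto intro: pointed_class_in)
  qed
  fix \<beta> assume "\<beta> \<in> carrier ?G"
  then obtain m where m: "m \<in> pointed_maps circle b P p" "\<beta> = loop_class m"
    by (auto elim: quotient_setE)
  note mp = loop_path[OF m(1)]
  show "\<alpha> \<otimes>\<^bsub>?G\<^esub> \<beta> \<in> carrier ?G"
    by (simp add: l m fundamental_group_mult pointed_class_in circle_concat_pointed(1))
  fix \<delta> assume "\<delta> \<in> carrier ?G"
  then obtain n where n: "n \<in> pointed_maps circle b P p" "\<delta> = loop_class n"
    by (auto elim: quotient_setE)
  note np = loop_path[OF n(1)]
  show "\<alpha> \<otimes>\<^bsub>?G\<^esub> \<beta> \<otimes>\<^bsub>?G\<^esub> \<delta> = \<alpha> \<otimes>\<^bsub>?G\<^esub> (\<beta> \<otimes>\<^bsub>?G\<^esub> \<delta>)"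
  proof -
    let ?l = "loop_path b l" and ?m = "loop_path b m" and ?n = "loop_path b n"
    have lm: "circle_concat b l m \<in> pointed_maps circle b P p"
      "circle_concat b m n \<in> pointed_maps circle b P p"
      using l m n by (simp_all add: circle_concat_pointed(1))
    have "homotopic_paths S ((?l +++ ?m) +++ ?n) (loop_path b (circle_concat b l m) +++ ?n)"
      using circle_concat_pointed(2)[OF l(1) m(1)] mp np by (intro homotopic_paths_join) auto
    moreover have "homotopic_paths S (?l +++ (?m +++ ?n)) (?l +++ loop_path b (circle_concat b m n))"
      using circle_concat_pointed(2)[OF m(1) n(1)] lp mp by (intro homotopic_paths_join) auto
    moreover have "homotopic_paths S (?l +++ (?m +++ ?n)) ((?l +++ ?m) +++ ?n)"
      using lp mp np by (intro homotopic_paths_assoc) auto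
    ultimately have "homotopic_paths S (loop_path b (circle_concat b (circle_concat b l m) n))
        (loop_path b (circle_concat b l (circle_concat b m n)))"
      using circle_concat_pointed(2)[OF lm(1) n(1)] circle_concat_pointed(2)[OF l(1) lm(2)]
        homotopic_paths_trans homotopic_paths_sym by meson
    then show ?thesis
      by (simp add: l m n fundamental_group_mult loop_class_eq_iff circle_concat_pointed(1) lm)
  qed
qed (simp add: fundamental_group_carrier fundamental_group_one pointed_class_in constant_loop_pointed(1))

end

end

section \<open>Homotopy relations are analytic\<close>

text \<open>R is the image of the closed set Z of homotopies, inside the Polish space of maps from
  [0,1] x X to P, under the continuous map taking both ends. T lists the times at which the track is
  pinned to p: the empty set gives free homotopy, [0,1] pointed homotopy, and {0, 1} free homotopy
  of pointed maps.\<close>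

lemma analytic_homotopy_relation:
  fixes X :: "'a topology" and P :: "'b topology" and T :: "real set"
  assumes X: "Polish_space X" "locally_compact_space X" and x: "x \<in> topspace X"
    and P: "Polish_space P" and p: "p \<in> topspace P" and T: "T \<subseteq> {0..1}"
    and R: "R = {(f, g). f \<in> maps X P \<and> g \<in> maps X P \<and>
       (\<exists>H. continuous_map (prod_topology unit_space X) P H \<and>
         (\<forall>z\<in>topspace X. H (0, z) = f z \<and> H (1, z) = g z) \<and> (\<forall>t\<in>T. H (t, x) = p))}"
    and U: "R \<subseteq> U \<times> U"
  shows "analytic_in (prod_topology (subtopology (compact_open_topology X P) U)
                                    (subtopology (compact_open_topology X P) U)) R"
proof -
  let ?IX = "prod_topology unit_space X"
  let ?W = "compact_open_topology ?IX P"
  let ?C = "compact_open_topology X P"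
  define r where "r t H = restrict (H \<circ> Pair t) (topspace X)" for t :: real and H :: "real \<times> 'a \<Rightarrow> 'b"
  define Z where "Z = {H \<in> maps ?IX P. \<forall>t\<in>T. H (t, x) = p}"
  have I: "Polish_space unit_space" "locally_compact_space unit_space"
    by (simp_all add: Polish_space_top_of_set_compact compact_imp_locally_compact_space compact_space_subtopology)
  have "Polish_space ?IX" using I X by (intro Polish_space_prod_topology)
  moreover have "locally_compact_space ?IX" using I X by (simp add: locally_compact_space_prod_topology)
  ultimately have W: "Polish_space ?W" using P by (intro Polish_space_compact_open)
  have "closedin ?W Z"
  proof -
    have *: "closedin ?W {H \<in> topspace ?W. H (t, x) = p}" if "t \<in> T" for t
    proof (rule closedin_continuous_maps_eq[OF Polish_imp_Hausdorff[OF P]])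
      show "continuous_map ?W P (\<lambda>H. H (t, x))"
        using that T x by (intro continuous_map_evaluation) auto
    qed (use p in simp)
    have "closedin ?W C" if "C \<in> insert (topspace ?W) ((\<lambda>t. {H \<in> topspace ?W. H (t, x) = p}) ` T)" for C
      using that * closedin_topspace[of ?W] by blast
    then have "closedin ?W (\<Inter> (insert (topspace ?W) ((\<lambda>t. {H \<in> topspace ?W. H (t, x) = p}) ` T)))"
      by (intro closedin_Inter) simp_all
    moreover have "\<Inter> (insert (topspace ?W) ((\<lambda>t. {H \<in> topspace ?W. H (t, x) = p}) ` T)) = Z"
      by (auto simp: Z_def)
    ultimately show ?thesis by (simp only:)
  qed
  then have WZ: "Polish_space (subtopology ?W Z)" using W by (intro Polish_space_closedin)
  have r: "continuous_map ?W ?C (r t)" if "t \<in> {0..1}" for t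
    unfolding r_def using that
    by (intro continuous_map_precompose continuous_map_pairedI) auto
  have image: "(\<lambda>H. (r 0 H, r 1 H)) ` Z = R"
  proof (intro Set.set_eqI iffI)
    fix w assume "w \<in> (\<lambda>H. (r 0 H, r 1 H)) ` Z"
    then obtain H where H: "H \<in> Z" "w = (r 0 H, r 1 H)" by blast
    then have "H \<in> maps ?IX P" by (simp add: Z_def)
    then have "r t H \<in> maps X P" if "t \<in> {0..1}" for t
      using continuous_map_funspace[OF r[OF that]] by auto
    moreover have "continuous_map ?IX P H" using \<open>H \<in> maps ?IX P\<close> by (rule maps_continuous)
    ultimately show "w \<in> R"
      using H by (auto simp: R Z_def r_def intro!: exI[of _ H])
  next
    fix w assume "w \<in> R"
    then obtain f g H where w: "w = (f, g)" "f \<in> maps X P" "g \<in> maps X P"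
      "continuous_map ?IX P H" "\<forall>z\<in>topspace X. H (0, z) = f z \<and> H (1, z) = g z" "\<forall>t\<in>T. H (t, x) = p"
      unfolding R by blast
    \<comment> \<open>Members of the mapping space are extensional, so the homotopy is cut down to
      its domain.\<close>
    let ?H = "restrict H (topspace ?IX)"
    have "?H \<in> Z"
      using restrict_in_maps[OF w(4)] w(6) T x unfolding Z_def by auto
    moreover have "r 0 ?H = f" "r 1 ?H = g"
      using w(2,3,5) by (auto simp: r_def maps_def intro!: extensionalityI[of _ "topspace X"])
    ultimately show "w \<in> (\<lambda>H. (r 0 H, r 1 H)) ` Z" using w(1)
      by (intro image_eqI[of _ _ ?H]) simp_all
  qed
  have tZ: "topspace (subtopology ?W Z) = Z" by (auto simp: Z_def)
  have "r 0 H \<in> U" "r 1 H \<in> U" if "H \<in> Z" for H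
    using image U that by blast+
  then have "continuous_map (subtopology ?W Z)
      (prod_topology (subtopology ?C U) (subtopology ?C U)) (\<lambda>H. (r 0 H, r 1 H))"
    by (intro continuous_map_pairedI continuous_map_into_subtopology continuous_map_from_subtopology r)
      (auto simp: tZ)
  then show ?thesis
    by (rule analytic_inI[OF WZ]) (simp only: tZ image)
qed

lemma homotopic_with_True_iff:
  "homotopic_with (\<lambda>_. True) X P f g \<longleftrightarrow>
    (\<exists>H. continuous_map (prod_topology unit_space X) P H \<and>
      (\<forall>z\<in>topspace X. H (0, z) = f z \<and> H (1, z) = g z))"
proof
  assume "homotopic_with (\<lambda>_. True) X P f g"
  then show "\<exists>H. continuous_map (prod_topology unit_space X) P H \<and>
      (\<forall>z\<in>topspace X. H (0, z) = f z \<and> H (1, z) = g z)"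
    unfolding homotopic_with_def by blast
qed (blast intro: homotopic_withI)

lemma homotopic_with_basepoint_iff:
  assumes "x \<in> topspace X"
  shows "homotopic_with (\<lambda>k. k x = p) X P f g \<longleftrightarrow>
    (\<exists>H. continuous_map (prod_topology unit_space X) P H \<and>
      (\<forall>z\<in>topspace X. H (0, z) = f z \<and> H (1, z) = g z) \<and> (\<forall>t\<in>{0..1}. H (t, x) = p))"
proof
  assume "homotopic_with (\<lambda>k. k x = p) X P f g"
  then show "\<exists>H. continuous_map (prod_topology unit_space X) P H \<and>
      (\<forall>z\<in>topspace X. H (0, z) = f z \<and> H (1, z) = g z) \<and> (\<forall>t\<in>{0..1}. H (t, x) = p)"
    unfolding homotopic_with_def by blast
qed (blast intro: homotopic_with_basepointI[OF assms])

lemma semidefinable_homotopy_classes: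
  assumes X: "Polish_space X" "locally_compact_space X" and x: "x \<in> topspace X"
    and P: "Polish_space P" and p: "p \<in> topspace P"
  shows "semidefinable (homotopy_classes X P)"
proof -
  let ?R = "eqrel (homotopy_classes X P)"
  have "equiv (maps X P) ?R"
  proof (rule equivI)
    show "?R \<subseteq> maps X P \<times> maps X P" by (auto simp: homotopy_classes_def)
    show "refl_on (maps X P) ?R"
      by (rule refl_onI) (auto simp: homotopy_classes_def maps_def)
    show "sym ?R"
      by (rule symI) (auto simp: homotopy_classes_def intro: homotopic_with_symD)
    show "trans ?R"
      by (rule transI) (auto simp: homotopy_classes_def intro: homotopic_with_trans)
  qed
  moreover have "analytic_in (prod_topology (subtopology (compact_open_topology X P) (maps X P))
      (subtopology (compact_open_topology X P) (maps X P))) ?R"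
    by (rule analytic_homotopy_relation[OF X x P p, of "{}"])
      (auto simp: homotopy_classes_def homotopic_with_True_iff)
  moreover have "subtopology (compact_open_topology X P) (maps X P) = compact_open_topology X P"
    by (metis subtopology_topspace topspace_compact_open_topology)
  ultimately show ?thesis
    unfolding semidefinable_def using Polish_space_compact_open[OF X P]
    by (simp add: homotopy_classes_def)
qed

lemma Polish_space_pointed_maps:
  assumes X: "Polish_space X" "locally_compact_space X" and x: "x \<in> topspace X"
    and P: "Polish_space P" and p: "p \<in> topspace P"
  shows "Polish_space (subtopology (compact_open_topology X P) (pointed_maps X x P p))"
proof (rule Polish_space_closedin[OF Polish_space_compact_open[OF X P]])
  have "closedin (compact_open_topology X P) {f \<in> topspace (compact_open_topology X P). f x = p}"
    by (rule closedin_continuous_maps_eq[OF Polish_imp_Hausdorff[OF P] continuous_map_evaluation[OF x]])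
      (use p in simp)
  then show "closedin (compact_open_topology X P) (pointed_maps X x P p)"
    by (simp add: pointed_maps_def)
qed

lemma semidefinable_pointed_homotopy_classes:
  assumes X: "Polish_space X" "locally_compact_space X" and x: "x \<in> topspace X"
    and P: "Polish_space P" and p: "p \<in> topspace P"
  shows "semidefinable (pointed_homotopy_classes X x P p)"
proof -
  have "analytic_in (prod_topology (subtopology (compact_open_topology X P) (pointed_maps X x P p))
      (subtopology (compact_open_topology X P) (pointed_maps X x P p)))
      (eqrel (pointed_homotopy_classes X x P p))"
  proof (rule analytic_homotopy_relation[OF X x P p, of "{0..1}"])
    \<comment> \<open>That the ends are pointed is part of being homotopic through pointed
      maps.\<close>
    have "f \<in> pointed_maps X x P p \<and> g \<in> pointed_maps X x P p \<and> homotopic_with (\<lambda>k. k x = p) X P f g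
        \<longleftrightarrow> f \<in> maps X P \<and> g \<in> maps X P \<and> homotopic_with (\<lambda>k. k x = p) X P f g" for f g
      using homotopic_with_imp_property[of "\<lambda>k. k x = p" X P f g] by (auto simp: pointed_maps_def)
    then show "eqrel (pointed_homotopy_classes X x P p) = {(f, g). f \<in> maps X P \<and> g \<in> maps X P \<and>
       (\<exists>H. continuous_map (prod_topology unit_space X) P H \<and>
         (\<forall>z\<in>topspace X. H (0, z) = f z \<and> H (1, z) = g z) \<and> (\<forall>t\<in>{0..1}. H (t, x) = p))}"
      by (simp only: pointed_homotopy_classes_def presentation.simps flip: homotopic_with_basepoint_iff[OF x])
  qed (auto simp: pointed_homotopy_classes_def)
  then show ?thesis
    unfolding semidefinable_def topspace_pointed_homotopy_classes
    using Polish_space_pointed_maps[OF assms] equiv_pointed_homotopy_classes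
    by (simp add: pointed_homotopy_classes_def)
qed

section \<open>Auxiliary facts on Borel functions, opposite groups and countable covers\<close>

lemma Borel_function_into_subtopology:
  assumes f: "Borel_function X Y f" and C: "\<And>x. x \<in> topspace X \<Longrightarrow> f x \<in> C"
  shows "Borel_function X (subtopology Y C) f"
  unfolding Borel_function_def
proof (rule measurable_Borel_algebraI)
  have m: "f \<in> measurable (Borel_algebra X) (Borel_algebra Y)"
    using f by (simp add: Borel_function_def)
  show "f x \<in> topspace (subtopology Y C)" if "x \<in> space (Borel_algebra X)" for x
    using measurable_space[OF m that] that C by simp
  fix U assume "openin (subtopology Y C) U"
  then obtain V where V: "openin Y V" "U = V \<inter> C" by (auto simp: openin_subtopology)
  have "f -` V \<inter> space (Borel_algebra X) \<in> sets (Borel_algebra X)"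
    using m openin_in_Borel_algebra[OF V(1)] by (rule measurable_sets)
  moreover have "f -` V \<inter> space (Borel_algebra X) = f -` U \<inter> space (Borel_algebra X)"
    using V(2) C by auto
  ultimately show "f -` U \<inter> space (Borel_algebra X) \<in> sets (Borel_algebra X)" by simp
qed

lemma group_opposite_group:
  assumes "group G"
  shows "group (opposite_group G)"
proof -
  interpret group G by fact
  show ?thesis
  proof (rule groupI)
    fix a assume a: "a \<in> carrier (opposite_group G)"
    then show "\<exists>c\<in>carrier (opposite_group G). c \<otimes>\<^bsub>opposite_group G\<^esub> a = \<one>\<^bsub>opposite_group G\<^esub>"
      by (intro bexI[of _ "inv\<^bsub>G\<^esub> a"]) (simp_all add: opposite_group_def)
  qed (simp_all add: opposite_group_def m_assoc)
qed

lemma Lindelof_space_countable_cover: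
  assumes X: "Lindelof_space X"
    and N: "\<And>x. x \<in> topspace X \<Longrightarrow> openin X (N x)" "\<And>x. x \<in> topspace X \<Longrightarrow> x \<in> N x"
  obtains D where "countable D" "D \<subseteq> topspace X" "topspace X = \<Union> (N ` D)"
proof -
  have "N x \<subseteq> topspace X" if "x \<in> topspace X" for x
    using N(1)[OF that] by (rule openin_subset)
  then have "\<Union> (N ` topspace X) = topspace X" using N(2) by blast
  moreover have "\<forall>U\<in>N ` topspace X. openin X U" using N(1) by blast
  ultimately obtain \<V> where V: "countable \<V>" "\<V> \<subseteq> N ` topspace X" "\<Union>\<V> = topspace X"
    using X[unfolded Lindelof_space_def, rule_format, of "N ` topspace X"] by auto
  then obtain D where "countable D" "D \<subseteq> topspace X" "\<V> = N ` D"
    using countable_subset_image[of \<V> N "topspace X"] by auto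
  then show ?thesis using V(3) by (intro that[of D]) simp_all
qed

section \<open>The action\<close>

locale pointed_sliding = sliding P h S
  for P :: "'b topology" and h and S +
  fixes p :: 'b and X :: "'a topology" and x :: 'a and b :: complex
  assumes p: "p \<in> topspace P" and X: "Polish_space X" "locally_compact_space X"
    and x: "x \<in> topspace X" and b: "b \<in> sphere 0 1"
begin

abbreviation A :: "('a \<Rightarrow> 'b) presentation" where "A \<equiv> pointed_homotopy_classes X x P p"

abbreviation cls :: "('a \<Rightarrow> 'b) \<Rightarrow> ('a \<Rightarrow> 'b) set" where "cls \<equiv> pointed_class X x P p"

abbreviation loops :: "(complex \<Rightarrow> 'b) set" where "loops \<equiv> pointed_maps circle b P p"

abbreviation \<pi>\<^sub>1 :: "(complex \<Rightarrow> 'b) set monoid" where "\<pi>\<^sub>1 \<equiv> fundamental_group b P p"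

text \<open>Collecting the results over all representatives avoids choices; that this is a single
  class is the content of \<open>transport_eq\<close>. The function is restricted to the quotient
  because elements of \<open>Bij\<close> are extensional.\<close>

definition transport :: "(complex \<Rightarrow> 'b) set \<Rightarrow> ('a \<Rightarrow> 'b) set \<Rightarrow> ('a \<Rightarrow> 'b) set" where
  "transport \<alpha> = (\<lambda>C\<in>quotient_set A.
     {g \<in> pointed_maps X x P p. \<exists>l\<in>\<alpha>. \<exists>f\<in>C. homotopic_along X x (loop_path b l) f g})"

lemma pointed_mapsD:
  assumes "f \<in> pointed_maps X x P p"
  shows "f \<in> maps X P" "continuous_map X P f" "f x = p"
  using assms by (simp_all add: pointed_maps_def maps_def)

section \<open>Well-definedness of the action\<close>

text \<open>The forward direction is \<open>homotopic_along_null\<close>. Through this equivalence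
  the remaining arguments reduce to the calculus of tracks.\<close>

lemma homotopic_along_const_iff:
  assumes "f \<in> pointed_maps X x P p" "g \<in> pointed_maps X x P p"
  shows "homotopic_along X x (\<lambda>_. h p) f g \<longleftrightarrow> cls f = cls g"
proof -
  have "homotopic_paths S (\<lambda>_. h p) (\<lambda>_. h p)"
    using h_in[OF p] by (auto simp: path_def path_image_def)
  then show ?thesis
    unfolding pointed_class_eq_iff[OF assms]
    using homotopic_along_null[OF _ x _ p] homotopic_imp_homotopic_along_const[OF _ x]
      pointed_mapsD assms by blast
qed

lemma homotopic_along_cls_right:
  assumes R: "homotopic_along X x \<gamma> f g" and fg: "f \<in> pointed_maps X x P p"
    "g \<in> pointed_maps X x P p" "k \<in> pointed_maps X x P p" "cls g = cls k"
  shows "homotopic_along X x \<gamma> f k"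
proof -
  have "homotopic_along X x (\<gamma> +++ (\<lambda>_. h p)) f k"
    using homotopic_along_join[OF R _ x] homotopic_along_const_iff fg by blast
  moreover have "homotopic_paths S (\<gamma> +++ (\<lambda>_. h p)) \<gamma>"
    using homotopic_paths_rconst[of \<gamma> S] homotopic_along_paths[OF R x] pointed_mapsD[OF fg(2)] by simp
  ultimately show ?thesis by (rule homotopic_along_homotopic_paths)
qed

text \<open>Go back from g to f along \<gamma>, replace f by f', and go on to g' along \<delta>. The
  resulting track, reversed \<gamma> followed by \<delta>, is null-homotopic.\<close>

lemma homotopic_along_unique:
  assumes R: "homotopic_along X x \<gamma> f g" "homotopic_along X x \<delta> f' g'"
    and \<gamma>\<delta>: "homotopic_paths S \<gamma> \<delta>" and c: "cls f = cls f'"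
    and m: "f \<in> pointed_maps X x P p" "f' \<in> pointed_maps X x P p"
      "g \<in> pointed_maps X x P p" "g' \<in> pointed_maps X x P p"
  shows "cls g = cls g'"
proof -
  have "homotopic_along X x (reversepath \<gamma>) g f" using R(1) by (rule homotopic_along_reverse)
  then have "homotopic_along X x (reversepath \<gamma>) g f'"
    by (rule homotopic_along_cls_right) (use m c in auto)
  from homotopic_along_join[OF this R(2) x]
  have 1: "homotopic_along X x (reversepath \<gamma> +++ \<delta>) g g'" .
  note gp = homotopic_along_paths[OF R(1) x]
  have "homotopic_paths S (reversepath \<gamma> +++ \<delta>) (reversepath \<gamma> +++ \<gamma>)"
    using \<gamma>\<delta> gp by (intro homotopic_paths_join homotopic_paths_sym[OF \<gamma>\<delta>])
      (auto simp: homotopic_paths_imp_pathstart)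
  moreover have "homotopic_paths S (\<lambda>_. h p) (reversepath \<gamma> +++ \<gamma>)"
    using homotopic_paths_reverse_left[OF gp(1,2)] gp(4) pointed_mapsD[OF m(3)] by simp
  ultimately have "homotopic_paths S (reversepath \<gamma> +++ \<delta>) (\<lambda>_. h p)"
    using homotopic_paths_sym homotopic_paths_trans by blast
  from homotopic_along_homotopic_paths[OF 1 this] show ?thesis
    using homotopic_along_const_iff m by blast
qed

lemma transport_eq:
  assumes l: "l \<in> loops" and f: "f \<in> pointed_maps X x P p" and g: "g \<in> pointed_maps X x P p"
    and R: "homotopic_along X x (loop_path b l) f g"
  shows "transport (pointed_class circle b P p l) (cls f) = cls g"
proof (intro Set.set_eqI iffI)
  fix k assume "k \<in> transport (pointed_class circle b P p l) (cls f)"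
  then obtain l' f' where k: "k \<in> pointed_maps X x P p" and l': "l' \<in> pointed_class circle b P p l"
    and f': "f' \<in> cls f" and R': "homotopic_along X x (loop_path b l') f' k"
    using pointed_class_in[OF f] by (auto simp: transport_def)
  have "homotopic_paths S (loop_path b l) (loop_path b l')"
    using l' mem_pointed_class[OF l] homotopic_loop_paths_iff[OF b p l] by blast
  moreover have f'm: "f' \<in> pointed_maps X x P p" "cls f = cls f'"
    using f' mem_pointed_class[OF f] pointed_class_eq_iff[OF f] by blast+
  ultimately have "cls g = cls k"
    using homotopic_along_unique[OF R R' _ _ f _ g k] by blast
  then show "k \<in> cls g" using pointed_class_self[OF k] by simp
next
  fix k assume "k \<in> cls g"
  then have k: "k \<in> pointed_maps X x P p" "cls g = cls k"
    using mem_pointed_class[OF g] pointed_class_eq_iff[OF g] by blast+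
  have "homotopic_along X x (loop_path b l) f k"
    by (rule homotopic_along_cls_right[OF R f g k])
  then show "k \<in> transport (pointed_class circle b P p l) (cls f)"
    using k pointed_class_in[OF f] pointed_class_self[OF f] pointed_class_self[OF l]
    by (auto simp: transport_def)
qed

text \<open>Postcomposition with one slide of P along the loop moves all pointed maps at once, so
  the action of a class has a lift that is even continuous.\<close>

lemma transport_lift:
  assumes l: "l \<in> loops"
  obtains G where "continuous_map (ambient A) (ambient A) G"
    "\<And>f. f \<in> pointed_maps X x P p \<Longrightarrow> G f \<in> pointed_maps X x P p"
    "\<And>f. f \<in> pointed_maps X x P p \<Longrightarrow> homotopic_along X x (loop_path b l) f (G f)"
proof -
  note lp = loop_path[OF b p l]
  obtain \<phi> N where \<phi>: "continuous_map P P \<phi>" "p \<in> N" "\<And>y. y \<in> N \<Longrightarrow> \<phi> y = p"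
    "\<And>(X :: 'a topology) x f. continuous_map X P f \<Longrightarrow> x \<in> topspace X \<Longrightarrow> f x = p \<Longrightarrow>
      homotopic_along X x (loop_path b l) f (\<phi> \<circ> f)"
    by (rule slide_along[OF lp(1,2) p lp(3) p lp(4)]) blast
  define G where "G f = restrict (\<phi> \<circ> f) (topspace X)" for f :: "'a \<Rightarrow> 'b"
  have G: "continuous_map (compact_open_topology X P) (compact_open_topology X P) G"
    unfolding G_def by (rule continuous_map_postcompose[OF \<phi>(1)])
  have Gp: "G f \<in> pointed_maps X x P p" if "f \<in> pointed_maps X x P p" for f
    using pointed_mapsD[OF that] continuous_map_funspace[OF G] \<phi>(2,3) x
    by (auto simp: pointed_maps_def G_def)
  have "continuous_map (ambient A) (ambient A) G"
    unfolding pointed_homotopy_classes_def presentation.simps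
    by (intro continuous_map_into_subtopology continuous_map_from_subtopology G)
      (use Gp in auto)
  moreover have "homotopic_along X x (loop_path b l) f (G f)" if "f \<in> pointed_maps X x P p" for f
    by (rule homotopic_along_cong[OF \<phi>(4)[OF pointed_mapsD(2)[OF that] x pointed_mapsD(3)[OF that]]])
      (simp_all add: G_def)
  ultimately show ?thesis using that Gp by blast
qed

lemma transport_one:
  assumes C: "C \<in> quotient_set A"
  shows "transport \<one>\<^bsub>\<pi>\<^sub>1\<^esub> C = C"
proof -
  obtain f where f: "f \<in> pointed_maps X x P p" "C = cls f" using C by (rule quotient_setE)
  have "homotopic_along X x (\<lambda>_. h p) f f" using homotopic_along_const_iff f(1) by blast
  then have "homotopic_along X x (loop_path b (\<lambda>z\<in>sphere 0 1. p)) f f"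
    using constant_loop_pointed(2)[OF b p] by (rule homotopic_along_homotopic_paths)
  from transport_eq[OF constant_loop_pointed(1)[OF b p] f(1) f(1) this] show ?thesis
    by (simp only: fundamental_group_one[OF b p] f(2))
qed

lemma transport_in:
  assumes \<alpha>: "\<alpha> \<in> carrier \<pi>\<^sub>1" and C: "C \<in> quotient_set A"
  shows "transport \<alpha> C \<in> quotient_set A"
proof -
  obtain f where f: "f \<in> pointed_maps X x P p" "C = cls f" using C by (rule quotient_setE)
  obtain l where l: "l \<in> loops" "\<alpha> = pointed_class circle b P p l"
    using \<alpha> by (auto simp: fundamental_group_carrier[OF b p] elim: quotient_setE)
  obtain g where "g \<in> pointed_maps X x P p" "homotopic_along X x (loop_path b l) f g"
    using transport_lift[OF l(1)] f(1) by metis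
  then show ?thesis using transport_eq[OF l(1) f(1)] l f by (simp add: pointed_class_in)
qed

text \<open>Homotopies are stacked and their tracks concatenated. The first loop acts first, which
  is why the action is a right action.\<close>

lemma transport_mult:
  assumes \<alpha>: "\<alpha> \<in> carrier \<pi>\<^sub>1" and \<beta>: "\<beta> \<in> carrier \<pi>\<^sub>1" and C: "C \<in> quotient_set A"
  shows "transport (\<alpha> \<otimes>\<^bsub>\<pi>\<^sub>1\<^esub> \<beta>) C = transport \<beta> (transport \<alpha> C)"
proof -
  obtain f where f: "f \<in> pointed_maps X x P p" "C = cls f" using C by (rule quotient_setE)
  obtain l where l: "l \<in> loops" "\<alpha> = pointed_class circle b P p l"
    using \<alpha> by (auto simp: fundamental_group_carrier[OF b p] elim: quotient_setE)
  obtain m where m: "m \<in> loops" "\<beta> = pointed_class circle b P p m"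
    using \<beta> by (auto simp: fundamental_group_carrier[OF b p] elim: quotient_setE)
  obtain g where g: "g \<in> pointed_maps X x P p" "homotopic_along X x (loop_path b l) f g"
    using transport_lift[OF l(1)] f(1) by metis
  obtain k where k: "k \<in> pointed_maps X x P p" "homotopic_along X x (loop_path b m) g k"
    using transport_lift[OF m(1)] g(1) by metis
  have "homotopic_along X x (loop_path b (circle_concat b l m)) f k"
    using homotopic_along_join[OF g(2) k(2) x] circle_concat_pointed(2)[OF b p l(1) m(1)]
    by (rule homotopic_along_homotopic_paths)
  from transport_eq[OF circle_concat_pointed(1)[OF b p l(1) m(1)] f(1) k(1) this]
  show ?thesis
    using transport_eq[OF l(1) f(1) g] transport_eq[OF m(1) g(1) k]
    by (simp add: l m f fundamental_group_mult[OF b p])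
qed

lemma transport_Bij:
  assumes \<alpha>: "\<alpha> \<in> carrier \<pi>\<^sub>1"
  shows "transport \<alpha> \<in> Bij (quotient_set A)"
proof -
  interpret group \<pi>\<^sub>1 by (rule group_fundamental_group[OF b p])
  have i: "inv\<^bsub>\<pi>\<^sub>1\<^esub> \<alpha> \<in> carrier \<pi>\<^sub>1" using \<alpha> by (rule inv_closed)
  have "transport (inv\<^bsub>\<pi>\<^sub>1\<^esub> \<alpha>) (transport \<alpha> C) = C" "transport \<alpha> (transport (inv\<^bsub>\<pi>\<^sub>1\<^esub> \<alpha>) C) = C"
    if "C \<in> quotient_set A" for C
    using transport_mult[OF \<alpha> i that] transport_mult[OF i \<alpha> that] transport_one[OF that] \<alpha>
    by (simp_all add: r_inv l_inv)
  then have "bij_betw (transport \<alpha>) (quotient_set A) (quotient_set A)"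
    using transport_in[OF \<alpha>] transport_in[OF i]
    by (intro bij_betw_byWitness[where f' = "transport (inv\<^bsub>\<pi>\<^sub>1\<^esub> \<alpha>)"]) auto
  then show ?thesis by (simp add: Bij_def transport_def)
qed

lemma group_action_transport:
  "group_action (opposite_group \<pi>\<^sub>1) (quotient_set A) transport"
  unfolding group_action_def group_hom_def group_hom_axioms_def
proof (intro conjI homI)
  show "group (opposite_group \<pi>\<^sub>1)"
    by (rule group_opposite_group[OF group_fundamental_group[OF b p]])
  show "group (BijGroup (quotient_set A))" by (rule group_BijGroup)
  have op: "carrier (opposite_group \<pi>\<^sub>1) = carrier \<pi>\<^sub>1"
    "\<alpha> \<otimes>\<^bsub>opposite_group \<pi>\<^sub>1\<^esub> \<beta> = \<beta> \<otimes>\<^bsub>\<pi>\<^sub>1\<^esub> \<alpha>" for \<alpha> \<beta>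
    by (simp_all add: opposite_group_def)
  fix \<alpha> assume "\<alpha> \<in> carrier (opposite_group \<pi>\<^sub>1)"
  then have \<alpha>: "\<alpha> \<in> carrier \<pi>\<^sub>1" by (simp only: op)
  show "transport \<alpha> \<in> carrier (BijGroup (quotient_set A))"
    using transport_Bij[OF \<alpha>] by (simp add: BijGroup_def)
  fix \<beta> assume "\<beta> \<in> carrier (opposite_group \<pi>\<^sub>1)"
  then have \<beta>: "\<beta> \<in> carrier \<pi>\<^sub>1" by (simp only: op)
  \<comment> \<open>The swapped factors of the opposite group compensate the reversed order in
    \<open>transport_mult\<close>.\<close>
  have "transport (\<beta> \<otimes>\<^bsub>\<pi>\<^sub>1\<^esub> \<alpha>) = compose (quotient_set A) (transport \<alpha>) (transport \<beta>)"
  proof (rule extensionalityI[of _ "quotient_set A"])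
    fix C assume "C \<in> quotient_set A"
    then show "transport (\<beta> \<otimes>\<^bsub>\<pi>\<^sub>1\<^esub> \<alpha>) C = compose (quotient_set A) (transport \<alpha>) (transport \<beta>) C"
      using transport_mult[OF \<beta> \<alpha>] by (simp add: compose_eq)
  qed (simp_all add: transport_def)
  then show "transport (\<alpha> \<otimes>\<^bsub>opposite_group \<pi>\<^sub>1\<^esub> \<beta>)
      = transport \<alpha> \<otimes>\<^bsub>BijGroup (quotient_set A)\<^esub> transport \<beta>"
    using transport_Bij[OF \<alpha>] transport_Bij[OF \<beta>] by (simp add: op(2) BijGroup_def)
qed

lemma definable_transport: "definable_right_action \<pi>\<^sub>1 A transport"
  unfolding definable_right_action_def definable_left_action_def
proof (intro conjI ballI)
  show "semidefinable A" by (rule semidefinable_pointed_homotopy_classes[OF X x Polish p])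
  show "group_action (opposite_group \<pi>\<^sub>1) (quotient_set A) transport"
    by (rule group_action_transport)
  fix \<alpha> assume "\<alpha> \<in> carrier (opposite_group \<pi>\<^sub>1)"
  then obtain l where l: "l \<in> loops" "\<alpha> = pointed_class circle b P p l"
    by (auto simp: opposite_group_def fundamental_group_carrier[OF b p] elim: quotient_setE)
  obtain G where G: "continuous_map (ambient A) (ambient A) G"
    "\<And>f. f \<in> pointed_maps X x P p \<Longrightarrow> G f \<in> pointed_maps X x P p"
    "\<And>f. f \<in> pointed_maps X x P p \<Longrightarrow> homotopic_along X x (loop_path b l) f (G f)"
    using transport_lift[OF l(1)] by blast
  show "definable_function A A (transport \<alpha>)"
    unfolding definable_function_def
  proof (intro exI[of _ G] conjI ballI)
    show "Borel_function (ambient A) (ambient A) G" by (rule continuous_imp_Borel_function[OF G(1)])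
    fix f assume "f \<in> topspace (ambient A)"
    then have f: "f \<in> pointed_maps X x P p" by simp
    show "transport \<alpha> (eqrel A `` {f}) = eqrel A `` {G f}"
      using transport_eq[OF l(1) f G(2)[OF f] G(3)[OF f]] by (simp add: l pointed_class_def)
  qed
qed

section \<open>The orbit space\<close>

abbreviation A_orbits :: "('a \<Rightarrow> 'b) presentation" where
  "A_orbits \<equiv> orbit_space \<pi>\<^sub>1 A transport"

lemma ambient_orbits [simp]: "ambient A_orbits = ambient A"
  by (simp add: orbit_space_def)

text \<open>The track of a free homotopy between pointed maps is a closed path at h p, hence comes
  from a loop, and transport along that loop takes one class to the other.\<close>

lemma eqrel_orbits:
  "eqrel A_orbits = {(f, g). f \<in> pointed_maps X x P p \<and> g \<in> pointed_maps X x P p \<and>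
     homotopic_with (\<lambda>_. True) X P f g}"
proof -
  have "(\<exists>\<alpha>\<in>carrier \<pi>\<^sub>1. transport \<alpha> (cls f) = cls g) \<longleftrightarrow> homotopic_with (\<lambda>_. True) X P f g"
    if f: "f \<in> pointed_maps X x P p" and g: "g \<in> pointed_maps X x P p" for f g
  proof
    assume "\<exists>\<alpha>\<in>carrier \<pi>\<^sub>1. transport \<alpha> (cls f) = cls g"
    then obtain l where l: "l \<in> loops" "transport (pointed_class circle b P p l) (cls f) = cls g"
      by (auto simp: fundamental_group_carrier[OF b p] elim: quotient_setE)
    obtain k where k: "k \<in> pointed_maps X x P p" "homotopic_along X x (loop_path b l) f k"
      using transport_lift[OF l(1)] f by metis
    have "cls k = cls g" using transport_eq[OF l(1) f k] l(2) by simp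
    then have "homotopic_along X x (loop_path b l) f g"
      using homotopic_along_cls_right[OF k(2) f k(1) g] by simp
    then show "homotopic_with (\<lambda>_. True) X P f g" by (rule homotopic_along_imp_homotopic)
  next
    assume "homotopic_with (\<lambda>_. True) X P f g"
    then obtain \<gamma> where R: "homotopic_along X x \<gamma> f g"
      using homotopic_imp_homotopic_along[OF _ x] by blast
    note gp = homotopic_along_paths[OF R x]
    obtain l where l: "l \<in> loops" "\<And>s. s \<in> {0..1} \<Longrightarrow> loop_path b l s = \<gamma> s"
      using loop_of_path[OF b p gp(1,2)] gp(3,4) pointed_mapsD(3)[OF f] pointed_mapsD(3)[OF g] by metis
    have "homotopic_paths S \<gamma> (loop_path b l)" using l(2) by (intro homotopic_paths_eq gp) simp
    from homotopic_along_homotopic_paths[OF R this]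
    have "transport (pointed_class circle b P p l) (cls f) = cls g"
      by (rule transport_eq[OF l(1) f g])
    moreover have "pointed_class circle b P p l \<in> carrier \<pi>\<^sub>1"
      using l(1) by (simp add: fundamental_group_carrier[OF b p] pointed_class_in)
    ultimately show "\<exists>\<alpha>\<in>carrier \<pi>\<^sub>1. transport \<alpha> (cls f) = cls g" by blast
  qed
  then show ?thesis
    unfolding orbit_space_def presentation.simps topspace_pointed_homotopy_classes
      pointed_class_def[symmetric] by blast
qed

text \<open>By \<open>eqrel_orbits\<close> no quantifier over the group remains: the relation asks
  for a homotopy whose track is at p at the times 0 and 1.\<close>

lemma semidefinable_orbits: "semidefinable A_orbits"
proof -
  let ?R = "eqrel A_orbits"
  have "equiv (pointed_maps X x P p) ?R"
  proof (rule equivI)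
    show "?R \<subseteq> pointed_maps X x P p \<times> pointed_maps X x P p" by (auto simp: eqrel_orbits)
    show "refl_on (pointed_maps X x P p) ?R"
      by (rule refl_onI) (auto simp: eqrel_orbits pointed_mapsD)
    show "sym ?R" by (rule symI) (auto simp: eqrel_orbits intro: homotopic_with_symD)
    show "trans ?R" by (rule transI) (auto simp: eqrel_orbits intro: homotopic_with_trans)
  qed
  moreover have "analytic_in (prod_topology (subtopology (compact_open_topology X P) (pointed_maps X x P p))
      (subtopology (compact_open_topology X P) (pointed_maps X x P p))) ?R"
  proof (rule analytic_homotopy_relation[OF X x Polish p, of "{0, 1}"])
    show "?R = {(f, g). f \<in> maps X P \<and> g \<in> maps X P \<and>
       (\<exists>H. continuous_map (prod_topology unit_space X) P H \<and>
         (\<forall>z\<in>topspace X. H (0, z) = f z \<and> H (1, z) = g z) \<and> (\<forall>t\<in>{0, 1}. H (t, x) = p))}"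
      unfolding eqrel_orbits homotopic_with_True_iff pointed_maps_def using x by auto
  qed (auto simp: eqrel_orbits)
  ultimately show ?thesis
    unfolding semidefinable_def ambient_orbits topspace_pointed_homotopy_classes
    using Polish_space_pointed_maps[OF X x Polish p]
    by (simp add: pointed_homotopy_classes_def)
qed

text \<open>Near each point \<open>y\<close> of \<open>P\<close> a single slide along a path from \<open>y\<close> to \<open>p\<close> is constant with
  value \<open>p\<close>, so countably many slides suffice to move all maps to pointed ones.\<close>

lemma Borel_pointing:
  assumes P: "path_connected_space P"
  obtains G where "Borel_function (compact_open_topology X P) (ambient A) G"
    "\<And>f. f \<in> maps X P \<Longrightarrow> G f \<in> pointed_maps X x P p"
    "\<And>f. f \<in> maps X P \<Longrightarrow> homotopic_with (\<lambda>_. True) X P f (G f)"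
proof -
  \<comment> \<open>One predicate holds all requirements on a slide, so that slide and neighbourhood
    can be chosen together for every y.\<close>
  define good where "good y \<phi> N \<longleftrightarrow> continuous_map P P \<phi> \<and> openin P N \<and> y \<in> N \<and> (\<forall>z\<in>N. \<phi> z = p) \<and>
      (\<forall>f. continuous_map X P f \<longrightarrow> homotopic_with (\<lambda>_. True) X P f (\<phi> \<circ> f))" for y \<phi> N
  have "\<exists>\<phi> N. good y \<phi> N" if y: "y \<in> topspace P" for y
  proof -
    obtain c where c: "continuous_map unit_space P c" "c 0 = y" "c 1 = p"
      using P y p unfolding path_connected_space_def pathin_def by blast
    from continuous_map_compose[OF c(1) h_continuous]
    have hc: "path (h \<circ> c)" "path_image (h \<circ> c) \<subseteq> S" "pathstart (h \<circ> c) = h y" "pathfinish (h \<circ> c) = h p"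
      using c(2,3) by (auto simp: path_def path_image_def pathstart_def pathfinish_def)
    obtain \<phi> N where \<phi>: "continuous_map P P \<phi>" "openin P N" "y \<in> N" "\<And>z. z \<in> N \<Longrightarrow> \<phi> z = p"
      "\<And>(X :: 'a topology) x f. continuous_map X P f \<Longrightarrow> x \<in> topspace X \<Longrightarrow> f x = y \<Longrightarrow>
        homotopic_along X x (h \<circ> c) f (\<phi> \<circ> f)"
      "\<And>(X :: 'a topology) f. continuous_map X P f \<Longrightarrow> homotopic_with (\<lambda>_. True) X P f (\<phi> \<circ> f)"
      by (rule slide_along[where ?'a = 'a, OF hc(1,2) y hc(3) p hc(4)]) (rule that, assumption+)
    have "good y \<phi> N" using \<phi>(1-4,6) unfolding good_def by blast
    then show ?thesis by blast
  qed
  then obtain \<phi> N where good: "\<And>y. y \<in> topspace P \<Longrightarrow> good y (\<phi> y) (N y)"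
    by metis
  have \<phi>: "continuous_map P P (\<phi> y)" and N: "openin P (N y)" "y \<in> N y"
    and N\<phi>: "z \<in> N y \<Longrightarrow> \<phi> y z = p"
    and h\<phi>: "continuous_map X P f \<Longrightarrow> homotopic_with (\<lambda>_. True) X P f (\<phi> y \<circ> f)"
    if "y \<in> topspace P" for y z f
    using good[OF that] unfolding good_def by blast+
  have "Lindelof_space P"
    using Polish by (intro second_countable_imp_Lindelof_space) (simp add: Polish_space_iff_second_countable)
  from Lindelof_space_countable_cover[OF this N]
  obtain D where D: "countable D" "D \<subseteq> topspace P" "topspace P = \<Union> (N ` D)" .
  have "D \<noteq> {}" using D(3) p by blast
  define d where "d = from_nat_into D"
  have d: "range d = D" unfolding d_def using \<open>D \<noteq> {}\<close> D(1) by (rule range_from_nat_into)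
  then have dP: "d n \<in> topspace P" for n using D(2) by blast
  \<comment> \<open>Which slide is applied to f depends only on the position of f x, and these sets
    are open by continuity of evaluation at x.\<close>
  define M where "M n = {f \<in> maps X P. f x \<in> N (d n)}" for n
  define F where "F n f = restrict (\<phi> (d n) \<circ> f) (topspace X)" for n and f :: "'a \<Rightarrow> 'b"
  define k where "k f = (LEAST n. f \<in> M n)" for f
  let ?C = "compact_open_topology X P"
  have F: "continuous_map ?C ?C (F n)" for n
    unfolding F_def by (rule continuous_map_postcompose[OF \<phi>[OF dP]])
  have M: "openin ?C (M n)" for n
    using openin_continuous_map_preimage[OF continuous_map_evaluation[OF x] N(1)[OF dP], of n]
    by (simp add: M_def)
  have cover: "topspace ?C \<subseteq> (\<Union>n. M n)"
  proof
    fix f assume "f \<in> topspace ?C"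
    then have f: "f \<in> maps X P" by simp
    then have "f x \<in> \<Union> (N ` range d)" using maps_in[OF f x] D(3) d by simp
    then show "f \<in> (\<Union>n. M n)" using f by (auto simp: M_def)
  qed
  have k: "f x \<in> N (d (k f))" if "f \<in> maps X P" for f
  proof -
    have "\<exists>n. f \<in> M n" using cover that by auto
    then have "f \<in> M (k f)" unfolding k_def by (rule LeastI_ex)
    then show ?thesis by (simp add: M_def)
  qed
  have FP: "F (k f) f \<in> pointed_maps X x P p" if f: "f \<in> maps X P" for f
  proof -
    have "F (k f) f \<in> maps X P" using continuous_map_funspace[OF F[of "k f"]] f by auto
    moreover have "F (k f) f x = p" using N\<phi>[OF dP k[OF f]] x by (simp add: F_def)
    ultimately show ?thesis by (simp add: pointed_maps_def)
  qed
  show ?thesis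
  proof (rule that[of "\<lambda>f. F (k f) f"])
    have "Borel_function ?C ?C (\<lambda>f. F (k f) f)"
      unfolding k_def using M cover F by (rule Borel_function_piecewise)
    then have "Borel_function ?C (subtopology ?C (pointed_maps X x P p)) (\<lambda>f. F (k f) f)"
      by (rule Borel_function_into_subtopology) (use FP in simp)
    then show "Borel_function ?C (ambient A) (\<lambda>f. F (k f) f)"
      by (simp add: pointed_homotopy_classes_def)
    fix f assume f: "f \<in> maps X P"
    show "F (k f) f \<in> pointed_maps X x P p" by (rule FP[OF f])
    show "homotopic_with (\<lambda>_. True) X P f (F (k f) f)"
      by (rule homotopic_with_eq[OF h\<phi>[OF dP maps_continuous[OF f], of "k f"]]) (simp_all add: F_def)
  qed
qed

text \<open>An orbit is sent to the free homotopy class that contains it, a map lifted by the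
  inclusion of the pointed maps. It is injective since the orbit relation is free homotopy
  restricted to pointed maps, and the Borel map of \<open>Borel_pointing\<close> gives surjectivity
  and lifts the inverse.\<close>

lemma orbits_definably_isomorphic:
  assumes P: "path_connected_space P"
  shows "definably_isomorphic A_orbits (homotopy_classes X P)"
proof -
  let ?B = "homotopy_classes X P"
  let ?F = "\<lambda>C. eqrel ?B `` C"
  have sB: "semidefinable ?B" by (rule semidefinable_homotopy_classes[OF X x Polish p])
  have sA: "semidefinable A_orbits" by (rule semidefinable_orbits)
  have eA: "equiv (pointed_maps X x P p) (eqrel A_orbits)"
    using sA by (simp add: semidefinable_def)
  have tB: "topspace (ambient ?B) = maps X P" by (simp add: homotopy_classes_def)
  have eB: "equiv (maps X P) (eqrel ?B)"
    using sB by (simp add: semidefinable_def tB)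
  have B: "(f, g) \<in> eqrel ?B \<longleftrightarrow> f \<in> maps X P \<and> g \<in> maps X P \<and> homotopic_with (\<lambda>_. True) X P f g" for f g
    by (simp add: homotopy_classes_def)
  have F: "?F (eqrel A_orbits `` {f}) = eqrel ?B `` {f}" if f: "f \<in> pointed_maps X x P p" for f
  proof -
    have "(f, g) \<in> eqrel ?B" if "(f, g) \<in> eqrel A_orbits" for g
      using that by (simp add: B eqrel_orbits pointed_mapsD(1))
    moreover have "(f, f) \<in> eqrel A_orbits" using eA f by (meson equivE refl_onD)
    moreover have "trans (eqrel ?B)" using eB by (meson equivE)
    ultimately show ?thesis by (blast dest: transD)
  qed
  obtain G where G: "Borel_function (compact_open_topology X P) (ambient A) G"
    "\<And>f. f \<in> maps X P \<Longrightarrow> G f \<in> pointed_maps X x P p"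
    "\<And>f. f \<in> maps X P \<Longrightarrow> homotopic_with (\<lambda>_. True) X P f (G f)"
    using Borel_pointing[OF P] by blast
  have FG: "?F (eqrel A_orbits `` {G f}) = eqrel ?B `` {f}" if f: "f \<in> maps X P" for f
  proof -
    have "(f, G f) \<in> eqrel ?B" using G(2,3)[OF f] f by (simp add: B pointed_mapsD(1))
    then have "eqrel ?B `` {f} = eqrel ?B `` {G f}" by (rule equiv_class_eq[OF eB])
    then show ?thesis using F[OF G(2)[OF f]] by simp
  qed
  have qA: "quotient_set A_orbits = pointed_maps X x P p // eqrel A_orbits"
    by (simp add: quotient_set_def)
  have qB: "quotient_set ?B = maps X P // eqrel ?B" by (simp add: quotient_set_def tB)
  have bij: "bij_betw ?F (quotient_set A_orbits) (quotient_set ?B)"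
    unfolding bij_betw_def qA qB
  proof
    show "inj_on ?F (pointed_maps X x P p // eqrel A_orbits)"
    proof (rule inj_onI)
      fix C D assume C: "C \<in> pointed_maps X x P p // eqrel A_orbits"
        and D: "D \<in> pointed_maps X x P p // eqrel A_orbits" and CD: "?F C = ?F D"
      obtain f where f: "f \<in> pointed_maps X x P p" "C = eqrel A_orbits `` {f}" using C by (rule quotientE)
      obtain g where g: "g \<in> pointed_maps X x P p" "D = eqrel A_orbits `` {g}" using D by (rule quotientE)
      have "eqrel ?B `` {f} = eqrel ?B `` {g}" using CD f g F by metis
      then have "(f, g) \<in> eqrel ?B"
        using eq_equiv_class[OF _ eB] pointed_mapsD(1)[OF g(1)] by blast
      then have "(f, g) \<in> eqrel A_orbits" using f g by (simp add: B eqrel_orbits)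
      then show "C = D" using equiv_class_eq[OF eA] f g by blast
    qed
    show "?F ` (pointed_maps X x P p // eqrel A_orbits) = maps X P // eqrel ?B"
    proof (intro equalityI subsetI)
      fix D assume "D \<in> ?F ` (pointed_maps X x P p // eqrel A_orbits)"
      then obtain f where f: "f \<in> pointed_maps X x P p" "D = ?F (eqrel A_orbits `` {f})"
        by (auto elim!: quotientE)
      then have "D = eqrel ?B `` {f}" using F by simp
      then show "D \<in> maps X P // eqrel ?B" using quotientI[OF pointed_mapsD(1)[OF f(1)]] by simp
    next
      fix D assume "D \<in> maps X P // eqrel ?B"
      then obtain f where f: "f \<in> maps X P" "D = eqrel ?B `` {f}" by (rule quotientE)
      then have "D = ?F (eqrel A_orbits `` {G f})" using FG by simp
      moreover have "eqrel A_orbits `` {G f} \<in> pointed_maps X x P p // eqrel A_orbits"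
        by (rule quotientI[OF G(2)[OF f(1)]])
      ultimately show "D \<in> ?F ` (pointed_maps X x P p // eqrel A_orbits)" by blast
    qed
  qed
  have "definable_function A_orbits ?B ?F"
    unfolding definable_function_def
  proof (intro exI[of _ "\<lambda>f. f"] conjI ballI)
    have "continuous_map (ambient A) (compact_open_topology X P) (\<lambda>f. f)"
      unfolding pointed_homotopy_classes_def presentation.simps
      by (intro continuous_map_from_subtopology continuous_map_id[unfolded id_def])
    from continuous_imp_Borel_function[OF this]
    show "Borel_function (ambient A_orbits) (ambient ?B) (\<lambda>f. f)"
      by (simp add: homotopy_classes_def)
  qed (use F in simp)
  moreover have "definable_function ?B A_orbits (inv_into (quotient_set A_orbits) ?F)"
    unfolding definable_function_def
  proof (intro exI[of _ G] conjI ballI)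
    show "Borel_function (ambient ?B) (ambient A_orbits) G"
      using G(1) by (simp add: homotopy_classes_def)
    fix f assume "f \<in> topspace (ambient ?B)"
    then have f: "f \<in> maps X P" by (simp add: tB)
    have "eqrel A_orbits `` {G f} \<in> quotient_set A_orbits"
      unfolding qA by (rule quotientI[OF G(2)[OF f]])
    from inv_into_f_f[OF bij_betw_imp_inj_on[OF bij] this]
    show "inv_into (quotient_set A_orbits) ?F (eqrel ?B `` {f}) = eqrel A_orbits `` {G f}"
      by (simp only: FG[OF f])
  qed
  ultimately have "definable_isomorphism A_orbits ?B ?F"
    using sA sB bij by (simp add: definable_isomorphism_def)
  then show ?thesis by (auto simp: definably_isomorphic_def)
qed

end

theorem theorem6p5:
  fixes P :: "'b topology" and p :: 'b
    and X :: "'a topology" and x :: 'a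
    and b :: complex
  assumes "polyhedron_space P" and "path_connected_space P" and "p \<in> topspace P"
    and "Polish_space X" and "locally_compact_space X" and "x \<in> topspace X"
    and "b \<in> topspace circle"
  shows "\<exists>\<phi>. definable_right_action (fundamental_group b P p)
                (pointed_homotopy_classes X x P p) \<phi> \<and>
             definably_isomorphic
               (orbit_space (fundamental_group b P p) (pointed_homotopy_classes X x P p) \<phi>)
               (homotopy_classes X P)"
proof -
  obtain h S where "sliding P h S" using polyhedron_sliding[OF assms(1)] .
  then interpret pointed_sliding P h S p X x b
    using assms by (simp add: pointed_sliding_def pointed_sliding_axioms_def)
  show ?thesis
    using definable_transport orbits_definably_isomorphic[OF assms(2)] by blast
qed

end
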